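(* Let $p\in(1,\infty)$ and let $(X,d)$ be a complete metric space. Let $\Psi$ be a scale function, and suppose there exists a regular local $p$-Dirichlet space $(X,d,m,\mathcal{E}_p,\mathcal{F}_p,\Gamma_p)$ that satisfies the volume doubling property $\mathrm{VD}$ and the Poincaré inequality $\mathrm{PI}_p(\Psi)$. (1) If $\liminf_{r\downarrow 0}\frac{\Psi(r)}{r^{p}}=0$, then the vanishing $p$-modulus property $\mathrm{VM}_p$ holds for $(X,d,m)$. (2) Suppose in addition that $(X,d)$ satisfies the chain condition and that the capacity upper bound $\mathrm{Cap}_p(\Psi)_{\le}$ holds. If $\liminf_{r\downarrow 0}\frac{\Psi(r)}{r^{p}}>0$, then $\mathrm{VM}_p$ fails for $(X,d,m)$.
   Context: Balls $B(x,r)$ are open $d$-balls. Regular local $p$-Dirichlet space ($p\in[1,\infty)$): a tuple $(X,d,m,\mathcal{E}_p,\mathcal{F}_p,\Gamma_p)$ such that: (1) $(X,d)$ is a locally compact separable metric space with $\#X\ge 2$ and $m$ is a Radon measure on $X$ with full support. (2) $\mathcal{F}_p$ is a linear subspace of $L^p(X,m)$, $\mathcal{E}_p:\mathcal{F}_p\to[0,\infty)$, and $(\mathcal{F}_p,\mathcal{E}_{p,1}^{1/p})$ is a Banach space, where $\mathcal{E}_{p,1}(\cdot):=\mathcal{E}_p(\cdot)+\|\cdot\|_{L^p(X,m)}^p$. (3) For each $f\in\mathcal{F}_p$ there is a finite non-negative Borel measure $\Gamma_p\langle f\rangle$ on $X$ (the energy measure) with $\Gamma_p\langle f\rangle(X)=\mathcal{E}_p(f)$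 and $\Gamma_p\langle\lambda f\rangle=|\lambda|^p\Gamma_p\langle f\rangle$ for all $\lambda\in\mathbb{R}$. (4) $\Gamma_p\langle f+g\rangle(A)^{1/p}\le\Gamma_p\langle f\rangle(A)^{1/p}+\Gamma_p\langle g\rangle(A)^{1/p}$ for all $f,g\in\mathcal{F}_p$ and Borel $A\subset X$. (5) For $f\in\mathcal{F}_p$ and Lipschitz $g:\mathbb{R}\to\mathbb{R}$ with $g(0)=0$: $g\circ f\in\mathcal{F}_p$ and $\Gamma_p\langle g\circ f\rangle\le \mathrm{LIP}[g]^p\,\Gamma_p\langle f\rangle$, where $\mathrm{LIP}[g]$ is the smallest Lipschitz constant of $g$. (6) If $f\in\mathcal{F}_p$, $A\subset X$ is open and $f|_A$ equals a constant $m$-a.e., then $\Gamma_p\langle f\rangle(A)=0$. (7) If $f\in L^p(X,m)$, $f_j\in\mathcal{F}_p$, $f_j\to f$ in $L^p(X,m)$ and $\sup_j\mathcal{E}_p(f_j)<\infty$, then $f\in\mathcal{F}_p$ and $\Gamma_p\langle f\rangle(A)\le\liminf_{j\to\infty}\Gamma_p\langle f_j\rangle(A)$ for every Borel $A\subset X$. (8) $C_c(X)\cap\mathcal{F}_p$ is dense in $(\mathcal{F}_p,\mathcal{E}_{p,1}^{1/p})$ and in $(C_c(X),\|\cdot\|_{\sup})$. $\mathrm{VD}$: there is $C_{\mathrm{VD}}\in(1,\infty)$ with $0<m(B(x,2r))\le C_{\mathrm{VD}}\,m(B(x,r))<\infty$ for all $(x,r)\in X\times(0,\infty)$. Scale function: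 a continuous increasing bijection $\Psi:(0,\infty)\to(0,\infty)$ for which there are constants $C_\Psi\in[1,\infty)$, $\beta_1,\beta_2\in(0,\infty)$ with $C_\Psi^{-1}(R/r)^{\beta_1}\le\Psi(R)/\Psi(r)\le C_\Psi(R/r)^{\beta_2}$ for all $0<r\le R<\infty$. $\mathrm{PI}_p(\Psi)$: there are $C_{\mathrm{PI}}\in(0,\infty)$, $A_{\mathrm{PI}}\in[1,\infty)$ such that for all $x\in X$, $r\in(0,\infty)$, $u\in\mathcal{F}_p$, $\int_{B(x,r)}|u-u_{B(x,r)}|^p\,dm\le C_{\mathrm{PI}}\Psi(r)\,\Gamma_p\langle u\rangle(B(x,A_{\mathrm{PI}}r))$, where $u_{B}:=m(B)^{-1}\int_B u\,dm$. $\mathrm{Cap}_p(\Psi)_{\le}$: for disjoint non-empty Borel sets $A,B$ put $\mathrm{Cap}_p(A,B):=\inf\{\mathcal{E}_p(f): f\in\mathcal{F}_p,\ f|_A=0\ m\text{-a.e.},\ f|_B=1\ m\text{-a.e.}\}$. The condition says there are $C\in(0,\infty)$, $A\in(1,\infty)$ with $\mathrm{Cap}_p(B(x,r),X\setminus B(x,Ar))\le C\,m(B(x,r))/\Psi(r)$ for all $(x,r)\in X\times(0,\infty)$ (nothing is required when $X\setminus B(x,Ar)=\emptyset$). Chain condition: an $\epsilon$-chain between $x$ and $y$ is a finite sequence $x_0=x,x_1,\dots,x_N=y$, $N\in\mathbb{N}$, with $d(x_j,x_{j+1})<\epsilon$ for all $j$; $d_\epsilon(x,y)$ is the infimum of $\sum_{j=0}^{N-1}d(x_j,x_{j+1})$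 over all $\epsilon$-chains between $x$ and $y$. $(X,d)$ satisfies the chain condition if there is $C\in[1,\infty)$ with $d_\epsilon(x,y)\le C\,d(x,y)$ for all $\epsilon>0$, $x,y\in X$. Modulus: curves are non-constant continuous maps from an interval into $X$. For a family $\Gamma$ of curves, a Borel $\rho:X\to[0,\infty]$ is admissible if $\int_\gamma\rho\,ds\ge 1$ for every locally rectifiable $\gamma\in\Gamma$, and $\mathrm{Mod}_p(\Gamma):=\inf\{\int_X\rho^p\,dm:\rho\text{ admissible for }\Gamma\}$. $(X,d,m)$ satisfies $\mathrm{VM}_p$ if $\mathrm{Mod}_p(\Gamma)=0$ for every family $\Gamma$ of curves in $(X,d)$. *)

theory Defs
  imports "HOL-Analysis.Analysis"
begin

text \<open>
  The metric space is the whole of a type \<open>'a :: metric_space\<close>.  An element of an \<open>L\<^sup>p\<close>-type space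
  is represented by any of its Borel representatives \<open>f :: 'a \<Rightarrow> real\<close>; identities between
  elements are therefore identities almost everywhere.
\<close>

definition radon_measure :: "'a::metric_space measure \<Rightarrow> bool" where
  "radon_measure M \<longleftrightarrow>
     sets M = sets borel \<and>
     (\<forall>K. compact K \<longrightarrow> emeasure M K < \<infinity>) \<and>
     (\<forall>A\<in>sets borel. emeasure M A = (INF U\<in>{U. open U \<and> A \<subseteq> U}. emeasure M U)) \<and>
     (\<forall>U. open U \<longrightarrow> emeasure M U = (SUP K\<in>{K. compact K \<and> K \<subseteq> U}. emeasure M K))"

definition full_support :: "'a::metric_space measure \<Rightarrow> bool" where
  "full_support M \<longleftrightarrow> (\<forall>U. open U \<and> U \<noteq> {} \<longrightarrow> 0 < emeasure M U)"

definition Lp_space :: "real \<Rightarrow> 'a measure \<Rightarrow> ('a \<Rightarrow> real) set" where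
  "Lp_space p M = {f \<in> borel_measurable M. integrable M (\<lambda>x. \<bar>f x\<bar> powr p)}"

definition Lp_norm :: "real \<Rightarrow> 'a measure \<Rightarrow> ('a \<Rightarrow> real) \<Rightarrow> real" where
  "Lp_norm p M f = (\<integral>x. \<bar>f x\<bar> powr p \<partial>M) powr (1 / p)"

text \<open>\<open>F\<close> is a Banach space under \<open>N\<close> once functions agreeing almost everywhere are identified.\<close>

definition banach_space_mod_ae ::
  "'a measure \<Rightarrow> ('a \<Rightarrow> real) set \<Rightarrow> (('a \<Rightarrow> real) \<Rightarrow> real) \<Rightarrow> bool" where
  "banach_space_mod_ae M F N \<longleftrightarrow>
     (\<forall>f\<in>F. 0 \<le> N f \<and> (N f = 0 \<longleftrightarrow> (AE x in M. f x = 0))) \<and>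
     (\<forall>f\<in>F. \<forall>c. N (\<lambda>x. c * f x) = \<bar>c\<bar> * N f) \<and>
     (\<forall>f\<in>F. \<forall>g\<in>F. N (\<lambda>x. f x + g x) \<le> N f + N g) \<and>
     (\<forall>u::nat \<Rightarrow> 'a \<Rightarrow> real.
        (\<forall>n. u n \<in> F) \<and>
        (\<forall>e>0. \<exists>n0. \<forall>i\<ge>n0. \<forall>j\<ge>n0. N (\<lambda>x. u i x - u j x) < e) \<longrightarrow>
        (\<exists>f\<in>F. (\<lambda>n. N (\<lambda>x. u n x - f x)) \<longlonglongrightarrow> 0))"

definition Cc_space :: "('a::metric_space \<Rightarrow> real) set" where
  "Cc_space = {f. continuous_on UNIV f \<and> compact (closure {x. f x \<noteq> 0})}"

definition best_lipschitz :: "(real \<Rightarrow> real) \<Rightarrow> real" where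
  "best_lipschitz g = Inf {L. L-lipschitz_on UNIV g}"

definition E1_norm ::
  "real \<Rightarrow> 'a measure \<Rightarrow> (('a \<Rightarrow> real) \<Rightarrow> real) \<Rightarrow> ('a \<Rightarrow> real) \<Rightarrow> real" where
  "E1_norm p M E f = (E f + Lp_norm p M f powr p) powr (1 / p)"

locale regular_local_dirichlet_space =
  fixes p :: real
    and M :: "'a::metric_space measure"
    and E :: "('a \<Rightarrow> real) \<Rightarrow> real"
    and F :: "('a \<Rightarrow> real) set"
    and \<Gamma> :: "('a \<Rightarrow> real) \<Rightarrow> 'a measure"
  assumes p_ge_1: "1 \<le> p"
    and locally_compact: "locally_compact_space (euclidean :: 'a topology)"
    and separable: "separable_space (euclidean :: 'a topology)"
    and two_points: "\<exists>x y :: 'a. x \<noteq> y"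
    and radon: "radon_measure M"
    and full_support: "full_support M"
    \<comment> \<open>well-definedness of the data on classes of functions modulo almost everywhere equality\<close>
    and ae_closed: "\<And>f g. f \<in> F \<Longrightarrow> g \<in> borel_measurable M \<Longrightarrow> (AE x in M. f x = g x) \<Longrightarrow>
                      g \<in> F \<and> E g = E f \<and> \<Gamma> g = \<Gamma> f"
    and F_subset_Lp: "F \<subseteq> Lp_space p M"
    and zero_in_F: "(\<lambda>x. 0) \<in> F"
    and add_in_F: "\<And>f g. f \<in> F \<Longrightarrow> g \<in> F \<Longrightarrow> (\<lambda>x. f x + g x) \<in> F"
    and scale_in_F: "\<And>f c. f \<in> F \<Longrightarrow> (\<lambda>x. c * f x) \<in> F"
    and E_nonneg: "\<And>f. f \<in> F \<Longrightarrow> 0 \<le> E f"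
    and banach: "banach_space_mod_ae M F (E1_norm p M E)"
    and energy_sets: "\<And>f. f \<in> F \<Longrightarrow> sets (\<Gamma> f) = sets borel"
    and energy_finite: "\<And>f. f \<in> F \<Longrightarrow> finite_measure (\<Gamma> f)"
    and energy_total: "\<And>f. f \<in> F \<Longrightarrow> measure (\<Gamma> f) UNIV = E f"
    and energy_scale: "\<And>f c A. f \<in> F \<Longrightarrow> A \<in> sets borel \<Longrightarrow>
                         measure (\<Gamma> (\<lambda>x. c * f x)) A = \<bar>c\<bar> powr p * measure (\<Gamma> f) A"
    and energy_triangle: "\<And>f g A. f \<in> F \<Longrightarrow> g \<in> F \<Longrightarrow> A \<in> sets borel \<Longrightarrow>
                            measure (\<Gamma> (\<lambda>x. f x + g x)) A powr (1 / p)
                              \<le> measure (\<Gamma> f) A powr (1 / p) + measure (\<Gamma> g) A powr (1 / p)"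
    and lipschitz_in_F: "\<And>f g. f \<in> F \<Longrightarrow> \<exists>L. L-lipschitz_on UNIV g \<Longrightarrow> g 0 = 0 \<Longrightarrow> g \<circ> f \<in> F"
    and energy_lipschitz: "\<And>f g A. f \<in> F \<Longrightarrow> \<exists>L. L-lipschitz_on UNIV g \<Longrightarrow> g 0 = 0 \<Longrightarrow>
                             A \<in> sets borel \<Longrightarrow>
                             measure (\<Gamma> (g \<circ> f)) A \<le> best_lipschitz g powr p * measure (\<Gamma> f) A"
    and energy_local: "\<And>f A c. f \<in> F \<Longrightarrow> open A \<Longrightarrow> (AE x in M. x \<in> A \<longrightarrow> f x = c) \<Longrightarrow>
                         measure (\<Gamma> f) A = 0"
    and lower_semicontinuous_in_F:
      "\<And>f u. f \<in> Lp_space p M \<Longrightarrow> (\<And>j::nat. u j \<in> F) \<Longrightarrow>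
         (\<lambda>j. Lp_norm p M (\<lambda>x. u j x - f x)) \<longlonglongrightarrow> 0 \<Longrightarrow>
         bdd_above (range (\<lambda>j. E (u j))) \<Longrightarrow> f \<in> F"
    and energy_lower_semicontinuous:
      "\<And>f u A. f \<in> Lp_space p M \<Longrightarrow> (\<And>j::nat. u j \<in> F) \<Longrightarrow>
         (\<lambda>j. Lp_norm p M (\<lambda>x. u j x - f x)) \<longlonglongrightarrow> 0 \<Longrightarrow>
         bdd_above (range (\<lambda>j. E (u j))) \<Longrightarrow> A \<in> sets borel \<Longrightarrow>
         emeasure (\<Gamma> f) A \<le> liminf (\<lambda>j. emeasure (\<Gamma> (u j)) A)"
    and dense_in_F: "\<And>f e. f \<in> F \<Longrightarrow> 0 < e \<Longrightarrow>
                       \<exists>g \<in> Cc_space \<inter> F. E1_norm p M E (\<lambda>x. f x - g x) < e"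
    and dense_in_Cc: "\<And>f e. f \<in> Cc_space \<Longrightarrow> 0 < e \<Longrightarrow>
                        \<exists>g \<in> Cc_space \<inter> F. (SUP x. \<bar>f x - g x\<bar>) < e"

definition volume_doubling :: "'a::metric_space measure \<Rightarrow> bool" where
  "volume_doubling M \<longleftrightarrow>
     (\<exists>C>1. \<forall>x. \<forall>r>0.
        0 < emeasure M (ball x (2 * r)) \<and>
        emeasure M (ball x (2 * r)) \<le> ennreal C * emeasure M (ball x r) \<and>
        ennreal C * emeasure M (ball x r) < \<infinity>)"

text \<open>A scale function lives on \<open>(0, \<infinity>)\<close>; its values at \<open>r \<le> 0\<close> are irrelevant.\<close>

definition scale_function :: "(real \<Rightarrow> real) \<Rightarrow> bool" where
  "scale_function \<Psi> \<longleftrightarrow>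
     continuous_on {0<..} \<Psi> \<and> strict_mono_on {0<..} \<Psi> \<and> bij_betw \<Psi> {0<..} {0<..} \<and>
     (\<exists>C\<ge>1. \<exists>\<beta>1>0. \<exists>\<beta>2>0. \<forall>r R. 0 < r \<and> r \<le> R \<longrightarrow>
        inverse C * (R / r) powr \<beta>1 \<le> \<Psi> R / \<Psi> r \<and> \<Psi> R / \<Psi> r \<le> C * (R / r) powr \<beta>2)"

definition set_average :: "'a measure \<Rightarrow> 'a set \<Rightarrow> ('a \<Rightarrow> real) \<Rightarrow> real" where
  "set_average M B u = inverse (measure M B) * (LINT x:B|M. u x)"

definition poincare_inequality ::
  "real \<Rightarrow> (real \<Rightarrow> real) \<Rightarrow> 'a::metric_space measure \<Rightarrow> ('a \<Rightarrow> real) set \<Rightarrow>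
     (('a \<Rightarrow> real) \<Rightarrow> 'a measure) \<Rightarrow> bool" where
  "poincare_inequality p \<Psi> M F \<Gamma> \<longleftrightarrow>
     (\<exists>C>0. \<exists>a\<ge>1. \<forall>x. \<forall>r>0. \<forall>u\<in>F.
        (\<integral>\<^sup>+y\<in>ball x r. ennreal (\<bar>u y - set_average M (ball x r) u\<bar> powr p) \<partial>M)
          \<le> ennreal (C * \<Psi> r) * emeasure (\<Gamma> u) (ball x (a * r)))"

text \<open>The infimum is taken in \<open>[0, \<infinity>]\<close>, so it is \<open>\<infinity>\<close> if there is no competitor.\<close>

definition capacity ::
  "'a measure \<Rightarrow> (('a \<Rightarrow> real) \<Rightarrow> real) \<Rightarrow> ('a \<Rightarrow> real) set \<Rightarrow> 'a set \<Rightarrow> 'a set \<Rightarrow> ennreal" where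
  "capacity M E F A B =
     (INF f \<in> {f \<in> F. (AE x in M. x \<in> A \<longrightarrow> f x = 0) \<and> (AE x in M. x \<in> B \<longrightarrow> f x = 1)}.
        ennreal (E f))"

definition capacity_upper_bound ::
  "(real \<Rightarrow> real) \<Rightarrow> 'a::metric_space measure \<Rightarrow> (('a \<Rightarrow> real) \<Rightarrow> real) \<Rightarrow>
     ('a \<Rightarrow> real) set \<Rightarrow> bool" where
  "capacity_upper_bound \<Psi> M E F \<longleftrightarrow>
     (\<exists>C>0. \<exists>a>1. \<forall>x. \<forall>r>0. - ball x (a * r) \<noteq> {} \<longrightarrow>
        capacity M E F (ball x r) (- ball x (a * r))
          \<le> ennreal C * emeasure M (ball x r) / ennreal (\<Psi> r))"

definition eps_chains :: "real \<Rightarrow> 'a::metric_space \<Rightarrow> 'a \<Rightarrow> (nat \<times> (nat \<Rightarrow> 'a)) set" where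
  "eps_chains \<epsilon> x y =
     {(N, z). 1 \<le> N \<and> z 0 = x \<and> z N = y \<and> (\<forall>j<N. dist (z j) (z (Suc j)) < \<epsilon>)}"

definition eps_dist :: "real \<Rightarrow> 'a::metric_space \<Rightarrow> 'a \<Rightarrow> ennreal" where
  "eps_dist \<epsilon> x y =
     (INF (N, z) \<in> eps_chains \<epsilon> x y. \<Sum>j<N. ennreal (dist (z j) (z (Suc j))))"

definition chain_condition :: "'a::metric_space itself \<Rightarrow> bool" where
  "chain_condition _ \<longleftrightarrow>
     (\<exists>C\<ge>1. \<forall>\<epsilon>>0. \<forall>x y :: 'a. eps_dist \<epsilon> x y \<le> ennreal (C * dist x y))"

text \<open>
  A curve is a pair \<open>(I, \<gamma>)\<close> of its parameter interval (bounded or not, with or without end points)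
  and a map of which only the restriction to \<open>I\<close> matters.
\<close>

type_synonym 'a curve = "real set \<times> (real \<Rightarrow> 'a)"

definition is_curve :: "'a::metric_space curve \<Rightarrow> bool" where
  "is_curve c \<longleftrightarrow>
     (case c of (I, \<gamma>) \<Rightarrow> is_interval I \<and> continuous_on I \<gamma> \<and> \<not> \<gamma> constant_on I)"

text \<open>The length of \<open>\<gamma>\<close> restricted to \<open>[a, b]\<close>, where \<open>a \<le> b\<close>.\<close>

definition curve_length :: "(real \<Rightarrow> 'a::metric_space) \<Rightarrow> real \<Rightarrow> real \<Rightarrow> ennreal" where
  "curve_length \<gamma> a b =
     (SUP (n, t) \<in> {(n::nat, t::nat \<Rightarrow> real). t 0 = a \<and> t n = b \<and> mono_on {..n} t}.
        \<Sum>i<n. ennreal (dist (\<gamma> (t i)) (\<gamma> (t (Suc i)))))"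

definition locally_rectifiable :: "'a::metric_space curve \<Rightarrow> bool" where
  "locally_rectifiable c \<longleftrightarrow>
     (case c of (I, \<gamma>) \<Rightarrow> \<forall>a b. a \<le> b \<and> {a..b} \<subseteq> I \<longrightarrow> curve_length \<gamma> a b < \<infinity>)"

text \<open>
  The arc-length parametrization of a rectifiable \<open>\<gamma>\<close> on \<open>[a, b]\<close>.  The choice of \<open>t\<close> does not
  matter: \<open>\<gamma>\<close> is constant between two parameters with the same value of the length function.
\<close>

definition arc_length_param :: "(real \<Rightarrow> 'a::metric_space) \<Rightarrow> real \<Rightarrow> real \<Rightarrow> real \<Rightarrow> 'a" where
  "arc_length_param \<gamma> a b s =
     \<gamma> (SOME t. a \<le> t \<and> t \<le> b \<and> curve_length \<gamma> a t = ennreal s)"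

definition line_integral ::
  "('a::metric_space \<Rightarrow> ennreal) \<Rightarrow> (real \<Rightarrow> 'a) \<Rightarrow> real \<Rightarrow> real \<Rightarrow> ennreal" where
  "line_integral \<rho> \<gamma> a b =
     (\<integral>\<^sup>+s\<in>{0..enn2real (curve_length \<gamma> a b)}. \<rho> (arc_length_param \<gamma> a b s) \<partial>lborel)"

text \<open>
  For a locally rectifiable curve, the integral is the supremum over the compact subcurves; for a
  compact parameter interval the supremum is attained by the whole curve.
\<close>

definition curve_integral :: "('a::metric_space \<Rightarrow> ennreal) \<Rightarrow> 'a curve \<Rightarrow> ennreal" where
  "curve_integral \<rho> c =
     (case c of (I, \<gamma>) \<Rightarrow>
        SUP (a, b) \<in> {(a, b). a \<le> b \<and> {a..b} \<subseteq> I}. line_integral \<rho> \<gamma> a b)"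

definition admissible :: "'a::metric_space curve set \<Rightarrow> ('a \<Rightarrow> ennreal) \<Rightarrow> bool" where
  "admissible G \<rho> \<longleftrightarrow>
     \<rho> \<in> borel_measurable borel \<and>
     (\<forall>c\<in>G. locally_rectifiable c \<longrightarrow> 1 \<le> curve_integral \<rho> c)"

definition ennreal_powr :: "ennreal \<Rightarrow> real \<Rightarrow> ennreal" where
  "ennreal_powr x p = (if x = \<infinity> then \<infinity> else ennreal (enn2real x powr p))"

definition modulus :: "real \<Rightarrow> 'a::metric_space measure \<Rightarrow> 'a curve set \<Rightarrow> ennreal" where
  "modulus p M G = (INF \<rho>\<in>{\<rho>. admissible G \<rho>}. \<integral>\<^sup>+x. ennreal_powr (\<rho> x) p \<partial>M)"

definition vanishing_modulus :: "real \<Rightarrow> 'a::metric_space measure \<Rightarrow> bool" where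
  "vanishing_modulus p M \<longleftrightarrow> (\<forall>G. (\<forall>c\<in>G. is_curve c) \<longrightarrow> modulus p M G = 0)"

end

(*
Part 1.  Let u be in F and C_c, and let u_r be its average against the cone kernels of radius r.
Doubling and the Poincare inequality give |u_r x' - u_r x''| <= g x * d x' x'' for x', x'' in
B(x,r), where g^p = K r^-p Psi(2r) Gamma<u>(B(x,2ar)) / m(B(x,2r)); by Fubini and doubling the
integral of g^p is at most K' (Psi(2r) / r^p) E u, which is small along a sequence of radii.  The
function g is an upper gradient of u_r, and u_r is uniformly close to u; applied to a countable
subset of F and C_c that separates points, this yields weights of arbitrarily small p-norm which
are admissible for all non-constant curves at once.

Part 2.  The capacity bound asks for functions in L^p that equal 1 off a ball, so m is finite, and
doubling makes X compact.  If all moduli vanished, there would be a weight rho of small p-norm with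
integral at least 1 along every curve; it has a majorant of small p-norm that is the increasing limit
of Lipschitz functions sigma_n.  Chains of small mesh from a ball to the complement of a larger one
then have sigma_n-cost at least 1/2 for some n, since cheap chains would subconverge (Tychonoff) to a
curve along which rho has integral at most 1/2.  The infimum of the costs of chains is a cut-off
function with local Lipschitz constant bounded by sigma_n.  Its discrete convolution at a
fine scale s, built from capacitary cut-off functions, has energy at most K (s^p / Psi s) times the
integral of sigma_n^p, which contradicts the Poincare inequality at the scale of X.
*)
theory Submission
  imports Defs
begin

section \<open>Curve length and arc length parametrization\<close>

text \<open>Part 1 has no cut-off functions of controlled energy at hand, so the smoothing is not
  done inside \<open>F\<close>. The cone averages may leave \<open>F\<close>: only their oscillation
  matters, and the Poincare inequality for \<open>u\<close> itself bounds it. In part 2 the obstacle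
  is that a Borel weight says nothing about the finitely many points that a chain sees. A
  Vitali-Caratheodory majorant repairs this: each \<open>\<sigma> n\<close> is Lipschitz, hence
  nearly constant along short edges, and because the sequence increases, an inequality for a fixed
  \<open>\<sigma> k\<close> survives the limit of the chains before \<open>k\<close> is sent to
  infinity. A positive floor \<open>\<delta>\<close> under the weights makes cost control length,
  and it is cheap in p-norm because m is finite. Chain costs yield a function with a pointwise
  gradient bound, but nothing places that function in \<open>F\<close>. The discrete convolution
  moves the bound to an element of \<open>F\<close>, at a scale below the mesh, where the lower
  bound for \<open>\<Psi> s / s powr p\<close> keeps the energy of the cut-off functions
  affordable.\<close>

lemma curve_length_upper:
  assumes "t 0 = a" "t n = b" "mono_on {..n} t"
  shows "(\<Sum>i<n. ennreal (dist (\<gamma> (t i)) (\<gamma> (t (Suc i))))) \<le> curve_length \<gamma> a b"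
  unfolding curve_length_def using assms by (intro SUP_upper2[of "(n,t)"]) auto

lemma curve_length_least:
  assumes "\<And>n t. t 0 = a \<Longrightarrow> t n = b \<Longrightarrow> mono_on {..n} t \<Longrightarrow>
     (\<Sum>i<n. ennreal (dist (\<gamma> (t i)) (\<gamma> (t (Suc i))))) \<le> c"
  shows "curve_length \<gamma> a b \<le> c"
  unfolding curve_length_def using assms by (intro SUP_least) auto

lemma dist_le_curve_length:
  assumes "a \<le> b"
  shows "ennreal (dist (\<gamma> a) (\<gamma> b)) \<le> curve_length \<gamma> a b"
  using assms curve_length_upper[of "\<lambda>i. if i = 0 then a else b" a 1 b \<gamma>]
  by (auto simp: mono_on_def)

text \<open>Prepending \<open>a\<close> to a partition of \<open>[b, c]\<close> gives a partition of
  \<open>[a, c]\<close>. In this one-step form superadditivity can go by induction, without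
  concatenating two index sequences.\<close>

lemma dist_add_curve_length_le:
  assumes "a \<le> b" "b \<le> c"
  shows "ennreal (dist (\<gamma> a) (\<gamma> b)) + curve_length \<gamma> b c \<le> curve_length \<gamma> a c"
proof -
  let ?P = "{(n::nat, t::nat \<Rightarrow> real). t 0 = b \<and> t n = c \<and> mono_on {..n} t}"
  have ne: "?P \<noteq> {}"
    using assms by (auto intro!: exI[of _ 1] exI[of _ "\<lambda>i. if i = 0 then b else c"] simp: mono_on_def)
  have "ennreal (dist (\<gamma> a) (\<gamma> b)) + (\<Sum>i<n. ennreal (dist (\<gamma> (t i)) (\<gamma> (t (Suc i)))))
      \<le> curve_length \<gamma> a c" if t: "t 0 = b" "t n = c" "mono_on {..n} t" for n t
  proof -
    let ?t = "\<lambda>i. case i of 0 \<Rightarrow> a | Suc j \<Rightarrow> t j"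
    have mono: "mono_on {..Suc n} ?t"
    proof (rule mono_onI)
      fix r s assume rs: "r \<in> {..Suc n}" "s \<in> {..Suc n}" "r \<le> s"
      show "?t r \<le> ?t s"
      proof (cases r; cases s)
        fix j assume "r = 0" "s = Suc j"
        then have "t 0 \<le> t j" using t rs by (auto simp: mono_on_def)
        then show ?thesis using t assms \<open>r = 0\<close> \<open>s = Suc j\<close> by simp
      next
        fix j k assume "r = Suc j" "s = Suc k"
        then show ?thesis using t rs by (auto simp: mono_on_def)
      qed (use rs in auto)
    qed
    have "(\<Sum>i<Suc n. ennreal (dist (\<gamma> (?t i)) (\<gamma> (?t (Suc i))))) \<le> curve_length \<gamma> a c"
      by (rule curve_length_upper) (use t mono in auto)
    then show ?thesis using t by (simp add: sum.lessThan_Suc_shift del: sum.lessThan_Suc)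
  qed
  then have "(SUP x\<in>?P. ennreal (dist (\<gamma> a) (\<gamma> b)) +
      (case x of (n,t) \<Rightarrow> \<Sum>i<n. ennreal (dist (\<gamma> (t i)) (\<gamma> (t (Suc i)))))) \<le> curve_length \<gamma> a c"
    by (intro SUP_least) auto
  also have "(SUP x\<in>?P. ennreal (dist (\<gamma> a) (\<gamma> b)) +
      (case x of (n,t) \<Rightarrow> \<Sum>i<n. ennreal (dist (\<gamma> (t i)) (\<gamma> (t (Suc i)))))) =
      ennreal (dist (\<gamma> a) (\<gamma> b)) + curve_length \<gamma> b c"
    unfolding curve_length_def using ne by (subst ennreal_SUP_add_right) auto
  finally show ?thesis .
qed

lemma curve_length_superadditive:
  assumes "a \<le> b" "b \<le> c"
  shows "curve_length \<gamma> a b + curve_length \<gamma> b c \<le> curve_length \<gamma> a c"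
proof -
  let ?P = "{(n::nat, t::nat \<Rightarrow> real). t 0 = a \<and> t n = b \<and> mono_on {..n} t}"
  have ne: "?P \<noteq> {}"
    using assms by (auto intro!: exI[of _ 1] exI[of _ "\<lambda>i. if i = 0 then a else b"] simp: mono_on_def)
  \<comment> \<open>The splitting point is the moving end \<open>t n\<close>, so that each induction
    step shifts a single increment into the length by
    \<open>dist_add_curve_length_le\<close>.\<close>
  have *: "(\<Sum>i<n. ennreal (dist (\<gamma> (t i)) (\<gamma> (t (Suc i))))) + curve_length \<gamma> (t n) c
      \<le> curve_length \<gamma> (t 0) c" if "t n \<le> c" "mono_on {..n} t" for n t
    using that
  proof (induction n)
    case (Suc n)
    have le: "t n \<le> t (Suc n)" using Suc.prems by (auto simp: mono_on_def)
    have "mono_on {..n} t" using Suc.prems by (auto simp: mono_on_def)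
    then have "(\<Sum>i<n. ennreal (dist (\<gamma> (t i)) (\<gamma> (t (Suc i))))) + curve_length \<gamma> (t n) c
      \<le> curve_length \<gamma> (t 0) c"
      using Suc le by auto
    moreover have "ennreal (dist (\<gamma> (t n)) (\<gamma> (t (Suc n)))) + curve_length \<gamma> (t (Suc n)) c
       \<le> curve_length \<gamma> (t n) c"
      by (rule dist_add_curve_length_le) (use le Suc.prems in auto)
    ultimately show ?case
      by (simp add: add.assoc) (meson add_left_mono order_trans)
  qed simp
  have "(SUP x\<in>?P. (case x of (n,t) \<Rightarrow> \<Sum>i<n. ennreal (dist (\<gamma> (t i)) (\<gamma> (t (Suc i))))) + curve_length \<gamma> b c)
     \<le> curve_length \<gamma> a c"
    using * assms by (intro SUP_least) auto
  also have "(SUP x\<in>?P. (case x of (n,t) \<Rightarrow> \<Sum>i<n. ennreal (dist (\<gamma> (t i)) (\<gamma> (t (Suc i))))) + curve_length \<gamma> b c)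
     = curve_length \<gamma> a b + curve_length \<gamma> b c"
    unfolding curve_length_def[of \<gamma> a b] using ne by (subst ennreal_SUP_add_left) auto
  finally show ?thesis .
qed

lemma curve_length_subadditive:
  assumes "a \<le> b" "b \<le> c"
  shows "curve_length \<gamma> a c \<le> curve_length \<gamma> a b + curve_length \<gamma> b c"
proof -
  have *: "(\<Sum>i<n. ennreal (dist (\<gamma> (t i)) (\<gamma> (t (Suc i)))))
     \<le> curve_length \<gamma> (t 0) b + curve_length \<gamma> b (t n)"
    if "mono_on {..n} t" "t 0 \<le> b" "b \<le> t n" for n t
    using that
  proof (induction n)
    case (Suc n)
    have le: "t n \<le> t (Suc n)" using Suc.prems by (auto simp: mono_on_def)
    have mono: "mono_on {..n} t" using Suc.prems by (auto simp: mono_on_def)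
    show ?case
    proof (cases "b \<le> t n")
      case True
      then have "(\<Sum>i<n. ennreal (dist (\<gamma> (t i)) (\<gamma> (t (Suc i)))))
       \<le> curve_length \<gamma> (t 0) b + curve_length \<gamma> b (t n)"
        using Suc mono by auto
      moreover have "curve_length \<gamma> b (t n) + ennreal (dist (\<gamma> (t n)) (\<gamma> (t (Suc n)))) \<le> curve_length \<gamma> b (t (Suc n))"
        by (rule order_trans[OF add_left_mono[OF dist_le_curve_length] curve_length_superadditive])
           (use le True in auto)
      ultimately show ?thesis
        by (simp add: add.assoc) (smt (verit) add.assoc add_left_mono add_right_mono order_trans)
    next
      \<comment> \<open>Here \<open>b\<close> falls strictly inside the last interval, which is cut
        there by the triangle inequality.\<close>
      case False
      have "(\<Sum>i<n. ennreal (dist (\<gamma> (t i)) (\<gamma> (t (Suc i))))) \<le> curve_length \<gamma> (t 0) (t n)"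
        by (rule curve_length_upper) (use mono in auto)
      moreover have "ennreal (dist (\<gamma> (t n)) (\<gamma> (t (Suc n)))) \<le>
         ennreal (dist (\<gamma> (t n)) (\<gamma> b)) + ennreal (dist (\<gamma> b) (\<gamma> (t (Suc n))))"
        by (simp add: dist_triangle flip: ennreal_plus)
      moreover have "\<dots> \<le> curve_length \<gamma> (t n) b + curve_length \<gamma> b (t (Suc n))"
        using False Suc.prems by (intro add_mono dist_le_curve_length) auto
      moreover have "curve_length \<gamma> (t 0) (t n) + curve_length \<gamma> (t n) b \<le> curve_length \<gamma> (t 0) b"
        using False Suc.prems by (intro curve_length_superadditive) (auto simp: mono_on_def)
      ultimately show ?thesis
        by (simp add: add.assoc) (smt (verit) add.assoc add_mono add_right_mono order_trans order_refl)
    qed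
  qed (simp)
  show ?thesis
    by (rule curve_length_least) (use * assms in force)
qed

lemma curve_length_add:
  assumes "a \<le> b" "b \<le> c"
  shows "curve_length \<gamma> a c = curve_length \<gamma> a b + curve_length \<gamma> b c"
  using curve_length_subadditive[OF assms] curve_length_superadditive[OF assms] by (intro antisym)

lemma curve_length_refl [simp]: "curve_length \<gamma> a a = 0"
proof -
  have "curve_length \<gamma> a a \<le> 0"
  proof (rule curve_length_least)
    fix n and t :: "nat \<Rightarrow> real"
    assume t: "t 0 = a" "t n = a" "mono_on {..n} t"
    have "t i = a" if "i \<le> n" for i
    proof -
      have "t 0 \<le> t i" "t i \<le> t n" using t(3) that by (auto simp: mono_on_def)
      then show ?thesis using t by simp
    qed
    then show "(\<Sum>i<n. ennreal (dist (\<gamma> (t i)) (\<gamma> (t (Suc i))))) \<le> 0" by simp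
  qed
  then show ?thesis by simp
qed

lemma curve_length_le_of_lipschitz:
  assumes "a \<le> b" "0 \<le> L"
    and "\<And>s t. a \<le> s \<Longrightarrow> s \<le> t \<Longrightarrow> t \<le> b \<Longrightarrow> dist (\<gamma> s) (\<gamma> t) \<le> L * (t - s)"
  shows "curve_length \<gamma> a b \<le> ennreal (L * (b - a))"
proof (rule curve_length_least)
  fix n and t :: "nat \<Rightarrow> real"
  assume t: "t 0 = a" "t n = b" "mono_on {..n} t"
  have "(\<Sum>i<n. ennreal (dist (\<gamma> (t i)) (\<gamma> (t (Suc i))))) \<le> (\<Sum>i<n. ennreal (L * (t (Suc i) - t i)))"
  proof (intro sum_mono ennreal_leI assms(3))
    fix i assume i: "i \<in> {..<n}"
    show "a \<le> t i" using mono_onD[OF t(3), of 0 i] t(1) i by auto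
    show "t i \<le> t (Suc i)" using mono_onD[OF t(3), of i "Suc i"] i by auto
    show "t (Suc i) \<le> b" using mono_onD[OF t(3), of "Suc i" n] t(2) i by auto
  qed
  also have "\<dots> = ennreal (\<Sum>i<n. L * (t (Suc i) - t i))"
    using assms(2) t(3) by (intro sum_ennreal) (auto simp: mono_on_def)
  also have "(\<Sum>i<n. L * (t (Suc i) - t i)) = L * (b - a)"
    using t by (simp add: sum_distrib_left[symmetric] sum_lessThan_telescope)
  finally show "(\<Sum>i<n. ennreal (dist (\<gamma> (t i)) (\<gamma> (t (Suc i))))) \<le> ennreal (L * (b - a))" .
qed

text \<open>A partition that misses the total length by less than \<open>e/2\<close> still does so
  after inserting a point \<open>s\<close> before its first point beyond \<open>a\<close>.
  Continuity makes the new increment from \<open>a\<close> to \<open>s\<close> smaller than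
  \<open>e/2\<close>, so the length beyond \<open>s\<close> exceeds the total minus
  \<open>e\<close>, and additivity leaves less than \<open>e\<close> for
  \<open>[a, s]\<close>.\<close>

lemma curve_length_small_right:
  assumes "a < b" "continuous_on {a..b} \<gamma>" "curve_length \<gamma> a b < \<infinity>" "0 < e"
  shows "\<exists>d>0. \<forall>t. a \<le> t \<and> t < a + d \<and> t \<le> b \<longrightarrow> curve_length \<gamma> a t < ennreal e"
proof -
  let ?V = "curve_length \<gamma>"
  have fin: "?V a b \<noteq> top" using assms by auto
  show ?thesis
  proof (cases "?V a b < ennreal e")
    case True
    have "?V a t < ennreal e" if "a \<le> t" "t \<le> b" for t
      using curve_length_add[of a t b \<gamma>] True that
      by (metis le_iff_add order_le_less_trans)
    then show ?thesis by (intro exI[of _ 1]) auto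
  next
    case False
    then have pos: "0 < ?V a b" using assms(4) by (metis ennreal_less_zero_iff not_less order_less_le_trans)
    have "?V a b - ennreal (e/2) < ?V a b"
      using pos fin assms(4) by (intro ennreal_between) (auto simp: top.not_eq_extremum)
    then obtain n t where t: "t 0 = a" "t n = b" "mono_on {..n} t"
      and big: "?V a b - ennreal (e/2) < (\<Sum>i<n. ennreal (dist (\<gamma> (t i)) (\<gamma> (t (Suc i)))))"
      unfolding curve_length_def[of \<gamma> a b] less_SUP_iff by auto
    \<comment> \<open>Partitions are only weakly monotone, so several initial points may coincide
      with \<open>a\<close>; their increments vanish.\<close>
    define j where "j = (LEAST i. a < t i)"
    have "a < t n" using t assms by simp
    then have j: "a < t j" "j \<le> n" unfolding j_def by (auto intro: LeastI Least_le)
    have jb: "t i = a" if "i < j" for i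
    proof -
      have "\<not> a < t i" using that not_less_Least unfolding j_def by blast
      moreover have "t 0 \<le> t i" using mono_onD[OF t(3), of 0 i] that j by auto
      ultimately show ?thesis using t by simp
    qed
    have j0: "0 < j" using j t by (cases j) auto
    obtain d where d: "d > 0" "\<And>x. x \<in> {a..b} \<Longrightarrow> dist x a < d \<Longrightarrow> dist (\<gamma> x) (\<gamma> a) < e/2"
      using assms(1,2,4) unfolding continuous_on_iff by (metis atLeastAtMost_iff half_gt_zero less_eq_real_def order_refl)
    have "?V a s < ennreal e" if s: "a \<le> s" "s < a + min d (t j - a)" "s \<le> b" for s
    proof -
      let ?S = "\<lambda>A. \<Sum>i\<in>A. ennreal (dist (\<gamma> (t i)) (\<gamma> (t (Suc i))))"
      have "?S {..<n} = ?S {..<j-1} + ?S {j-1..<n}"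
        unfolding lessThan_atLeast0 using j j0 by (intro sum.atLeastLessThan_concat[symmetric]) auto
      also have "?S {..<j-1} = 0" using jb by (auto intro!: sum.neutral)
      also have "?S {j-1..<n} = ennreal (dist (\<gamma> a) (\<gamma> (t j))) + ?S {j..<n}"
        using j j0 jb[of "j-1"] by (subst sum.atLeast_Suc_lessThan) auto
      also have "?S {j..<n} \<le> ?V (t j) b"
      proof -
        have "?S {j..<n} = (\<Sum>i<n-j. ennreal (dist (\<gamma> (t (i+j))) (\<gamma> (t (Suc i+j)))))"
          using sum.shift_bounds_nat_ivl[of "\<lambda>i. ennreal (dist (\<gamma> (t i)) (\<gamma> (t (Suc i))))" 0 j "n-j"] j
          by (simp add: lessThan_atLeast0)
        also have "\<dots> \<le> ?V (t j) b"
          by (rule curve_length_upper[of "\<lambda>i. t (i + j)"]) (use j t in \<open>auto simp: mono_on_def le_diff_conv2\<close>)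
        finally show ?thesis .
      qed
      also have "ennreal (dist (\<gamma> a) (\<gamma> (t j))) \<le> ennreal (dist (\<gamma> a) (\<gamma> s)) + ennreal (dist (\<gamma> s) (\<gamma> (t j)))"
        by (simp add: dist_triangle flip: ennreal_plus)
      also have "ennreal (dist (\<gamma> a) (\<gamma> s)) \<le> ennreal (e/2)"
        using d(2)[of s] s by (intro ennreal_leI) (simp add: dist_commute dist_real_def min_def split: if_splits)
      also have "ennreal (dist (\<gamma> s) (\<gamma> (t j))) \<le> ?V s (t j)"
        using s by (intro dist_le_curve_length) auto
      finally have "?S {..<n} \<le> ennreal (e/2) + (?V s (t j) + ?V (t j) b)"
        by (simp add: add.assoc add_left_mono)
      also have tjb: "t j \<le> b" using mono_onD[OF t(3), of j n] t j by auto
      then have "?V s (t j) + ?V (t j) b = ?V s b"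
        using s by (intro curve_length_add[symmetric]) auto
      finally have 1: "?V a b - ennreal (e/2) < ennreal (e/2) + ?V s b" using big by order
      have 2: "?V a b = ?V a s + ?V s b" using s by (intro curve_length_add) auto
      have f: "?V a s < top" "?V s b < top" using fin 2 by (auto simp: top.not_eq_extremum)
      obtain x y where xy: "?V a s = ennreal x" "?V s b = ennreal y" "0 \<le> x" "0 \<le> y"
        using f by (metis ennreal_cases less_irrefl)
      from 1 2 have "ennreal (x + y - e / 2) < ennreal (e / 2 + y)" using xy assms(4)
        by (simp flip: ennreal_plus add: ennreal_minus)
      then have "x + y - e / 2 < e / 2 + y" using xy assms(4) by (smt (verit) ennreal_leI field_sum_of_halves linorder_not_less)
      then have "x < e" by simp
      then show ?thesis using xy by (simp add: ennreal_less_iff)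
    qed
    then show ?thesis using d j by (intro exI[of _ "min d (t j - a)"]) auto
  qed
qed

text \<open>Time reversal is an involution, so one inequality gives invariance of length, and
  smallness at the left end of an interval carries over to the right end.\<close>

lemma curve_length_reverse_le: "curve_length (\<lambda>t. \<gamma> (- t)) (- b) (- a) \<le> curve_length \<gamma> a b"
proof (rule curve_length_least)
  fix n and t :: "nat \<Rightarrow> real"
  assume t: "t 0 = - b" "t n = - a" "mono_on {..n} t"
  have "(\<Sum>i<n. ennreal (dist (\<gamma> (- t i)) (\<gamma> (- t (Suc i))))) =
      (\<Sum>i<n. ennreal (dist (\<gamma> (- t (n - Suc i))) (\<gamma> (- t (Suc (n - Suc i))))))"
    by (rule sum.nat_diff_reindex[symmetric])
  also have "\<dots> = (\<Sum>i<n. ennreal (dist (\<gamma> (- t (n - i))) (\<gamma> (- t (n - Suc i)))))"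
    by (intro sum.cong) (auto simp: dist_commute Suc_diff_Suc)
  also have "\<dots> \<le> curve_length \<gamma> a b"
    by (rule curve_length_upper[of "\<lambda>i. - t (n - i)"]) (use t in \<open>auto simp: mono_on_def\<close>)
  finally show "(\<Sum>i<n. ennreal (dist (\<gamma> (- t i)) (\<gamma> (- t (Suc i))))) \<le> curve_length \<gamma> a b" .
qed

lemma curve_length_reverse: "curve_length (\<lambda>t. \<gamma> (- t)) (- b) (- a) = curve_length \<gamma> a b"
  using curve_length_reverse_le[of \<gamma> b a] curve_length_reverse_le[of "\<lambda>t. \<gamma> (- t)" "-a" "-b"]
  by (intro antisym) auto

lemma curve_length_small_left:
  assumes "a < b" "continuous_on {a..b} \<gamma>" "curve_length \<gamma> a b < \<infinity>" "0 < e"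
  shows "\<exists>d>0. \<forall>t. a \<le> t \<and> b - d < t \<and> t \<le> b \<longrightarrow> curve_length \<gamma> t b < ennreal e"
proof -
  have "continuous_on {-b..-a} (\<lambda>t. \<gamma> (- t))"
    by (rule continuous_on_compose2[OF assms(2)]) (auto intro!: continuous_intros)
  then obtain d where d: "d > 0"
    "\<And>t. -b \<le> t \<and> t < -b + d \<and> t \<le> -a \<Longrightarrow> curve_length (\<lambda>t. \<gamma> (- t)) (-b) t < ennreal e"
    using curve_length_small_right[of "-b" "-a" "\<lambda>t. \<gamma> (- t)" e] assms curve_length_reverse[of \<gamma> b a]
    by auto
  have "curve_length \<gamma> t b < ennreal e" if "a \<le> t" "b - d < t" "t \<le> b" for t
    using d(2)[of "-t"] that curve_length_reverse[of \<gamma> b t] by auto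
  then show ?thesis using d(1) by blast
qed

lemma curve_length_mono_interval:
  assumes "a \<le> a'" "a' \<le> b'" "b' \<le> b"
  shows "curve_length \<gamma> a' b' \<le> curve_length \<gamma> a b"
proof -
  have "curve_length \<gamma> a' b' \<le> curve_length \<gamma> a' b"
    using curve_length_add[of a' b' b \<gamma>] assms by simp
  also have "\<dots> \<le> curve_length \<gamma> a b"
    using curve_length_add[of a a' b \<gamma>] assms by simp
  finally show ?thesis .
qed

lemma curve_length_diff:
  assumes "curve_length \<gamma> a b < \<infinity>" "a \<le> s" "s \<le> t" "t \<le> b"
  shows "curve_length \<gamma> s t =
    ennreal (enn2real (curve_length \<gamma> a t) - enn2real (curve_length \<gamma> a s))"
    and "enn2real (curve_length \<gamma> a s) \<le> enn2real (curve_length \<gamma> a t)"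
proof -
  have add: "curve_length \<gamma> a t = curve_length \<gamma> a s + curve_length \<gamma> s t"
    using assms by (intro curve_length_add) auto
  have "curve_length \<gamma> a t \<le> curve_length \<gamma> a b"
    using assms by (intro curve_length_mono_interval) auto
  then have "curve_length \<gamma> a t < top" using assms(1) by (simp add: less_top order_le_less_trans)
  then obtain x y where "curve_length \<gamma> a s = ennreal x" "curve_length \<gamma> s t = ennreal y" "0 \<le> x" "0 \<le> y"
    using add by (metis ennreal_cases ennreal_add_eq_top less_irrefl)
  then show "curve_length \<gamma> s t =
      ennreal (enn2real (curve_length \<gamma> a t) - enn2real (curve_length \<gamma> a s))"
    "enn2real (curve_length \<gamma> a s) \<le> enn2real (curve_length \<gamma> a t)"
    using add by (auto simp flip: ennreal_plus)
qed

lemma curve_length_continuous: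
  assumes "continuous_on {a..b} \<gamma>" "curve_length \<gamma> a b < \<infinity>"
  shows "continuous_on {a..b} (\<lambda>t. enn2real (curve_length \<gamma> a t))"
  unfolding continuous_on_iff
proof (intro ballI allI impI)
  fix x e :: real assume x: "x \<in> {a..b}" and e: "0 < e"
  let ?V = "\<lambda>t. enn2real (curve_length \<gamma> a t)"
  have "\<exists>d>0. \<forall>t. x \<le> t \<and> t < x + d \<and> t \<le> b \<longrightarrow> ?V t - ?V x < e"
  proof (cases "x < b")
    case True
    have "curve_length \<gamma> x b < \<infinity>"
      using curve_length_mono_interval[of a x b b \<gamma>] x assms(2) by (auto intro: order_le_less_trans)
    then obtain d where d: "d > 0" "\<And>t. x \<le> t \<Longrightarrow> t < x + d \<Longrightarrow> t \<le> b \<Longrightarrow> curve_length \<gamma> x t < ennreal e"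
      using curve_length_small_right[of x b \<gamma> e] True e x continuous_on_subset[OF assms(1), of "{x..b}"] by auto
    have "?V t - ?V x < e" if "x \<le> t" "t < x + d" "t \<le> b" for t
      using d(2)[OF that] curve_length_diff[OF assms(2), of x t] that x by (auto simp: ennreal_less_iff)
    then show ?thesis using d by blast
  next
    case False
    then have "x = b" using x by auto
    then show ?thesis using e by (intro exI[of _ 1]) auto
  qed
  then obtain d1 where d1: "d1 > 0" "\<And>t. x \<le> t \<and> t < x + d1 \<and> t \<le> b \<Longrightarrow> ?V t - ?V x < e" by blast
  have "\<exists>d>0. \<forall>t. a \<le> t \<and> x - d < t \<and> t \<le> x \<longrightarrow> ?V x - ?V t < e"
  proof (cases "a < x")
    case True
    have "curve_length \<gamma> a x < \<infinity>"
      using curve_length_mono_interval[of a a x b \<gamma>] x assms(2) by (auto intro: order_le_less_trans)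
    then obtain d where d: "d > 0" "\<And>t. a \<le> t \<Longrightarrow> x - d < t \<Longrightarrow> t \<le> x \<Longrightarrow> curve_length \<gamma> t x < ennreal e"
      using curve_length_small_left[of a x \<gamma> e] True e x continuous_on_subset[OF assms(1), of "{a..x}"] by auto
    have "?V x - ?V t < e" if "a \<le> t" "x - d < t" "t \<le> x" for t
      using d(2)[OF that] curve_length_diff[OF assms(2), of t x] that x by (auto simp: ennreal_less_iff)
    then show ?thesis using d by blast
  next
    case False
    then have "x = a" using x by auto
    then show ?thesis using e by (intro exI[of _ 1]) auto
  qed
  then obtain d2 where d2: "d2 > 0" "\<And>t. a \<le> t \<and> x - d2 < t \<and> t \<le> x \<Longrightarrow> ?V x - ?V t < e" by blast
  have "dist (?V t) (?V x) < e" if t: "t \<in> {a..b}" "dist t x < min d1 d2" for t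
  proof (cases "x \<le> t")
    case True
    then show ?thesis using d1(2)[of t] t curve_length_diff(2)[OF assms(2), of x t] x
      by (auto simp: dist_real_def)
  next
    case False
    then show ?thesis using d2(2)[of t] t curve_length_diff(2)[OF assms(2), of t x] x
      by (auto simp: dist_real_def)
  qed
  then show "\<exists>d>0. \<forall>t\<in>{a..b}. dist t x < d \<longrightarrow> dist (?V t) (?V x) < e"
    using d1(1) d2(1) by (intro exI[of _ "min d1 d2"]) auto
qed

section \<open>Arc length parametrization and line integrals\<close>

lemma arc_length_param_ex:
  assumes "a \<le> b" "continuous_on {a..b} \<gamma>" "curve_length \<gamma> a b < \<infinity>"
    and "0 \<le> s" "s \<le> enn2real (curve_length \<gamma> a b)"
  obtains t where "a \<le> t" "t \<le> b" "curve_length \<gamma> a t = ennreal s" "arc_length_param \<gamma> a b s = \<gamma> t"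
proof -
  \<comment> \<open>The intermediate value theorem for the length function supplies a candidate for
    the choice in \<open>arc_length_param\<close>.\<close>
  have "\<exists>t. a \<le> t \<and> t \<le> b \<and> enn2real (curve_length \<gamma> a t) = s"
    using assms curve_length_continuous[OF assms(2,3)] by (intro IVT') auto
  then obtain t where "a \<le> t" "t \<le> b" "enn2real (curve_length \<gamma> a t) = s" by blast
  moreover have "curve_length \<gamma> a t \<le> curve_length \<gamma> a b" if "a \<le> t" "t \<le> b" for t
    using that by (intro curve_length_mono_interval) auto
  ultimately have "a \<le> t \<and> t \<le> b \<and> curve_length \<gamma> a t = ennreal s"
    using assms(3) by (metis ennreal_enn2real order_le_less_trans infinity_ennreal_def)
  then have "a \<le> (SOME t. a \<le> t \<and> t \<le> b \<and> curve_length \<gamma> a t = ennreal s) \<and>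
    (SOME t. a \<le> t \<and> t \<le> b \<and> curve_length \<gamma> a t = ennreal s) \<le> b \<and>
    curve_length \<gamma> a (SOME t. a \<le> t \<and> t \<le> b \<and> curve_length \<gamma> a t = ennreal s) = ennreal s"
    by (rule someI)
  then show thesis using that unfolding arc_length_param_def by blast
qed

lemma arc_length_param_lipschitz:
  assumes "a \<le> b" "continuous_on {a..b} \<gamma>" "curve_length \<gamma> a b < \<infinity>"
    and s: "0 \<le> s" "s \<le> enn2real (curve_length \<gamma> a b)"
    and s': "0 \<le> s'" "s' \<le> enn2real (curve_length \<gamma> a b)"
  shows "dist (arc_length_param \<gamma> a b s) (arc_length_param \<gamma> a b s') \<le> \<bar>s - s'\<bar>"
proof -
  obtain t where t: "a \<le> t" "t \<le> b" "curve_length \<gamma> a t = ennreal s" "arc_length_param \<gamma> a b s = \<gamma> t"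
    using arc_length_param_ex[OF assms(1-3) s] .
  obtain t' where t': "a \<le> t'" "t' \<le> b" "curve_length \<gamma> a t' = ennreal s'" "arc_length_param \<gamma> a b s' = \<gamma> t'"
    using arc_length_param_ex[OF assms(1-3) s'] .
  have *: "dist (\<gamma> u) (\<gamma> v) \<le> \<bar>x - y\<bar>" if "a \<le> u" "u \<le> v" "v \<le> b"
    "curve_length \<gamma> a u = ennreal x" "curve_length \<gamma> a v = ennreal y" "0 \<le> x" "0 \<le> y" for u v x y
  proof -
    have "ennreal (dist (\<gamma> u) (\<gamma> v)) \<le> curve_length \<gamma> u v" using that by (intro dist_le_curve_length)
    also have "\<dots> = ennreal (y - x)" using curve_length_diff(1)[OF assms(3), of u v] that by simp
    finally have "ennreal (dist (\<gamma> u) (\<gamma> v)) \<le> ennreal (y - x)" .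
    moreover have "x \<le> y" using curve_length_diff(2)[OF assms(3), of u v] that by simp
    ultimately show ?thesis by (simp add: ennreal_le_iff)
  qed
  show ?thesis
  proof (cases "t \<le> t'")
    case True
    then show ?thesis using *[of t t' s s'] t t' s s' by simp
  next
    case False
    then show ?thesis using *[of t' t s' s] t t' s s' by (simp add: dist_commute abs_minus_commute)
  qed
qed

text \<open>The parameter picked by the choice operator may differ from \<open>u\<close>, but the
  length function agrees at both, so the piece between them has length zero and
  \<open>\<gamma>\<close> does not move on it.\<close>

lemma arc_length_param_curve_length:
  assumes "a \<le> b" "continuous_on {a..b} \<gamma>" "curve_length \<gamma> a b < \<infinity>" "a \<le> u" "u \<le> b"
  shows "arc_length_param \<gamma> a b (enn2real (curve_length \<gamma> a u)) = \<gamma> u"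
proof -
  have le: "curve_length \<gamma> a u \<le> curve_length \<gamma> a b"
    using assms by (intro curve_length_mono_interval) auto
  then have fin: "curve_length \<gamma> a u < top" using assms(3) by (simp add: order_le_less_trans)
  obtain t where t: "a \<le> t" "t \<le> b"
    "curve_length \<gamma> a t = ennreal (enn2real (curve_length \<gamma> a u))"
    "arc_length_param \<gamma> a b (enn2real (curve_length \<gamma> a u)) = \<gamma> t"
    using arc_length_param_ex[OF assms(1-3), of "enn2real (curve_length \<gamma> a u)"] le assms(3)
    by (metis enn2real_mono enn2real_nonneg infinity_ennreal_def)
  have eq: "curve_length \<gamma> a t = curve_length \<gamma> a u" using t fin by simp
  have *: "\<gamma> x = \<gamma> y" if "a \<le> x" "x \<le> y" "y \<le> b" "curve_length \<gamma> a x = curve_length \<gamma> a y" for x y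
  proof -
    have "curve_length \<gamma> x y = 0" using curve_length_diff(1)[OF assms(3), of x y] that by simp
    then show ?thesis using dist_le_curve_length[of x y \<gamma>] that by simp
  qed
  have "\<gamma> t = \<gamma> u"
  proof (cases "t \<le> u")
    case True
    then show ?thesis using eq t(1) assms(5) by (intro *)
  next
    case False
    then show ?thesis using eq t(2) assms(4) by (intro *[symmetric]) auto
  qed
  then show ?thesis using t(4) by simp
qed

text \<open>Outside the interval the parametrization is an arbitrary choice; measurability is
  therefore proved on the restricted space, and the indicator factor extends it.\<close>

lemma arc_length_param_measurable:
  fixes \<rho> :: "'a::metric_space \<Rightarrow> ennreal"
  assumes "a \<le> b" "continuous_on {a..b} \<gamma>" "curve_length \<gamma> a b < \<infinity>" "\<rho> \<in> borel_measurable borel"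
  shows "(\<lambda>s. \<rho> (arc_length_param \<gamma> a b s) * indicator {0..enn2real (curve_length \<gamma> a b)} s)
     \<in> borel_measurable (lborel :: real measure)"
proof -
  let ?I = "{0..enn2real (curve_length \<gamma> a b)}"
  have "continuous_on ?I (arc_length_param \<gamma> a b)"
    unfolding continuous_on_iff
    using arc_length_param_lipschitz[OF assms(1-3)]
    by (metis atLeastAtMost_iff dist_real_def order_le_less_trans)
  then have "arc_length_param \<gamma> a b \<in> measurable (restrict_space borel ?I) borel"
    by (rule borel_measurable_continuous_on_restrict)
  then have "(\<lambda>s. \<rho> (arc_length_param \<gamma> a b s)) \<in> measurable (restrict_space borel ?I) borel"
    using assms(4) by (rule measurable_compose)
  then have "(\<lambda>s. \<rho> (arc_length_param \<gamma> a b s) * indicator ?I s) \<in> borel_measurable borel"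
    by (subst (asm) borel_measurable_restrict_space_iff_ennreal) auto
  then show ?thesis by simp
qed

lemma nn_integral_split_uniform:
  fixes f :: "real \<Rightarrow> ennreal"
  assumes "f \<in> borel_measurable lborel" "mono_on {..n} t"
  shows "(\<Sum>i<n. \<integral>\<^sup>+s\<in>{t i..t (Suc i)}. f s \<partial>lborel) = (\<integral>\<^sup>+s\<in>{t 0..t n}. f s \<partial>lborel)"
  using assms(2)
proof (induction n)
  case 0
  have "(\<integral>\<^sup>+s\<in>{t 0..t 0}. f s \<partial>lborel) = 0"
    by (rule nn_integral_null_set) auto
  then show ?case by simp
next
  case (Suc n)
  have le: "t 0 \<le> t n" "t n \<le> t (Suc n)" using Suc.prems by (auto simp: mono_on_def)
  \<comment> \<open>Adjacent closed pieces overlap in an endpoint, a null set.\<close>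
  have "(\<integral>\<^sup>+s\<in>{t n..t (Suc n)}. f s \<partial>lborel) = (\<integral>\<^sup>+s\<in>{t n<..t (Suc n)}. f s \<partial>lborel)"
    by (rule nn_integral_cong_AE) (use AE_lborel_singleton[of "t n"] in \<open>auto elim!: eventually_mono split: split_indicator\<close>)
  moreover have "(\<integral>\<^sup>+s\<in>{t 0..t n}. f s \<partial>lborel) + (\<integral>\<^sup>+s\<in>{t n<..t (Suc n)}. f s \<partial>lborel) =
     (\<integral>\<^sup>+s\<in>{t 0..t (Suc n)}. f s \<partial>lborel)"
    using assms(1) le
    by (subst nn_integral_add[symmetric]) (auto intro!: nn_integral_cong split: split_indicator)
  moreover have "mono_on {..n} t" using Suc.prems by (auto simp: mono_on_def)
  ultimately show ?case using Suc.IH by simp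
qed

text \<open>Integrating the hypothesis over the midpoint \<open>x\<close> on short pieces of the curve avoids any use of
  absolute continuity.\<close>

lemma upper_gradient_inequality:
  fixes w g :: "'a::metric_space \<Rightarrow> real"
  assumes "a \<le> b" "continuous_on {a..b} \<gamma>" "curve_length \<gamma> a b < \<infinity>"
    and g: "g \<in> borel_measurable borel" and r: "0 < r"
    and w: "\<And>x x' x''. dist x x' < r \<Longrightarrow> dist x x'' < r \<Longrightarrow> \<bar>w x' - w x''\<bar> \<le> g x * dist x' x''"
    and g0: "\<And>x. 0 \<le> g x"
  shows "ennreal \<bar>w (\<gamma> a) - w (\<gamma> b)\<bar> \<le> line_integral (\<lambda>x. ennreal (g x)) \<gamma> a b"
proof -
  define l where "l = enn2real (curve_length \<gamma> a b)"
  define \<beta> where "\<beta> = arc_length_param \<gamma> a b"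
  have \<beta>: "\<beta> 0 = \<gamma> a" "\<beta> l = \<gamma> b"
    using arc_length_param_curve_length[OF assms(1-3), of a] arc_length_param_curve_length[OF assms(1-3), of b] assms(1)
    by (auto simp: \<beta>_def l_def)
  have l0: "0 \<le> l" by (simp add: l_def)
  have lip: "dist (\<beta> s) (\<beta> s') \<le> \<bar>s - s'\<bar>" if "0 \<le> s" "s \<le> l" "0 \<le> s'" "s' \<le> l" for s s'
    using arc_length_param_lipschitz[OF assms(1-3)] that by (simp add: l_def \<beta>_def)
  define f where "f s = ennreal (g (\<beta> s)) * indicator {0..l} s" for s
  have fm: "f \<in> borel_measurable lborel"
    using arc_length_param_measurable[OF assms(1-3), of "\<lambda>x. ennreal (g x)"] g by (simp add: f_def[abs_def] l_def \<beta>_def)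
  \<comment> \<open>Pieces of arc length below \<open>r\<close>: every point of a piece lies within
    \<open>r\<close> of both its ends and may serve as the centre \<open>x\<close> in the hypothesis
    \<open>w\<close>.\<close>
  obtain n :: nat where n: "l / r < real n" using reals_Archimedean2 by blast
  then have n0: "0 < n" using l0 r by (cases n) (auto simp: divide_less_0_iff)
  define t where "t i = real i * (l / n)" for i
  have tS: "t (Suc i) - t i = l / n" for i by (simp add: t_def distrib_right add_divide_distrib)
  have ln: "l / n < r" using n r n0 by (simp add: pos_divide_less_eq mult.commute)
  have mono: "mono_on {..n} t" unfolding t_def using l0 by (intro mono_onI mult_right_mono) auto
  have t0: "t 0 = 0" "t n = l" using n0 by (auto simp: t_def)
  have ln0: "0 \<le> l / n" using l0 by simp
  have step: "ennreal \<bar>w (\<beta> (t i)) - w (\<beta> (t (Suc i)))\<bar> \<le> (\<integral>\<^sup>+s\<in>{t i..t (Suc i)}. f s \<partial>lborel)"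
    if i: "i < n" for i
  proof -
    have ti: "0 \<le> t i" "t i \<le> t (Suc i)" "t (Suc i) \<le> l"
      using mono_onD[OF mono, of 0 i] mono_onD[OF mono, of i "Suc i"] mono_onD[OF mono, of "Suc i" n] i t0 by auto
    let ?D = "\<bar>w (\<beta> (t i)) - w (\<beta> (t (Suc i)))\<bar>"
    show ?thesis
    proof (cases "l / n = 0")
      case True
      then have "t i = t (Suc i)" using tS[of i] by linarith
      then show ?thesis by simp
    next
      case False
      then have pos: "0 < l / n" using ln0 by linarith
      have "?D / (l / n) \<le> g (\<beta> s)" if s: "s \<in> {t i..t (Suc i)}" for s
      proof -
        have "?D \<le> g (\<beta> s) * dist (\<beta> (t i)) (\<beta> (t (Suc i)))"
          using lip[of s "t i"] lip[of s "t (Suc i)"] s ti tS[of i] ln by (intro w) auto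
        also have "\<dots> \<le> g (\<beta> s) * (l / n)"
          using lip[of "t i" "t (Suc i)"] ti tS[of i] g0 by (intro mult_left_mono) auto
        finally show ?thesis by (subst pos_divide_le_eq[OF pos])
      qed
      then have "(\<integral>\<^sup>+s\<in>{t i..t (Suc i)}. ennreal (?D / (l / n)) \<partial>lborel) \<le> (\<integral>\<^sup>+s\<in>{t i..t (Suc i)}. f s \<partial>lborel)"
        using ti by (intro nn_integral_mono) (auto simp: f_def intro!: ennreal_leI split: split_indicator)
      moreover have "(\<integral>\<^sup>+s\<in>{t i..t (Suc i)}. ennreal (?D / (l / n)) \<partial>lborel) =
          ennreal (?D / (l / n)) * ennreal (l / n)"
        using ti tS[of i] by (simp add: nn_integral_cmult_indicator)
      moreover have "ennreal (?D / (l / n)) * ennreal (l / n) = ennreal (?D / (l / n) * (l / n))"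
        by (rule ennreal_mult[symmetric]) (use pos in \<open>auto intro: divide_nonneg_pos simp del: divide_divide_eq_right\<close>)
      moreover have "?D / (l / n) * (l / n) = ?D"
        using pos by (metis less_irrefl nonzero_eq_divide_eq)
      ultimately show ?thesis by simp
    qed
  qed
  have "\<bar>w (\<beta> (t 0)) - w (\<beta> (t m))\<bar> \<le> (\<Sum>i<m. \<bar>w (\<beta> (t i)) - w (\<beta> (t (Suc i)))\<bar>)" for m
    by (induction m) auto
  from this[of n] have "ennreal \<bar>w (\<gamma> a) - w (\<gamma> b)\<bar> \<le> ennreal (\<Sum>i<n. \<bar>w (\<beta> (t i)) - w (\<beta> (t (Suc i)))\<bar>)"
    by (intro ennreal_leI) (simp add: t0 \<beta>)
  also have "\<dots> = (\<Sum>i<n. ennreal \<bar>w (\<beta> (t i)) - w (\<beta> (t (Suc i)))\<bar>)" by simp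
  also have "\<dots> \<le> (\<Sum>i<n. \<integral>\<^sup>+s\<in>{t i..t (Suc i)}. f s \<partial>lborel)" by (intro sum_mono step) auto
  also have "\<dots> = (\<integral>\<^sup>+s\<in>{t 0..t n}. f s \<partial>lborel)" by (rule nn_integral_split_uniform[OF fm mono])
  also have "\<dots> = line_integral (\<lambda>x. ennreal (g x)) \<gamma> a b"
    unfolding line_integral_def t0 l_def[symmetric] \<beta>_def[symmetric]
    by (intro nn_integral_cong) (auto simp: f_def split: split_indicator)
  finally show ?thesis .
qed

section \<open>Averages in doubling metric measure spaces\<close>

text \<open>Separability is carried as an explicit countable dense set. Without it the Borel sets of
  the product could exceed the product of the Borel sigma-algebras, and \<open>dist\<close> might
  fail to be jointly measurable for Fubini.\<close>

locale doubling_space =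
  fixes M :: "'a::metric_space measure" and C :: real and D :: "'a set"
  assumes sets_M: "sets M = sets borel"
    and C_gt_1: "1 < C"
    and ball_fin: "\<And>x r. 0 < r \<Longrightarrow> emeasure M (ball x r) < \<infinity>"
    and ball_pos: "\<And>x r. 0 < r \<Longrightarrow> 0 < emeasure M (ball x r)"
    and doubling: "\<And>x r. 0 < r \<Longrightarrow> emeasure M (ball x (2 * r)) \<le> ennreal C * emeasure M (ball x r)"
    and countable_D: "countable D"
    and dense_D: "\<And>x e. 0 < e \<Longrightarrow> \<exists>z\<in>D. dist x z < e"
begin

lemma space_M: "space M = UNIV"
  using sets_eq_imp_space_eq[OF sets_M] by simp

lemma ball_sets [measurable, simp]: "ball x r \<in> sets M"
  by (simp add: sets_M)

lemma borel_M: "borel_measurable M = borel_measurable borel"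
  using sets_M by (rule measurable_cong_sets) simp

lemma emeasure_ball: "0 < r \<Longrightarrow> emeasure M (ball x r) = ennreal (measure M (ball x r))"
  using ball_fin[of r x] by (intro emeasure_eq_ennreal_measure) auto

lemma measure_ball_pos: "0 < r \<Longrightarrow> 0 < measure M (ball x r)"
  using ball_pos[of r x] emeasure_ball[of r x] by (metis ennreal_less_zero_iff)

lemma doubling_measure: "0 < r \<Longrightarrow> measure M (ball x (2 * r)) \<le> C * measure M (ball x r)"
  using doubling[of r x] emeasure_ball[of r x] emeasure_ball[of "2*r" x] C_gt_1
  by (simp flip: ennreal_mult add: ennreal_le_iff)

lemma doubling_power: "0 < r \<Longrightarrow> measure M (ball x (2 ^ k * r)) \<le> C ^ k * measure M (ball x r)"
proof (induction k)
  case (Suc k)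
  have "measure M (ball x (2 * (2 ^ k * r))) \<le> C * measure M (ball x (2 ^ k * r))"
    using Suc.prems by (intro doubling_measure) simp
  also have "\<dots> \<le> C * (C ^ k * measure M (ball x r))"
    using Suc C_gt_1 by (intro mult_left_mono) auto
  finally show ?case by (simp add: mult.assoc)
qed simp

lemma measure_ball_mono:
  assumes "ball x r \<subseteq> ball y R" "0 < R"
  shows "measure M (ball x r) \<le> measure M (ball y R)"
  using assms ball_fin[of R y] by (intro measure_mono_fmeasurable) (auto simp: fmeasurable_def)

text \<open>The common form of volume comparison: the number \<open>k\<close> of doublings is read
  off from the distance of the centres and the two radii, and every later volume constant is a power
  \<open>C ^ k\<close> obtained here.\<close>

lemma measure_ball_compare:
  assumes "0 < r" "dist x y + R \<le> 2 ^ k * r"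
  shows "measure M (ball x R) \<le> C ^ k * measure M (ball y r)"
proof -
  have "ball x R \<subseteq> ball y (2 ^ k * r)"
  proof
    fix z assume "z \<in> ball x R"
    then have "dist y z < 2 ^ k * r" using dist_triangle[of y z x] assms by (simp add: dist_commute)
    then show "z \<in> ball y (2 ^ k * r)" by simp
  qed
  then have "measure M (ball x R) \<le> measure M (ball y (2 ^ k * r))"
    using assms by (intro measure_ball_mono) auto
  also have "\<dots> \<le> C ^ k * measure M (ball y r)" using assms by (intro doubling_power)
  finally show ?thesis .
qed

lemma sigma_finite_M: "sigma_finite_measure M"
proof
  obtain x0 :: 'a where True by blast
  have "(\<Union>n::nat. ball x0 (Suc n)) = UNIV"
  proof -
    have "y \<in> (\<Union>n::nat. ball x0 (Suc n))" for y
    proof -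
      obtain n :: nat where "dist x0 y < n" using reals_Archimedean2 by blast
      then show ?thesis by (auto intro!: exI[of _ n])
    qed
    then show ?thesis by blast
  qed
  then show "\<exists>A. countable A \<and> A \<subseteq> sets M \<and> \<Union> A = space M \<and> (\<forall>a\<in>A. emeasure M a \<noteq> \<infinity>)"
    using ball_fin by (intro exI[of _ "range (\<lambda>n::nat. ball x0 (Suc n))"]) (auto simp: space_M less_top[symmetric])
qed

text \<open>Openness alone would not put the set into the product sigma-algebra, so it is written as
  a countable union of rectangles, with centres in \<open>D\<close> and rational radii.\<close>

lemma dist_less_product_sets: "{(x, y). dist x y < R} \<in> sets (borel \<Otimes>\<^sub>M (borel :: 'a measure))"
proof -
  have eq: "{(x, y). dist x y < R} = (\<Union>z\<in>D. \<Union>q\<in>\<rat>. ball z q \<times> ball z (R - q))"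
  proof (intro equalityI subsetI)
    fix w :: "'a \<times> 'a" assume "w \<in> {(x, y). dist x y < R}"
    then obtain x y where w: "w = (x, y)" "dist x y < R" by auto
    define e where "e = (R - dist x y) / 2"
    have e: "0 < e" using w by (simp add: e_def)
    obtain q where q: "q \<in> \<rat>" "0 < q" "q < e" using Rats_dense_in_real[OF e] by blast
    obtain z where z: "z \<in> D" "dist x z < q" using dense_D[OF q(2)] by blast
    have "dist z y < R - q" using dist_triangle[of z y x] z q e_def by (simp add: dist_commute field_simps)
    then show "w \<in> (\<Union>z\<in>D. \<Union>q\<in>\<rat>. ball z q \<times> ball z (R - q))"
      using w z q by (auto simp: dist_commute intro!: bexI[of _ z] bexI[of _ q])
  next
    fix w assume "w \<in> (\<Union>z\<in>D. \<Union>q\<in>\<rat>. ball z q \<times> ball z (R - q))"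
    then obtain z q where "fst w \<in> ball z q" "snd w \<in> ball z (R - q)" by auto
    then have "dist (fst w) (snd w) < R" using dist_triangle[of "fst w" "snd w" z] by (simp add: dist_commute)
    then show "w \<in> {(x, y). dist x y < R}" by (simp add: case_prod_beta)
  qed
  show ?thesis unfolding eq
    using countable_D countable_rat by (intro sets.countable_UN' pair_measureI) auto
qed

lemma measurable_emeasure_ball:
  assumes "sigma_finite_measure N" "sets N = sets borel"
  shows "(\<lambda>x. emeasure N (ball x R)) \<in> borel_measurable (borel :: 'a measure)"
proof -
  interpret N: sigma_finite_measure N by fact
  have "{(x, y). dist x y < R} \<in> sets ((borel :: 'a measure) \<Otimes>\<^sub>M N)"
    using dist_less_product_sets[of R] sets_pair_measure_cong[OF refl assms(2)] by auto
  from N.measurable_emeasure_Pair[OF this]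
  show ?thesis by (simp add: vimage_def ball_def)
qed

text \<open>After exchanging the integrals, the inner one integrates
  \<open>1 / measure M (ball x s)\<close> over \<open>x\<close> in \<open>ball y R\<close>. For such
  \<open>x\<close> doubling bounds \<open>measure M (ball y R)\<close> by
  \<open>C ^ k * measure M (ball x s)\<close>, because \<open>dist x y + R\<close> stays below
  \<open>2 * R\<close>.\<close>

lemma integral_energy_over_volume:
  assumes "finite_measure N" "sets N = sets borel" "0 < s" "0 < R" "2 * R \<le> 2 ^ k * s"
  shows "(\<integral>\<^sup>+x. ennreal (measure N (ball x R) / measure M (ball x s)) \<partial>M) \<le> ennreal (C ^ k * measure N UNIV)"
proof -
  interpret N: finite_measure N by fact
  interpret M: sigma_finite_measure M by (rule sigma_finite_M)
  interpret P: pair_sigma_finite N M by unfold_locales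
  have [measurable_cong]: "sets N = sets borel" "sets M = sets borel" by (simp_all add: assms sets_M)
  have spN: "space N = UNIV" using sets_eq_imp_space_eq[OF assms(2)] by simp
  have [measurable]: "{(y, x). dist x y < R} \<in> sets (borel \<Otimes>\<^sub>M (borel :: 'a measure))"
    using dist_less_product_sets[of R] by (simp add: dist_commute)
  define q where "q x = ennreal (1 / measure M (ball x s))" for x
  have [measurable]: "(\<lambda>x. emeasure M (ball x s)) \<in> borel_measurable borel"
    by (rule measurable_emeasure_ball[OF sigma_finite_M sets_M])
  have [measurable]: "q \<in> borel_measurable borel"
    unfolding q_def measure_def by measurable
  have "(\<integral>\<^sup>+x. ennreal (measure N (ball x R) / measure M (ball x s)) \<partial>M) =
    (\<integral>\<^sup>+x. q x * emeasure N (ball x R) \<partial>M)"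
    by (intro nn_integral_cong)
      (simp add: q_def N.emeasure_eq_measure ennreal_mult[symmetric])
  also have "\<dots> = (\<integral>\<^sup>+x. (\<integral>\<^sup>+y. q x * indicator {(y, x). dist x y < R} (y, x) \<partial>N) \<partial>M)"
  proof (intro nn_integral_cong)
    fix x
    have "(\<integral>\<^sup>+y. q x * indicator {(y, x). dist x y < R} (y, x) \<partial>N) = (\<integral>\<^sup>+y. q x * indicator (ball x R) y \<partial>N)"
      by (intro nn_integral_cong) (auto split: split_indicator)
    also have "\<dots> = q x * emeasure N (ball x R)"
      by (subst nn_integral_cmult_indicator) (auto simp: assms)
    finally show "q x * emeasure N (ball x R) = (\<integral>\<^sup>+y. q x * indicator {(y, x). dist x y < R} (y, x) \<partial>N)" ..
  qed
  also have "\<dots> = (\<integral>\<^sup>+y. (\<integral>\<^sup>+x. q x * indicator {(y, x). dist x y < R} (y, x) \<partial>M) \<partial>N)"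
    by (rule P.Fubini') measurable
  also have "\<dots> \<le> (\<integral>\<^sup>+y. ennreal (C ^ k) \<partial>N)"
  proof (intro nn_integral_mono)
    fix y
    have "(\<integral>\<^sup>+x. q x * indicator {(y, x). dist x y < R} (y, x) \<partial>M) \<le>
      (\<integral>\<^sup>+x. ennreal (C ^ k / measure M (ball y R)) * indicator (ball y R) x \<partial>M)"
    proof (intro nn_integral_mono)
      fix x
      show "q x * indicator {(y, x). dist x y < R} (y, x) \<le> ennreal (C ^ k / measure M (ball y R)) * indicator (ball y R) x"
      proof (cases "dist x y < R")
        case True
        have "measure M (ball y R) \<le> C ^ k * measure M (ball x s)"
          using True assms by (intro measure_ball_compare) (auto simp: dist_commute)
        then have "1 / measure M (ball x s) \<le> C ^ k / measure M (ball y R)"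
          using measure_ball_pos[of s x] measure_ball_pos[of R y] assms by (simp add: field_simps)
        then show ?thesis using True by (simp add: q_def dist_commute ennreal_leI)
      qed simp
    qed
    also have "\<dots> = ennreal (C ^ k / measure M (ball y R)) * emeasure M (ball y R)"
      by (subst nn_integral_cmult_indicator) auto
    also have "\<dots> = ennreal (C ^ k)"
      using measure_ball_pos[of R y] assms C_gt_1 by (simp add: emeasure_ball ennreal_mult[symmetric])
    finally show "(\<integral>\<^sup>+x. q x * indicator {(y, x). dist x y < R} (y, x) \<partial>M) \<le> ennreal (C ^ k)" .
  qed
  also have "\<dots> = ennreal (C ^ k * measure N UNIV)"
    using C_gt_1 by (simp add: spN N.emeasure_eq_measure ennreal_mult)
  finally show ?thesis .
qed

text \<open>From \<open>\<bar>w\<bar> \<le> t + t powr (1 - p) * \<bar>w\<bar> powr p\<close> with \<open>t\<close> close to \<open>T powr (1/p)\<close>.\<close>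

lemma average_le_Lp_average:
  fixes w :: "'a \<Rightarrow> real"
  assumes w: "w \<in> borel_measurable borel" and p: "1 \<le> p" and T: "0 \<le> T" and r: "0 < r"
    and le: "(\<integral>\<^sup>+y\<in>ball x r. ennreal (\<bar>w y\<bar> powr p) \<partial>M) \<le> ennreal (T * measure M (ball x r))"
  shows "(\<integral>\<^sup>+y\<in>ball x r. ennreal \<bar>w y\<bar> \<partial>M) \<le> ennreal (2 * T powr (1/p) * measure M (ball x r))"
proof -
  let ?B = "ball x r" and ?m = "measure M (ball x r)"
  have [measurable_cong]: "sets M = sets borel" by (rule sets_M)
  note w[measurable]
  have m0: "0 < ?m" using measure_ball_pos r .
  have *: "(\<integral>\<^sup>+y\<in>?B. ennreal \<bar>w y\<bar> \<partial>M) \<le> ennreal (2 * t * ?m)" if t: "0 < t" "T \<le> t powr p" for t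
  proof -
    have pt: "\<bar>w y\<bar> \<le> t + t powr (1 - p) * \<bar>w y\<bar> powr p" for y
    proof (cases "\<bar>w y\<bar> \<le> t")
      case True
      then show ?thesis by (simp add: add_increasing2)
    next
      case False
      then have "\<bar>w y\<bar> = \<bar>w y\<bar> powr (1 - p) * \<bar>w y\<bar> powr p" using t by (simp flip: powr_add)
      also have "\<dots> \<le> t powr (1 - p) * \<bar>w y\<bar> powr p"
        using False t p by (intro mult_right_mono powr_mono2') auto
      finally show ?thesis using t by linarith
    qed
    have "(\<integral>\<^sup>+y\<in>?B. ennreal \<bar>w y\<bar> \<partial>M) \<le>
      (\<integral>\<^sup>+y. (ennreal t * indicator ?B y + ennreal (t powr (1 - p)) * (ennreal (\<bar>w y\<bar> powr p) * indicator ?B y)) \<partial>M)"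
      using pt t by (intro nn_integral_mono) (auto simp: ennreal_mult[symmetric] ennreal_plus[symmetric] intro!: ennreal_leI simp del: ennreal_plus split: split_indicator)
    also have "\<dots> = ennreal t * emeasure M ?B + ennreal (t powr (1 - p)) * (\<integral>\<^sup>+y\<in>?B. ennreal (\<bar>w y\<bar> powr p) \<partial>M)"
      by (subst nn_integral_add) (auto simp: nn_integral_cmult_indicator nn_integral_cmult)
    also have "\<dots> \<le> ennreal t * emeasure M ?B + ennreal (t powr (1 - p)) * ennreal (T * ?m)"
      using le by (intro add_mono mult_left_mono) auto
    also have "\<dots> = ennreal (t * ?m + t powr (1 - p) * (T * ?m))"
      using t T r by (simp add: emeasure_ball ennreal_mult[symmetric] ennreal_plus[symmetric] del: ennreal_plus)
    also have "\<dots> \<le> ennreal (2 * t * ?m)"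
    proof (rule ennreal_leI)
      have "t powr (1 - p) * T \<le> t powr (1 - p) * t powr p" using t by (intro mult_left_mono) auto
      also have "\<dots> = t" using t by (simp flip: powr_add)
      finally have "t powr (1 - p) * T * ?m \<le> t * ?m" using m0 by (intro mult_right_mono) auto
      then show "t * ?m + t powr (1 - p) * (T * ?m) \<le> 2 * t * ?m" by (simp add: algebra_simps)
    qed
    finally show ?thesis .
  qed
  \<comment> \<open>Finiteness first, so that the limit in \<open>t\<close> can be taken among real
    numbers.\<close>
  have fin: "(\<integral>\<^sup>+y\<in>?B. ennreal \<bar>w y\<bar> \<partial>M) \<noteq> top"
  proof -
    have "(T powr (1/p)) powr p \<le> (T powr (1/p) + 1) powr p" using p by (intro powr_mono2) auto
    then have "T \<le> (T powr (1/p) + 1) powr p" using T p by (simp add: powr_powr)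
    then show ?thesis using *[of "T powr (1/p) + 1"] by (metis add_nonneg_pos ennreal_neq_top neq_top_trans powr_ge_zero zero_less_one)
  qed
  then obtain S where S: "(\<integral>\<^sup>+y\<in>?B. ennreal \<bar>w y\<bar> \<partial>M) = ennreal S" "0 \<le> S" by (metis ennreal_cases)
  have "S \<le> 2 * T powr (1/p) * ?m + e" if e: "0 < e" for e
  proof -
    \<comment> \<open>The shift keeps \<open>t\<close> positive even for \<open>T = 0\<close>, and
      its size contributes exactly \<open>e\<close> to the bound.\<close>
    define t where "t = T powr (1/p) + e / (2 * ?m)"
    have "(T powr (1/p)) powr p \<le> t powr p"
      using e m0 p by (intro powr_mono2) (auto simp: t_def)
    then have "T \<le> t powr p" using T p by (simp add: powr_powr)
    moreover have t0: "0 < t" using e m0 by (simp add: t_def add_nonneg_pos)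
    ultimately have "S \<le> 2 * t * ?m" using *[of t] S m0 by (simp add: ennreal_le_iff)
    also have "\<dots> = 2 * T powr (1/p) * ?m + e" using m0 by (simp add: t_def field_simps)
    finally show ?thesis .
  qed
  then have "S \<le> 2 * T powr (1/p) * ?m" by (rule field_le_epsilon)
  then show ?thesis using S by (simp add: ennreal_leI)
qed

section \<open>Averages against cone kernels\<close>

definition cone :: "real \<Rightarrow> 'a \<Rightarrow> 'a \<Rightarrow> real" where
  "cone r x y = max 0 (1 - dist x y / r)"

definition cone_average :: "real \<Rightarrow> ('a \<Rightarrow> real) \<Rightarrow> 'a \<Rightarrow> real" where
  "cone_average r u x = (\<integral>y. cone r x y * u y \<partial>M) / (\<integral>y. cone r x y \<partial>M)"

lemma cone_bounds: "0 < r \<Longrightarrow> 0 \<le> cone r x y" "0 < r \<Longrightarrow> cone r x y \<le> 1"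
  by (auto simp: cone_def)

lemma cone_eq_0: "0 < r \<Longrightarrow> y \<notin> ball x r \<Longrightarrow> cone r x y = 0"
  by (auto simp: cone_def field_simps)

lemma cone_le_indicator: "0 < r \<Longrightarrow> cone r x y \<le> indicator (ball x r) y"
  using cone_bounds[of r x y] cone_eq_0[of r y x] by (auto split: split_indicator)

lemma cone_measurable [measurable]: "cone r x \<in> borel_measurable borel"
  unfolding cone_def divide_inverse by (intro borel_measurable_continuous_onI continuous_intros)

lemma cone_diff:
  assumes "0 < r"
  shows "\<bar>cone r x y - cone r x' y\<bar> \<le> dist x x' / r"
proof -
  have "\<bar>cone r x y - cone r x' y\<bar> \<le> \<bar>dist x y / r - dist x' y / r\<bar>" by (auto simp: cone_def max_def)
  also have "\<dots> = \<bar>dist x y - dist x' y\<bar> / r" using assms by (simp add: diff_divide_distrib[symmetric])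
  also have "\<dots> \<le> dist x x' / r" using assms abs_dist_diff_le[of x y x']
    by (intro divide_right_mono) (auto simp: dist_commute)
  finally show ?thesis .
qed

lemma bounded_integrable:
  fixes f :: "'a \<Rightarrow> real"
  assumes "f \<in> borel_measurable borel" "\<And>y. \<bar>f y\<bar> \<le> b" "\<And>y. y \<notin> ball x r \<Longrightarrow> f y = 0" "0 < r"
  shows "integrable M f"
proof (rule integrableI_bounded_set[where A = "ball x r" and B = b])
  show "f \<in> borel_measurable M" using assms(1) by (simp add: borel_M)
qed (use assms ball_fin in auto)

lemma cone_integrable:
  fixes f :: "'a \<Rightarrow> real"
  assumes "f \<in> borel_measurable borel" "\<And>y. \<bar>f y\<bar> \<le> b" "0 < r"
  shows "integrable M (\<lambda>y. cone r x y * f y)"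
proof (rule bounded_integrable)
  show "\<bar>cone r x y * f y\<bar> \<le> b" for y
  proof -
    have "\<bar>cone r x y * f y\<bar> \<le> 1 * b"
      unfolding abs_mult using cone_bounds[OF assms(3), of x y] assms(2)[of y]
      by (intro mult_mono) auto
    then show ?thesis by simp
  qed
qed (use assms cone_eq_0 in auto)

lemma cone_mass_lower:
  assumes "0 < r"
  shows "measure M (ball x (r/2)) / 2 \<le> (\<integral>y. cone r x y \<partial>M)"
proof -
  have "(\<integral>y. (1/2) * indicator (ball x (r/2)) y \<partial>M) \<le> (\<integral>y. cone r x y \<partial>M)"
  proof (rule integral_mono)
    show "integrable M (\<lambda>y. (1/2) * indicator (ball x (r/2)) y :: real)"
      using ball_fin[of "r/2" x] assms by (intro integrable_mult_right integrable_real_indicator) auto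
    show "integrable M (cone r x)" using cone_integrable[of "\<lambda>_. 1" 1 r x] assms by simp
    show "(1/2) * indicator (ball x (r/2)) y \<le> cone r x y" for y
      using assms by (auto simp: cone_def field_simps split: split_indicator)
  qed
  then show ?thesis by simp
qed

text \<open>Write the average as a quotient of \<open>J\<close> and \<open>I\<close>. Moving the
  centre by \<open>d\<close> changes each kernel by at most \<open>d / r\<close>, on
  \<open>ball x (2 * r)\<close> only, while the mass \<open>I\<close> stays comparable to the volume
  of that ball. The constant \<open>c\<close> is free; the application takes the mean of
  \<open>u\<close>, so that the integral becomes the left side of a Poincare inequality.\<close>

lemma cone_average_lipschitz:
  fixes u :: "'a \<Rightarrow> real"
  assumes u: "u \<in> borel_measurable borel" "\<And>y. \<bar>u y\<bar> \<le> b" and r: "0 < r"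
    and x: "dist x x' < r" "dist x x'' < r"
  shows "\<bar>cone_average r u x' - cone_average r u x''\<bar> \<le>
    (2 * C ^ 3 + (2 * C ^ 3)\<^sup>2) / (r * measure M (ball x (2 * r))) * (LINT y:ball x (2 * r)|M. \<bar>u y - c\<bar>) * dist x' x''"
proof -
  note u(1)[measurable]
  let ?B = "ball x (2 * r)"
  define K where "K = 2 * C ^ 3"
  define m where "m = measure M ?B"
  define d where "d = dist x' x''"
  define S where "S = (LINT y:?B|M. \<bar>u y - c\<bar>)"
  define I where "I z = (\<integral>y. cone r z y \<partial>M)" for z
  define J where "J z = (\<integral>y. cone r z y * (u y - c) \<partial>M)" for z
  have m: "0 < m" unfolding m_def using r by (intro measure_ball_pos) simp
  have K: "0 < K" using C_gt_1 by (simp add: K_def)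
  have bd: "\<bar>u y - c\<bar> \<le> b + \<bar>c\<bar>" for y using u(2)[of y] by linarith
  have sub: "ball z r \<subseteq> ?B" if "dist x z < r" for z
  proof
    fix y assume "y \<in> ball z r"
    then show "y \<in> ?B" using that dist_triangle[of x y z] by simp
  qed
  have int1: "integrable M (cone r z)" for z
    using cone_integrable[of "\<lambda>_. 1" 1 r z] r by simp
  have intu: "integrable M (\<lambda>y. cone r z y * (u y - c))" for z
    using cone_integrable[of "\<lambda>y. u y - c" "b + \<bar>c\<bar>" r z] r bd by simp
  have intu0: "integrable M (\<lambda>y. cone r z y * u y)" for z
    using cone_integrable[of u b r z] r u by simp
  have intB: "integrable M (\<lambda>y. indicator ?B y * \<bar>u y - c\<bar>)"
  proof (rule bounded_integrable[where b = "b + \<bar>c\<bar>" and x = x and r = "2 * r"])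
    have [measurable]: "?B \<in> sets borel" by simp
    show "(\<lambda>y. indicator ?B y * \<bar>u y - c\<bar>) \<in> borel_measurable borel" by measurable
    show "\<bar>indicator ?B y * \<bar>u y - c\<bar>\<bar> \<le> b + \<bar>c\<bar>" for y
      using bd[of y] by (auto simp: abs_mult split: split_indicator)
  qed (use r in auto)
  have S: "S = (\<integral>y. indicator ?B y * \<bar>u y - c\<bar> \<partial>M)" by (simp add: S_def set_lebesgue_integral_def)
  have S0: "0 \<le> S" unfolding S by (intro integral_nonneg_AE) auto
  \<comment> \<open>The cone is at least 1/2 on \<open>ball z (r/2)\<close>, and three doublings of
    that ball cover \<open>ball x (2 * r)\<close>: this is the origin of \<open>K\<close>.\<close>
  have I: "m / K \<le> I z" if z: "dist x z < r" for z
  proof -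
    have "m \<le> C ^ 3 * measure M (ball z (r/2))"
      unfolding m_def using z r by (intro measure_ball_compare) auto
    then have "m / C ^ 3 \<le> measure M (ball z (r/2))" using C_gt_1 by (simp add: field_simps)
    then show ?thesis using cone_mass_lower[OF r, of z] by (simp add: I_def K_def)
  qed
  have Ipos: "0 < I z" if "dist x z < r" for z using I[OF that] m K by (meson divide_pos_pos order_less_le_trans)
  \<comment> \<open>Normalised averages commute with subtracting a constant, so \<open>u\<close> may
    be replaced by \<open>u - c\<close> in the numerator.\<close>
  have avg: "cone_average r u z = J z / I z + c" if "dist x z < r" for z
  proof -
    have "J z = (\<integral>y. cone r z y * u y \<partial>M) - c * I z"
      unfolding J_def I_def using int1 intu0 by (simp add: right_diff_distrib mult.commute[of _ c])
    then show ?thesis using Ipos[OF that] by (simp add: cone_average_def I_def[symmetric] field_simps)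
  qed
  have J: "\<bar>J z\<bar> \<le> S" if z: "dist x z < r" for z
  proof -
    have "\<bar>J z\<bar> \<le> (\<integral>y. \<bar>cone r z y * (u y - c)\<bar> \<partial>M)" unfolding J_def by (rule integral_abs_bound)
    also have "\<dots> \<le> S" unfolding S
    proof (rule integral_mono)
      show "integrable M (\<lambda>y. \<bar>cone r z y * (u y - c)\<bar>)" using intu by simp
      show "\<bar>cone r z y * (u y - c)\<bar> \<le> indicator ?B y * \<bar>u y - c\<bar>" for y
      proof -
        have "\<bar>cone r z y\<bar> \<le> indicator ?B y"
          using cone_le_indicator[OF r, of z y] cone_bounds(1)[OF r, of z y] sub[OF z] by (auto split: split_indicator_asm split_indicator)
        then show ?thesis by (simp add: abs_mult mult_right_mono)
      qed
    qed (rule intB)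
    finally show ?thesis .
  qed
  have cd: "\<bar>cone r x' y - cone r x'' y\<bar> \<le> d / r * indicator ?B y" for y
  proof (cases "y \<in> ?B")
    case True
    then show ?thesis using cone_diff[OF r, of x' y x''] by (simp add: d_def)
  next
    case False
    then have "cone r x' y = 0" "cone r x'' y = 0" using sub[OF x(1)] sub[OF x(2)] cone_eq_0[OF r] by blast+
    then show ?thesis using False by simp
  qed
  have JJ: "\<bar>J x' - J x''\<bar> \<le> d / r * S"
  proof -
    have "J x' - J x'' = (\<integral>y. (cone r x' y - cone r x'' y) * (u y - c) \<partial>M)"
      unfolding J_def using intu by (subst Bochner_Integration.integral_diff[symmetric]) (auto simp: left_diff_distrib)
    also have "\<bar>\<dots>\<bar> \<le> (\<integral>y. \<bar>(cone r x' y - cone r x'' y) * (u y - c)\<bar> \<partial>M)" by (rule integral_abs_bound)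
    also have "\<dots> \<le> (\<integral>y. d / r * (indicator ?B y * \<bar>u y - c\<bar>) \<partial>M)"
    proof (rule integral_mono)
      show "integrable M (\<lambda>y. \<bar>(cone r x' y - cone r x'' y) * (u y - c)\<bar>)"
        using Bochner_Integration.integrable_diff[OF intu[of x'] intu[of x'']] by (intro integrable_abs) (simp add: left_diff_distrib)
      show "integrable M (\<lambda>y. d / r * (indicator ?B y * \<bar>u y - c\<bar>))" using intB by (rule integrable_mult_right)
      show "\<bar>(cone r x' y - cone r x'' y) * (u y - c)\<bar> \<le> d / r * (indicator ?B y * \<bar>u y - c\<bar>)" for y
        using mult_right_mono[OF cd[of y], of "\<bar>u y - c\<bar>"] by (simp add: abs_mult)
    qed
    also have "\<dots> = d / r * S" unfolding S by (rule integral_mult_right_zero)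
    finally show ?thesis .
  qed
  have II: "\<bar>I x'' - I x'\<bar> \<le> d / r * m"
  proof -
    have "I x' - I x'' = (\<integral>y. cone r x' y - cone r x'' y \<partial>M)"
      unfolding I_def using int1 by (simp add: Bochner_Integration.integral_diff)
    also have "\<bar>\<dots>\<bar> \<le> (\<integral>y. \<bar>cone r x' y - cone r x'' y\<bar> \<partial>M)" by (rule integral_abs_bound)
    also have "\<dots> \<le> (\<integral>y. d / r * indicator ?B y \<partial>M)"
    proof (rule integral_mono)
      show "integrable M (\<lambda>y. d / r * indicator ?B y)"
        using ball_fin[of "2*r" x] r by (intro integrable_mult_right integrable_real_indicator) auto
    qed (use int1 cd in auto)
    also have "\<dots> = d / r * m" by (simp add: m_def)
    finally show ?thesis by (simp add: abs_minus_commute)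
  qed
  have dr: "0 \<le> d / r" using r by (simp add: d_def)
  have inv: "1 / I z \<le> K / m" if "dist x z < r" for z
    using I[OF that] Ipos[OF that] m K by (simp add: field_simps)
  \<comment> \<open>The two summands isolate the change of the numerator and of the mass; they
    produce \<open>K\<close> and \<open>K\<^sup>2\<close> respectively.\<close>
  have eq: "J x' / I x' - J x'' / I x'' = (J x' - J x'') * (1 / I x') + J x'' * (I x'' - I x') * (1 / I x') * (1 / I x'')"
    using Ipos[OF x(1)] Ipos[OF x(2)] by (simp add: field_simps)
  have "\<bar>cone_average r u x' - cone_average r u x''\<bar> = \<bar>J x' / I x' - J x'' / I x''\<bar>"
    using avg x by simp
  also have "\<dots> \<le> \<bar>J x' - J x''\<bar> * (1 / I x') + \<bar>J x''\<bar> * \<bar>I x'' - I x'\<bar> * (1 / I x') * (1 / I x'')"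
    unfolding eq using Ipos[OF x(1)] Ipos[OF x(2)]
    by (intro order_trans[OF abs_triangle_ineq]) (simp add: abs_mult)
  also have "\<dots> \<le> (d / r * S) * (K / m) + S * (d / r * m) * (K / m) * (K / m)"
    using JJ II J[OF x(2)] inv[OF x(1)] inv[OF x(2)] Ipos[OF x(1)] Ipos[OF x(2)] S0 dr m K
    by (intro add_mono mult_mono mult_nonneg_nonneg) (auto intro: less_imp_le)
  also have "\<dots> = (K + K\<^sup>2) / (r * m) * S * d"
    using m r by (simp add: field_simps power2_eq_square)
  finally show ?thesis by (simp add: K_def m_def S_def d_def)
qed

lemma cone_average_approx:
  fixes u :: "'a \<Rightarrow> real"
  assumes u: "u \<in> borel_measurable borel" "\<And>y. \<bar>u y\<bar> \<le> b" and r: "0 < r"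
    and e: "\<And>y. dist x y < r \<Longrightarrow> \<bar>u y - u x\<bar> \<le> e"
  shows "\<bar>cone_average r u x - u x\<bar> \<le> e"
proof -
  define I where "I = (\<integral>y. cone r x y \<partial>M)"
  have int1: "integrable M (cone r x)"
    using cone_integrable[of "\<lambda>_. 1" 1 r x] r by simp
  have intu0: "integrable M (\<lambda>y. cone r x y * u y)"
    using cone_integrable[of u b r x] r u by simp
  have I: "0 < I" using cone_mass_lower[OF r, of x] measure_ball_pos[of "r/2" x] r by (simp add: I_def)
  have "(\<integral>y. cone r x y * u y \<partial>M) - u x * I = (\<integral>y. cone r x y * (u y - u x) \<partial>M)"
    unfolding I_def using int1 intu0 by (simp add: right_diff_distrib mult.commute)
  also have "\<bar>\<dots>\<bar> \<le> (\<integral>y. \<bar>cone r x y * (u y - u x)\<bar> \<partial>M)" by (rule integral_abs_bound)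
  also have "\<dots> \<le> (\<integral>y. e * cone r x y \<partial>M)"
  proof (rule integral_mono)
    show "integrable M (\<lambda>y. \<bar>cone r x y * (u y - u x)\<bar>)"
      using int1 intu0 by (intro integrable_abs) (simp add: right_diff_distrib)
    show "\<bar>cone r x y * (u y - u x)\<bar> \<le> e * cone r x y" for y
    proof (cases "y \<in> ball x r")
      case True
      then show ?thesis using e[of y] cone_bounds[OF r, of x y] mult_right_mono[of "\<bar>u y - u x\<bar>" e "cone r x y"] by (simp add: abs_mult mult.commute)
    qed (use cone_eq_0[OF r] in simp)
  qed (use int1 in simp)
  also have "\<dots> = e * I" by (simp add: I_def)
  finally have "\<bar>(\<integral>y. cone r x y * u y \<partial>M) - u x * I\<bar> \<le> e * I" .
  moreover have "cone_average r u x - u x = ((\<integral>y. cone r x y * u y \<partial>M) - u x * I) / I"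
    using I by (simp add: cone_average_def I_def[symmetric] field_simps)
  ultimately show ?thesis using I by (simp add: pos_divide_le_eq)
qed

end

section \<open>Vanishing modulus\<close>

lemma ennreal_le_suminf: "h n \<le> (\<Sum>n. h n :: ennreal)"
  using sum_le_suminf[of h "{n}"] by simp

lemma ennreal_powr_ennreal [simp]: "0 \<le> x \<Longrightarrow> ennreal_powr (ennreal x) p = ennreal (x powr p)"
  by (simp add: ennreal_powr_def)

lemma ennreal_powr_top [simp]: "ennreal_powr top p = top"
  by (simp add: ennreal_powr_def)

lemma ennreal_powr_mono:
  assumes "0 \<le> p" "x \<le> y"
  shows "ennreal_powr x p \<le> ennreal_powr y p"
proof (cases y)
  case (real b)
  then obtain a where "x = ennreal a" "0 \<le> a" using assms(2) by (cases x) (auto simp: top_unique)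
  then show ?thesis using real assms by (simp add: ennreal_leI powr_mono2)
qed simp

lemma ennreal_powr_inverse:
  assumes "0 < p"
  shows "ennreal_powr (ennreal_powr x (1/p)) p = x" "ennreal_powr (ennreal_powr x p) (1/p) = x"
  using assms by (cases x; simp add: powr_powr)+

lemma measurable_ennreal_powr [measurable]:
  assumes [measurable]: "f \<in> borel_measurable N"
  shows "(\<lambda>x. ennreal_powr (f x) p) \<in> borel_measurable N"
  unfolding ennreal_powr_def by measurable

text \<open>Uniform continuity on the compact support would miss pairs with one point outside it. A
  Lebesgue number for the cover by preimages of intervals of length \<open>e\<close> controls whole
  balls around points of the support; away from it both values are zero.\<close>

lemma Cc_uniformly_continuous:
  assumes u: "u \<in> Cc_space" and e: "0 < e"
  obtains d where "0 < d" "\<And>x y. dist x y < d \<Longrightarrow> \<bar>u x - u y\<bar> < e"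
proof -
  let ?K = "closure {x. u x \<noteq> 0}"
  have K: "compact ?K" and cont: "continuous_on UNIV u" using u by (auto simp: Cc_space_def)
  let ?\<C> = "range (\<lambda>c. u -` {c - e/2 <..< c + e/2})"
  have op: "open G" if "G \<in> ?\<C>" for G
    using that cont by (auto simp: continuous_on_open_vimage)
  have cov: "?K \<subseteq> \<Union>?\<C>"
  proof
    fix x assume "x \<in> ?K"
    have "x \<in> u -` {u x - e/2 <..< u x + e/2}" using e by simp
    then show "x \<in> \<Union>?\<C>" by blast
  qed
  obtain d where d: "0 < d" "\<And>x. x \<in> ?K \<Longrightarrow> \<exists>G\<in>?\<C>. ball x d \<subseteq> G"
    using Heine_Borel_lemma[OF K cov op] by blast
  have *: "\<bar>u x - u y\<bar> < e" if x: "x \<in> ?K" "dist x y < d" for x y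
  proof -
    obtain c where "ball x d \<subseteq> u -` {c - e/2 <..< c + e/2}" using d(2)[of x] x(1) by blast
    then have "u x \<in> {c - e/2 <..< c + e/2}" "u y \<in> {c - e/2 <..< c + e/2}"
      using x d(1) centre_in_ball[of x d] mem_ball[of y x d] by blast+
    then show ?thesis by auto
  qed
  have "\<bar>u x - u y\<bar> < e" if "dist x y < d" for x y
  proof (cases "x \<in> ?K \<or> y \<in> ?K")
    case True
    then show ?thesis using *[of x y] *[of y x] that by (auto simp: dist_commute abs_minus_commute)
  next
    case False
    then have "u x = 0" "u y = 0" using subsetD[OF closure_subset[of "{x. u x \<noteq> 0}"]] by blast+
    then show ?thesis using e by simp
  qed
  then show thesis using d(1) that by blast
qed

lemma Cc_bounded:
  assumes "u \<in> Cc_space"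
  obtains b where "\<And>x. \<bar>u x\<bar> \<le> b"
proof -
  let ?K = "closure {x. u x \<noteq> 0}"
  have "compact (u ` ?K)"
    using assms by (intro compact_continuous_image) (auto simp: Cc_space_def intro: continuous_on_subset)
  then obtain b where b: "\<And>y. y \<in> u ` ?K \<Longrightarrow> norm y \<le> b"
    using compact_imp_bounded bounded_iff by metis
  have "\<bar>u x\<bar> \<le> max b 0" for x
  proof (cases "u x = 0")
    case False
    then have "x \<in> ?K" using subsetD[OF closure_subset[of "{x. u x \<noteq> 0}"]] by blast
    then show ?thesis using b[of "u x"] by auto
  qed simp
  then show thesis using that by blast
qed

lemma Cc_measurable: "u \<in> Cc_space \<Longrightarrow> u \<in> borel_measurable borel"
  by (auto simp: Cc_space_def intro: borel_measurable_continuous_onI)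

text \<open>A real-valued \<open>SUP\<close> bounds its terms only over a bounded range; compact
  support of both functions supplies this.\<close>

lemma Cc_sup_dist:
  assumes "f \<in> Cc_space" "g \<in> Cc_space" "(SUP x. \<bar>f x - g x\<bar>) < (e::real)"
  shows "\<bar>f x - g x\<bar> < e"
proof -
  obtain b where b: "\<And>x. \<bar>f x\<bar> \<le> b" using Cc_bounded[OF assms(1)] by blast
  obtain c where c: "\<And>x. \<bar>g x\<bar> \<le> c" using Cc_bounded[OF assms(2)] by blast
  have "\<bar>f x - g x\<bar> \<le> b + c" for x using b[of x] c[of x] by linarith
  then have "\<bar>f x - g x\<bar> \<le> (SUP x. \<bar>f x - g x\<bar>)" by (intro cSUP_upper bdd_aboveI2[where M = "b + c"]) auto
  then show ?thesis using assms(3) by simp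
qed

section \<open>Gradients of smoothed functions and the vanishing of the modulus\<close>

locale doubling_dirichlet_space =
  regular_local_dirichlet_space p M E F \<Gamma> + doubling_space M C D
  for p and M :: "'a::metric_space measure" and E F \<Gamma> C D
begin

text \<open>\<open>Q\<close> stands for the Poincare factor at radius \<open>2 * r\<close>. The
  expression in \<open>C\<close> is the constant of \<open>cone_average_lipschitz\<close>, and the
  extra factor 2 in \<open>A\<close> is the one lost in \<open>average_le_Lp_average\<close> when
  passing from the p-th power mean to the mean.\<close>

lemma cone_average_gradient:
  fixes u :: "'a \<Rightarrow> real"
  assumes uF: "u \<in> F" and u: "u \<in> borel_measurable borel" "\<And>y. \<bar>u y\<bar> \<le> b" and r: "0 < r"
    and Q: "0 \<le> Q" and a: "1 \<le> a" "2 * a \<le> 2 ^ k"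
    and PI: "\<And>x. (\<integral>\<^sup>+y\<in>ball x (2 * r). ennreal (\<bar>u y - set_average M (ball x (2 * r)) u\<bar> powr p) \<partial>M)
          \<le> ennreal Q * emeasure (\<Gamma> u) (ball x (a * (2 * r)))"
  defines "A \<equiv> 2 * (2 * C ^ 3 + (2 * C ^ 3)\<^sup>2)"
  obtains g where "g \<in> borel_measurable borel" "\<And>x. 0 \<le> g x"
    "\<And>x x' x''. dist x x' < r \<Longrightarrow> dist x x'' < r \<Longrightarrow>
       \<bar>cone_average r u x' - cone_average r u x''\<bar> \<le> g x * dist x' x''"
    "(\<integral>\<^sup>+x. ennreal (g x powr p) \<partial>M) \<le> ennreal ((A / r) powr p * Q * C ^ k * E u)"
proof -
  interpret G: finite_measure "\<Gamma> u" using energy_finite uF .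
  note u(1)[measurable]
  have [measurable_cong]: "sets M = sets borel" by (rule sets_M)
  have A: "0 \<le> A" using C_gt_1 by (simp add: A_def)
  define m where "m x = measure M (ball x (2 * r))" for x
  define N where "N x = measure (\<Gamma> u) (ball x (a * (2 * r)))" for x
  define T where "T x = Q * N x / m x" for x
  define g where "g x = A / r * T x powr (1/p)" for x
  have m: "0 < m x" for x using measure_ball_pos r by (simp add: m_def)
  have N: "0 \<le> N x" for x by (simp add: N_def)
  have T: "0 \<le> T x" for x using m[of x] N[of x] Q by (simp add: T_def)
  have p: "0 < p" "p \<noteq> 0" using p_ge_1 by auto
  have meas: "(\<lambda>x. emeasure M (ball x (2 * r))) \<in> borel_measurable borel"
    "(\<lambda>x. emeasure (\<Gamma> u) (ball x (a * (2 * r)))) \<in> borel_measurable borel"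
    by (intro measurable_emeasure_ball sigma_finite_M sets_M energy_sets[OF uF] G.sigma_finite_measure_axioms)+
  note this[measurable]
  have [measurable]: "m \<in> borel_measurable borel" "N \<in> borel_measurable borel"
    unfolding m_def N_def measure_def by measurable
  have [measurable]: "g \<in> borel_measurable borel"
    unfolding g_def T_def by measurable
  show thesis
  proof
    show "g \<in> borel_measurable borel" by measurable
    show "0 \<le> g x" for x using A r by (simp add: g_def)
    show "\<bar>cone_average r u x' - cone_average r u x''\<bar> \<le> g x * dist x' x''"
      if x: "dist x x' < r" "dist x x'' < r" for x x' x''
    proof -
      define c where "c = set_average M (ball x (2 * r)) u"
      define S where "S = (LINT y:ball x (2 * r)|M. \<bar>u y - c\<bar>)"
      have "(\<integral>\<^sup>+y\<in>ball x (2 * r). ennreal (\<bar>u y - c\<bar> powr p) \<partial>M) \<le> ennreal (T x * measure M (ball x (2 * r)))"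
        using PI[of x] Q m[of x] by (simp add: c_def T_def N_def m_def G.emeasure_eq_measure ennreal_mult[symmetric])
      then have "(\<integral>\<^sup>+y\<in>ball x (2 * r). ennreal \<bar>u y - c\<bar> \<partial>M) \<le> ennreal (2 * T x powr (1/p) * m x)"
        unfolding m_def using T p_ge_1 r by (intro average_le_Lp_average) auto
      moreover have "ennreal S = (\<integral>\<^sup>+y\<in>ball x (2 * r). ennreal \<bar>u y - c\<bar> \<partial>M)"
      proof -
        have "integrable M (\<lambda>y. indicator (ball x (2 * r)) y * \<bar>u y - c\<bar>)"
        proof (rule bounded_integrable[where b = "b + \<bar>c\<bar>" and x = x and r = "2 * r"])
          show "(\<lambda>y. indicator (ball x (2 * r)) y * \<bar>u y - c\<bar>) \<in> borel_measurable borel"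
            by (intro borel_measurable_times borel_measurable_indicator borel_measurable_abs borel_measurable_diff u) auto
          show "\<bar>indicator (ball x (2 * r)) y * \<bar>u y - c\<bar>\<bar> \<le> b + \<bar>c\<bar>" for y
            using u(2)[of y] by (auto split: split_indicator)
        qed (use r in auto)
        then have "(\<integral>\<^sup>+y. ennreal (indicator (ball x (2 * r)) y * \<bar>u y - c\<bar>) \<partial>M) = ennreal S"
          unfolding S_def set_lebesgue_integral_def by (subst nn_integral_eq_integral) auto
        then show ?thesis by (simp add: ennreal_mult' mult.commute ennreal_indicator)
      qed
      ultimately have "ennreal S \<le> ennreal (2 * T x powr (1/p) * m x)" by order
      then have "S \<le> 2 * T x powr (1/p) * m x"
        using m[of x] by (subst (asm) ennreal_le_iff) auto
      then have "(A / 2) / (r * m x) * S * dist x' x'' \<le> (A / 2) / (r * m x) * (2 * T x powr (1/p) * m x) * dist x' x''"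
        using A m[of x] r by (intro mult_right_mono mult_left_mono) auto
      moreover have "\<bar>cone_average r u x' - cone_average r u x''\<bar> \<le> (A / 2) / (r * m x) * S * dist x' x''"
      proof -
        have "A / 2 = 2 * C ^ 3 + (2 * C ^ 3)\<^sup>2" by (simp add: A_def)
        then show ?thesis unfolding m_def S_def using cone_average_lipschitz[OF u r x, of c] by presburger
      qed
      moreover have "(A / 2) / (r * m x) * (2 * T x powr (1/p) * m x) * dist x' x'' = g x * dist x' x''"
        using m[of x] r by (simp add: g_def field_simps)
      ultimately show ?thesis by linarith
    qed
    have "(\<integral>\<^sup>+x. ennreal (g x powr p) \<partial>M) = (\<integral>\<^sup>+x. ennreal ((A / r) powr p * Q) * ennreal (N x / m x) \<partial>M)"
    proof (intro nn_integral_cong)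
      fix x
      have "g x powr p = (A / r) powr p * (T x powr (1/p)) powr p"
        unfolding g_def using A r by (intro powr_mult)
      also have "(T x powr (1/p)) powr p = T x" using T[of x] p by (simp add: powr_powr)
      finally have "g x powr p = (A / r) powr p * Q * (N x / m x)" by (simp add: T_def)
      then show "ennreal (g x powr p) = ennreal ((A / r) powr p * Q) * ennreal (N x / m x)"
        using Q N[of x] m[of x] by (simp add: ennreal_mult[symmetric])
    qed
    also have "\<dots> = ennreal ((A / r) powr p * Q) * (\<integral>\<^sup>+x. ennreal (N x / m x) \<partial>M)"
      by (intro nn_integral_cmult) measurable
    also have "\<dots> \<le> ennreal ((A / r) powr p * Q) * ennreal (C ^ k * measure (\<Gamma> u) UNIV)"
    proof (intro mult_left_mono)
      show "(\<integral>\<^sup>+x. ennreal (N x / m x) \<partial>M) \<le> ennreal (C ^ k * measure (\<Gamma> u) UNIV)"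
        unfolding N_def m_def
        by (rule integral_energy_over_volume[OF energy_finite[OF uF] energy_sets[OF uF]]) (use a r in auto)
    qed simp
    also have "\<dots> = ennreal ((A / r) powr p * Q * C ^ k * E u)"
      using Q C_gt_1 E_nonneg[OF uF] by (simp add: energy_total[OF uF] ennreal_mult[symmetric] mult.assoc)
    finally show "(\<integral>\<^sup>+x. ennreal (g x powr p) \<partial>M) \<le> ennreal ((A / r) powr p * Q * C ^ k * E u)" .
  qed
qed

lemma small_gradient_approximation:
  assumes u: "u \<in> F" "u \<in> Cc_space" and PI: "poincare_inequality p \<Psi> M F \<Gamma>"
    and pos: "\<And>r. 0 < r \<Longrightarrow> 0 < \<Psi> r"
    and small: "\<And>\<eta> \<delta>. 0 < \<eta> \<Longrightarrow> 0 < \<delta> \<Longrightarrow> \<exists>r. 0 < r \<and> r < \<delta> \<and> \<Psi> r / r powr p < \<eta>"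
    and e: "0 < e" and d: "0 < d"
  shows "\<exists>w g r. 0 < r \<and> g \<in> borel_measurable borel \<and> (\<forall>x. 0 \<le> g x) \<and> (\<forall>x. \<bar>w x - u x\<bar> \<le> e) \<and>
    (\<forall>x x' x''. dist x x' < r \<longrightarrow> dist x x'' < r \<longrightarrow> \<bar>w x' - w x''\<bar> \<le> g x * dist x' x'') \<and>
    (\<integral>\<^sup>+x. ennreal (g x powr p) \<partial>M) \<le> ennreal d"
proof -
  obtain c a where c: "0 < c" and a: "1 \<le> a" and
    PI: "\<And>x r u. 0 < r \<Longrightarrow> u \<in> F \<Longrightarrow> (\<integral>\<^sup>+y\<in>ball x r. ennreal (\<bar>u y - set_average M (ball x r) u\<bar> powr p) \<partial>M)
          \<le> ennreal (c * \<Psi> r) * emeasure (\<Gamma> u) (ball x (a * r))"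
    using PI unfolding poincare_inequality_def by blast
  obtain b where b: "\<And>x. \<bar>u x\<bar> \<le> b" using Cc_bounded[OF u(2)] by blast
  obtain k :: nat where k: "2 * a \<le> 2 ^ k" using real_arch_pow[of 2 "2 * a"] by (auto intro: less_imp_le)
  obtain r0 where r0: "0 < r0" "\<And>x y. dist x y < r0 \<Longrightarrow> \<bar>u x - u y\<bar> < e"
    using Cc_uniformly_continuous[OF u(2) e] by blast
  define A where "A = 2 * (2 * C ^ 3 + (2 * C ^ 3)\<^sup>2)"
  have A: "0 < A" using C_gt_1 by (simp add: A_def add_pos_pos)
  \<comment> \<open>The factor 2 stems from \<open>r = s / 2\<close>: the scale function is
    evaluated at the Poincare radius \<open>2 * r = s\<close>. Dividing by \<open>B + 1\<close>
    below is safe also when the energy of \<open>u\<close> is zero.\<close>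
  define B where "B = (2 * A) powr p * c * C ^ k * E u"
  have B: "0 \<le> B" using A c C_gt_1 E_nonneg[OF u(1)] by (simp add: B_def)
  obtain s where s: "0 < s" "s < r0" "\<Psi> s / s powr p < d / (B + 1)"
    using small[of "d / (B + 1)" r0] d B r0 by (auto simp: divide_pos_pos)
  define r where "r = s / 2"
  have r: "0 < r" "2 * r = s" "r < r0" using s by (auto simp: r_def)
  obtain g where g: "g \<in> borel_measurable borel" "\<And>x. 0 \<le> g x"
    "\<And>x x' x''. dist x x' < r \<Longrightarrow> dist x x'' < r \<Longrightarrow>
       \<bar>cone_average r u x' - cone_average r u x''\<bar> \<le> g x * dist x' x''"
    "(\<integral>\<^sup>+x. ennreal (g x powr p) \<partial>M) \<le> ennreal ((A / r) powr p * (c * \<Psi> s) * C ^ k * E u)"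
  proof (rule cone_average_gradient[of u b r "c * \<Psi> s" a k])
    show "(\<integral>\<^sup>+y\<in>ball x (2 * r). ennreal (\<bar>u y - set_average M (ball x (2 * r)) u\<bar> powr p) \<partial>M)
          \<le> ennreal (c * \<Psi> s) * emeasure (\<Gamma> u) (ball x (a * (2 * r)))" for x
      using PI[of "2*r" u x] r u by simp
  qed (use u b r a k c pos[of s] s Cc_measurable in \<open>auto simp: A_def\<close>)
  have "(A / r) powr p * (c * \<Psi> s) * C ^ k * E u = B * (\<Psi> s / s powr p)"
    using s A by (simp add: B_def r_def powr_divide powr_mult)
  also have "\<dots> \<le> B * (d / (B + 1))" using s B by (intro mult_left_mono) auto
  also have "\<dots> \<le> d" using B d by (simp add: field_simps)
  finally have "(\<integral>\<^sup>+x. ennreal (g x powr p) \<partial>M) \<le> ennreal d" using g(4) by (meson ennreal_leI order_trans)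
  moreover have "\<bar>cone_average r u x - u x\<bar> \<le> e" for x
    using r0(2)[of x] r by (intro cone_average_approx[OF Cc_measurable[OF u(2)] b r(1)]) (auto simp: abs_minus_commute less_imp_le)
  ultimately show ?thesis using g r(1) by (intro exI[of _ "cone_average r u"] exI[of _ g] exI[of _ r]) auto
qed

text \<open>Cones with rational radius and centre in \<open>D\<close> separate points, and local
  compactness gives the small ones compact support; density in \<open>Cc_space\<close> replaces them
  by elements of \<open>F\<close> at a uniform error of 1/4.\<close>

lemma separating_family:
  obtains u :: "nat \<Rightarrow> 'a \<Rightarrow> real" where "\<And>n. u n \<in> F" "\<And>n. u n \<in> Cc_space"
    "\<And>x y. x \<noteq> y \<Longrightarrow> \<exists>n. 1/4 \<le> \<bar>u n x - u n y\<bar>"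
proof -
  \<comment> \<open>The implication makes the choice total: a wide cone may lack compact support and
    is then assigned the zero function.\<close>
  have "\<exists>g. g \<in> F \<and> g \<in> Cc_space \<and> (cone q z \<in> Cc_space \<longrightarrow> (\<forall>x. \<bar>cone q z x - g x\<bar> < 1/4))" for q z
  proof (cases "cone q z \<in> Cc_space")
    case True
    then obtain g where "g \<in> Cc_space \<inter> F" "(SUP x. \<bar>cone q z x - g x\<bar>) < 1/4"
      using dense_in_Cc[of "cone q z" "1/4"] by auto
    then have "\<forall>x. \<bar>cone q z x - g x\<bar> < 1/4" using Cc_sup_dist[OF True, of g "1/4"] by blast
    then show ?thesis using \<open>g \<in> Cc_space \<inter> F\<close> by blast
  next
    case False
    then show ?thesis using zero_in_F by (intro exI[of _ "\<lambda>x. 0"]) (auto simp: Cc_space_def)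
  qed
  then obtain G where G: "\<And>q z. G q z \<in> F" "\<And>q z. G q z \<in> Cc_space"
    "\<And>q z x. cone q z \<in> Cc_space \<Longrightarrow> \<bar>cone q z x - G q z x\<bar> < 1/4" by metis
  define U where "U = (\<lambda>(q, z). G q z) ` (\<rat> \<times> D)"
  have cU: "countable U" unfolding U_def using countable_D countable_rat by (intro countable_image countable_SIGMA)
  have "\<exists>z. z \<in> D" using dense_D[of 1] by fastforce
  then have neU: "U \<noteq> {}" unfolding U_def by (auto intro!: exI[of _ "0::real"])
  have sep: "\<exists>w\<in>U. 1/4 \<le> \<bar>w x - w y\<bar>" if "x \<noteq> y" for x y
  proof -
    obtain V K where "openin euclidean V" "compactin euclidean K" "x \<in> V" "V \<subseteq> K"
      using locally_compact unfolding locally_compact_space_def by (metis UNIV_I topspace_euclidean)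
    then have V: "open V" "compact K" "x \<in> V" "V \<subseteq> K" by auto
    obtain s where s: "0 < s" "ball x s \<subseteq> V" using V openE by blast
    have "0 < min (s/2) (dist x y / 2)" using s that by auto
    then obtain q where q: "q \<in> \<rat>" "0 < q" "q < min (s/2) (dist x y / 2)"
      using Rats_dense_in_real by blast
    obtain z where z: "z \<in> D" "dist x z < q / 8" using dense_D[of "q/8" x] q by auto
    have "cball z q \<subseteq> ball x s"
    proof
      fix w assume "w \<in> cball z q"
      then show "w \<in> ball x s" using dist_triangle[of x w z] z q s by auto
    qed
    then have cb: "cball z q \<subseteq> K" using s V by blast
    have "{w. cone q z w \<noteq> 0} \<subseteq> cball z q" using cone_eq_0[OF q(2)] ball_subset_cball by blast
    then have "closure {w. cone q z w \<noteq> 0} \<subseteq> K"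
      using cb closure_minimal[of _ "cball z q"] by blast
    then have "compact (closure {w. cone q z w \<noteq> 0})"
      using V(2) by (metis closed_closure compact_Int_closed inf.absorb_iff2)
    moreover have "continuous_on UNIV (cone q z)"
      unfolding cone_def divide_inverse by (intro continuous_intros)
    ultimately have cc: "cone q z \<in> Cc_space" by (simp add: Cc_space_def)
    \<comment> \<open>The centre is within \<open>q / 8\<close> of \<open>x\<close>, and
      \<open>y\<close> is farther than \<open>q\<close> from it. Two errors of 1/4 leave a gap of
      3/8, more than the 1/4 claimed.\<close>
    have "7/8 \<le> cone q z x" using z q by (simp add: cone_def dist_commute field_simps max_def)
    moreover have "cone q z y = 0"
      using dist_triangle[of x y z] z q by (intro cone_eq_0) auto
    ultimately have "1/4 \<le> \<bar>G q z x - G q z y\<bar>" using G(3)[OF cc, of x] G(3)[OF cc, of y] by linarith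
    then show ?thesis using q z by (auto simp: U_def intro!: bexI[of _ "(q, z)"])
  qed
  show thesis
  proof
    have "from_nat_into U n \<in> U" for n using from_nat_into[OF neU] .
    then show "from_nat_into U n \<in> F" "from_nat_into U n \<in> Cc_space" for n
      using G by (auto simp: U_def image_def) (metis (no_types, lifting))+
    show "\<exists>n. 1/4 \<le> \<bar>from_nat_into U n x - from_nat_into U n y\<bar>" if "x \<noteq> y" for x y
      using sep[OF that] from_nat_into_surj[OF cU] by metis
  qed
qed

lemma vanishing_modulus_of_scale:
  assumes PI: "poincare_inequality p \<Psi> M F \<Gamma>"
    and pos: "\<And>r. 0 < r \<Longrightarrow> 0 < \<Psi> r"
    and small: "\<And>\<eta> \<delta>. 0 < \<eta> \<Longrightarrow> 0 < \<delta> \<Longrightarrow> \<exists>r. 0 < r \<and> r < \<delta> \<and> \<Psi> r / r powr p < \<eta>"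
  shows "vanishing_modulus p M"
  unfolding vanishing_modulus_def
proof (intro allI impI)
  fix G :: "'a curve set" assume G: "\<forall>c\<in>G. is_curve c"
  have p: "0 < p" using p_ge_1 by simp
  obtain u :: "nat \<Rightarrow> 'a \<Rightarrow> real" where u: "\<And>n. u n \<in> F" "\<And>n. u n \<in> Cc_space"
    "\<And>x y. x \<noteq> y \<Longrightarrow> \<exists>n. 1/4 \<le> \<bar>u n x - u n y\<bar>"
    using separating_family by blast
  have "modulus p M G \<le> ennreal e" if e: "0 < e" for e
  proof -
    \<comment> \<open>The division by \<open>8 powr p\<close> anticipates the factor 8 in the
      weight; the rest spreads the budget \<open>e\<close> geometrically over
      \<open>n\<close>.\<close>
    define d where "d n = e / 8 powr p * (1/2) ^ Suc n" for n
    have d: "0 < d n" for n using e by (simp add: d_def)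
    define P where "P n w g r \<longleftrightarrow> 0 < r \<and> g \<in> borel_measurable borel \<and> (\<forall>x. 0 \<le> g x) \<and> (\<forall>x. \<bar>w x - u n x\<bar> \<le> 1/16) \<and>
      (\<forall>x x' x''. dist x x' < r \<longrightarrow> dist x x'' < r \<longrightarrow> \<bar>w x' - w x''\<bar> \<le> g x * dist x' x'') \<and>
      (\<integral>\<^sup>+x. ennreal (g x powr p) \<partial>M) \<le> ennreal (d n)" for n w and g :: "'a \<Rightarrow> real" and r
    have "\<exists>w g r. P n w g r" for n
      unfolding P_def by (rule small_gradient_approximation[OF u(1,2) PI pos small _ d]) auto
    then obtain w g r where P: "\<And>n. P n (w n) (g n) (r n)" by metis
    have r: "\<And>n. 0 < r n" and g: "\<And>n. g n \<in> borel_measurable borel" "\<And>n x. 0 \<le> g n x"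
      and w: "\<And>n x. \<bar>w n x - u n x\<bar> \<le> 1/16"
      and wg: "\<And>n x x' x''. dist x x' < r n \<Longrightarrow> dist x x'' < r n \<Longrightarrow> \<bar>w n x' - w n x''\<bar> \<le> g n x * dist x' x''"
      and gi: "\<And>n. (\<integral>\<^sup>+x. ennreal (g n x powr p) \<partial>M) \<le> ennreal (d n)"
      using P unfolding P_def by blast+
    note g(1)[measurable]
    have [measurable_cong]: "sets M = sets borel" by (rule sets_M)
    \<comment> \<open>An l^p sum dominates every single term, so whichever \<open>n\<close>
      separates two points of a curve suffices, and its p-th power integrates term by term.\<close>
    define \<rho> where "\<rho> x = ennreal_powr (\<Sum>n. ennreal ((8 * g n x) powr p)) (1/p)" for x
    have \<rho>m: "\<rho> \<in> borel_measurable borel" unfolding \<rho>_def by measurable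
    have ge: "ennreal (8 * g n x) \<le> \<rho> x" for n x
    proof -
      have "ennreal ((8 * g n x) powr p) \<le> (\<Sum>n. ennreal ((8 * g n x) powr p))"
        by (rule ennreal_le_suminf)
      then have "ennreal_powr (ennreal ((8 * g n x) powr p)) (1/p) \<le> \<rho> x"
        unfolding \<rho>_def using p by (intro ennreal_powr_mono) auto
      then show ?thesis using g(2)[of n x] p by (simp add: powr_powr)
    qed
    have "admissible G \<rho>" unfolding admissible_def
    proof (intro conjI \<rho>m ballI impI)
      fix c assume c: "c \<in> G" "locally_rectifiable c"
      obtain I \<gamma> where I: "c = (I, \<gamma>)" by (cases c)
      have cv: "is_interval I" "continuous_on I \<gamma>" "\<not> \<gamma> constant_on I"
        using G c I by (auto simp: is_curve_def)
      obtain s t where st: "s \<in> I" "t \<in> I" "s \<le> t" "\<gamma> s \<noteq> \<gamma> t"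
      proof -
        have "I \<noteq> {}" using cv(3) by (auto simp: constant_on_def)
        then obtain a where a: "a \<in> I" by blast
        have "\<not> (\<forall>b\<in>I. \<gamma> b = \<gamma> a)" using cv(3) unfolding constant_on_def by blast
        then obtain b where b: "b \<in> I" "\<gamma> b \<noteq> \<gamma> a" by blast
        show thesis
        proof (cases "a \<le> b")
          case True
          then show ?thesis using a b by (intro that[of a b]) auto
        next
          case False
          then show ?thesis using a b by (intro that[of b a]) auto
        qed
      qed
      have sub: "{s..t} \<subseteq> I" using cv(1) st(1,2) interval_subset_is_interval[of I s t] by (simp add: cbox_interval)
      obtain n where n: "1/4 \<le> \<bar>u n (\<gamma> s) - u n (\<gamma> t)\<bar>" using u(3)[OF st(4)] by blast
      \<comment> \<open>Two approximation errors of 1/16 reduce the separation 1/4 to 1/8, whence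
        the factor 8.\<close>
      have "1 \<le> \<bar>8 * w n (\<gamma> s) - 8 * w n (\<gamma> t)\<bar>" using n w[of n "\<gamma> s"] w[of n "\<gamma> t"] by linarith
      then have "1 \<le> ennreal \<bar>8 * w n (\<gamma> s) - 8 * w n (\<gamma> t)\<bar>" by simp
      also have "\<dots> \<le> line_integral (\<lambda>x. ennreal (8 * g n x)) \<gamma> s t"
      proof (rule upper_gradient_inequality)
        show "curve_length \<gamma> s t < \<infinity>" using c I st sub by (auto simp: locally_rectifiable_def)
        show "\<bar>8 * w n x' - 8 * w n x''\<bar> \<le> 8 * g n x * dist x' x''"
          if "dist x x' < r n" "dist x x'' < r n" for x x' x''
        proof -
          have "\<bar>8 * w n x' - 8 * w n x''\<bar> = 8 * \<bar>w n x' - w n x''\<bar>"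
            by (simp only: right_diff_distrib[symmetric] abs_mult abs_numeral)
          also have "\<dots> \<le> 8 * (g n x * dist x' x'')" using wg[OF that] by (rule mult_left_mono) simp
          finally show ?thesis by (simp only: mult.assoc)
        qed
      qed (use st r g continuous_on_subset[OF cv(2) sub] in auto)
      also have "\<dots> \<le> line_integral \<rho> \<gamma> s t"
        unfolding line_integral_def by (intro nn_integral_mono mult_right_mono ge) auto
      also have "\<dots> \<le> curve_integral \<rho> c"
        unfolding curve_integral_def I using st sub by (auto intro!: SUP_upper2[of "(s, t)"])
      finally show "1 \<le> curve_integral \<rho> c" .
    qed
    then have "modulus p M G \<le> (\<integral>\<^sup>+x. ennreal_powr (\<rho> x) p \<partial>M)"
      unfolding modulus_def by (auto intro: INF_lower)
    also have "\<dots> = (\<integral>\<^sup>+x. (\<Sum>n. ennreal ((8 * g n x) powr p)) \<partial>M)"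
      unfolding \<rho>_def by (simp add: ennreal_powr_inverse[OF p])
    also have "\<dots> = (\<Sum>n. \<integral>\<^sup>+x. ennreal ((8 * g n x) powr p) \<partial>M)"
      by (intro nn_integral_suminf) measurable
    also have "\<dots> \<le> (\<Sum>n. ennreal (e * (1/2) ^ Suc n))"
    proof (intro suminf_le summableI)
      fix n
      have "(\<integral>\<^sup>+x. ennreal ((8 * g n x) powr p) \<partial>M) = ennreal (8 powr p) * (\<integral>\<^sup>+x. ennreal (g n x powr p) \<partial>M)"
        using g(2) by (subst nn_integral_cmult[symmetric]) (auto simp: powr_mult ennreal_mult)
      also have "\<dots> \<le> ennreal (8 powr p) * ennreal (d n)" by (intro mult_left_mono gi) simp
      also have "\<dots> = ennreal (e * (1/2) ^ Suc n)"
        using d[of n] by (subst ennreal_mult[symmetric]) (auto simp: d_def)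
      finally show "(\<integral>\<^sup>+x. ennreal ((8 * g n x) powr p) \<partial>M) \<le> ennreal (e * (1/2) ^ Suc n)" .
    qed
    also have "\<dots> = ennreal e"
    proof (rule suminf_ennreal_eq)
      show "(\<lambda>n. e * (1/2) ^ Suc n) sums e" using sums_mult[OF power_half_series, of e] by (simp only: mult_1_right)
    qed (use e in simp)
    finally show ?thesis .
  qed
  then have "modulus p M G \<le> 0" by (intro ennreal_le_epsilon[of 0]) simp
  then show "modulus p M G = 0" by simp
qed

end

section \<open>Limits of discrete chains\<close>

text \<open>The chain is parametrized by the accumulated cost, so that the constant extension beyond the
  end of the chain costs nothing.\<close>

lemma chain_parametrization:
  fixes z :: "nat \<Rightarrow> 'a::metric_space" and s :: "'a \<Rightarrow> real"
  assumes \<delta>: "0 < \<delta>" "\<And>x. \<delta> \<le> s x"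
    and mesh: "\<And>j. j < N \<Longrightarrow> dist (z j) (z (Suc j)) < e"
    and cost: "(\<Sum>j<N. s (z j) * dist (z j) (z (Suc j))) \<le> T" and e: "0 < e"
  obtains \<zeta> where "\<zeta> 0 = z 0" "\<zeta> T = z N"
    "\<And>u v. 0 \<le> u \<Longrightarrow> u \<le> v \<Longrightarrow> dist (\<zeta> u) (\<zeta> v) \<le> e + (v - u) / \<delta>"
    "\<And>u v s' L. 0 \<le> u \<Longrightarrow> u \<le> v \<Longrightarrow> (\<And>x. s' x \<le> s x) \<Longrightarrow> (\<And>x y. \<bar>s' x - s' y\<bar> \<le> L * dist x y) \<Longrightarrow>
       0 \<le> L \<Longrightarrow> max 0 (s' (\<zeta> u) - L * (e + (v - u) / \<delta>)) * (dist (\<zeta> u) (\<zeta> v) - e) \<le> v - u"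
proof -
  let ?d = "\<lambda>i. dist (z i) (z (Suc i))"
  define c where "c j = (\<Sum>i<j. s (z i) * ?d i)" for j
  define J where "J u = {j. j \<le> N \<and> c j \<le> u}" for u
  \<comment> \<open>The last vertex that can be paid for with the budget \<open>u\<close>.\<close>
  define k where "k u = Max (J u)" for u
  define \<zeta> where "\<zeta> u = z (k u)" for u
  have s0: "0 \<le> s x" for x using \<delta>(1) \<delta>(2)[of x] by linarith
  have finJ: "finite (J u)" for u by (simp add: J_def)
  have neJ: "J u \<noteq> {}" if "0 \<le> u" for u using that by (auto simp: J_def c_def intro: exI[of _ 0])
  have kJ: "k u \<le> N" "c (k u) \<le> u" if "0 \<le> u" for u
    using Max_in[OF finJ neJ[OF that]] by (auto simp: k_def J_def)
  have kmax: "j \<le> k u" if "j \<le> N" "c j \<le> u" for j u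
    using that Max_ge[OF finJ, of j u] by (simp add: k_def J_def)
  have dist_sum: "dist (z i) (z j) \<le> sum ?d {i..<j}" if "i \<le> j" for i j
    using that
  proof (induction j)
    case (Suc j)
    show ?case
    proof (cases "i \<le> j")
      case True
      then show ?thesis using Suc.IH[OF True] dist_triangle[of "z i" "z (Suc j)" "z j"] by simp
    next
      case False
      then have "i = Suc j" using Suc.prems by simp
      then show ?thesis by simp
    qed
  qed simp
  have c_diff: "c j - c i = (\<Sum>l=i..<j. s (z l) * ?d l)" if "i \<le> j" for i j
    using sum_diff[of "{..<j}" "{..<i}" "\<lambda>l. s (z l) * ?d l"] that
    by (simp add: c_def lessThan_minus_lessThan)
  have main: "k u \<le> k v \<and> (k u < k v \<longrightarrow> (\<exists>S. 0 \<le> S \<and> dist (\<zeta> u) (\<zeta> v) \<le> e + S \<and> S \<le> (v - u) / \<delta> \<and>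
      (\<forall>A. 0 \<le> A \<longrightarrow> (\<forall>x. dist (\<zeta> u) x \<le> e + (v - u) / \<delta> \<longrightarrow> A \<le> s x) \<longrightarrow> A * S \<le> v - u)))"
    if uv: "0 \<le> u" "u \<le> v" for u v
  proof (intro conjI impI)
    show "k u \<le> k v" using kJ[OF uv(1)] uv by (intro kmax) auto
    assume lt: "k u < k v"
    define S where "S = sum ?d {Suc (k u)..<k v}"
    have kv: "k v \<le> N" "c (k v) \<le> v" using kJ[of v] uv by auto
    \<comment> \<open>The edge leaving \<open>z (k u)\<close> may be partly paid before
      \<open>u\<close>, so it is bounded by the mesh \<open>e\<close> alone. All later edges, of
      total length \<open>S\<close>, are paid out of \<open>v - u\<close>.\<close>
    have "\<not> c (Suc (k u)) \<le> u" using kmax[of "Suc (k u)" u] lt kv by auto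
    then have cS: "c (k v) - c (Suc (k u)) \<le> v - u" using kv by linarith
    have cost_eq: "c (k v) - c (Suc (k u)) = (\<Sum>l=Suc (k u)..<k v. s (z l) * ?d l)"
      using lt by (intro c_diff) simp
    have S0: "0 \<le> S" unfolding S_def by (intro sum_nonneg) simp
    have "\<delta> * S \<le> c (k v) - c (Suc (k u))"
      unfolding cost_eq S_def sum_distrib_left using \<delta>(2) by (intro sum_mono mult_right_mono) auto
    then have "\<delta> * S \<le> v - u" using cS by linarith
    then have S1: "S \<le> (v - u) / \<delta>" using \<delta>(1) by (simp add: pos_le_divide_eq mult.commute)
    have part: "dist (\<zeta> u) (z l) \<le> e + S" if l: "k u < l" "l \<le> k v" for l
    proof -
      have "dist (z (k u)) (z l) \<le> dist (z (k u)) (z (Suc (k u))) + dist (z (Suc (k u))) (z l)"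
        by (rule dist_triangle)
      also have "dist (z (k u)) (z (Suc (k u))) \<le> e" using mesh[of "k u"] lt kv by simp
      also have "dist (z (Suc (k u))) (z l) \<le> sum ?d {Suc (k u)..<l}" using l by (intro dist_sum) simp
      also have "\<dots> \<le> S" unfolding S_def using l by (intro sum_mono2) auto
      finally show ?thesis by (simp add: \<zeta>_def)
    qed
    have "A * S \<le> v - u" if A: "0 \<le> A" "\<And>x. dist (\<zeta> u) x \<le> e + (v - u) / \<delta> \<Longrightarrow> A \<le> s x" for A
    proof -
      have "A * S \<le> (\<Sum>l=Suc (k u)..<k v. s (z l) * ?d l)"
        unfolding S_def sum_distrib_left
      proof (intro sum_mono mult_right_mono A(2))
        fix l assume "l \<in> {Suc (k u)..<k v}"
        then show "dist (\<zeta> u) (z l) \<le> e + (v - u) / \<delta>" using part[of l] S1 by auto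
      qed simp
      then show ?thesis using cS cost_eq by linarith
    qed
    then show "\<exists>S. 0 \<le> S \<and> dist (\<zeta> u) (\<zeta> v) \<le> e + S \<and> S \<le> (v - u) / \<delta> \<and>
      (\<forall>A. 0 \<le> A \<longrightarrow> (\<forall>x. dist (\<zeta> u) x \<le> e + (v - u) / \<delta> \<longrightarrow> A \<le> s x) \<longrightarrow> A * S \<le> v - u)"
      using S0 S1 part[of "k v"] lt by (intro exI[of _ S]) (auto simp: \<zeta>_def)
  qed
  show thesis
  proof
    show "\<zeta> T = z N"
    proof -
      have cN: "c N \<le> T" using cost by (simp add: c_def)
      have "0 \<le> c N" unfolding c_def by (intro sum_nonneg mult_nonneg_nonneg s0) simp
      then have "k T \<le> N" using kJ[of T] cN by simp
      moreover have "N \<le> k T" using cN by (intro kmax) auto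
      ultimately show ?thesis by (simp add: \<zeta>_def)
    qed
    \<comment> \<open>Edges of length zero cost nothing, so \<open>k 0\<close> may be positive; the
      floor \<open>\<delta>\<close> shows that the chain has not moved up to there.\<close>
    show "\<zeta> 0 = z 0"
    proof -
      have "\<delta> * sum ?d {0..<k 0} \<le> c (k 0)"
        unfolding c_def sum_distrib_left lessThan_atLeast0 using \<delta>(2) by (intro sum_mono mult_right_mono) auto
      also have "\<dots> \<le> 0" using kJ[of 0] by simp
      finally have "sum ?d {0..<k 0} \<le> 0" using \<delta>(1) by (simp add: mult_le_0_iff)
      then have "dist (z 0) (z (k 0)) \<le> 0" using dist_sum[of 0 "k 0"] by linarith
      then show ?thesis by (simp add: \<zeta>_def)
    qed
    show "dist (\<zeta> u) (\<zeta> v) \<le> e + (v - u) / \<delta>" if uv: "0 \<le> u" "u \<le> v" for u v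
    proof (cases "k u < k v")
      case True
      then show ?thesis using main[OF uv] by force
    next
      case False
      then have "\<zeta> u = \<zeta> v" using main[OF uv] by (simp add: \<zeta>_def)
      then show ?thesis using uv e \<delta>(1) by simp
    qed
    show "max 0 (s' (\<zeta> u) - L * (e + (v - u) / \<delta>)) * (dist (\<zeta> u) (\<zeta> v) - e) \<le> v - u"
      if uv: "0 \<le> u" "u \<le> v" and s': "\<And>x. s' x \<le> s x" "\<And>x y. \<bar>s' x - s' y\<bar> \<le> L * dist x y" "0 \<le> L" for u v s' L
    proof (cases "k u < k v")
      case True
      \<comment> \<open>A lower bound for \<open>s\<close> on the ball that the chain can reach with
        the budget \<open>v - u\<close>, taken from the Lipschitz minorant \<open>s'\<close>. In the
        application \<open>s'\<close> is an earlier member of an increasing sequence of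
        weights.\<close>
      define A where "A = max 0 (s' (\<zeta> u) - L * (e + (v - u) / \<delta>))"
      obtain S where S: "0 \<le> S" "dist (\<zeta> u) (\<zeta> v) \<le> e + S"
        "\<And>A. 0 \<le> A \<Longrightarrow> (\<And>x. dist (\<zeta> u) x \<le> e + (v - u) / \<delta> \<Longrightarrow> A \<le> s x) \<Longrightarrow> A * S \<le> v - u"
        using main[OF uv] True by blast
      have "A \<le> s x" if x: "dist (\<zeta> u) x \<le> e + (v - u) / \<delta>" for x
      proof -
        have "L * dist (\<zeta> u) x \<le> L * (e + (v - u) / \<delta>)" using x s'(3) by (rule mult_left_mono)
        then have "s' (\<zeta> u) - L * (e + (v - u) / \<delta>) \<le> s x" using s'(1)[of x] s'(2)[of "\<zeta> u" x] by linarith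
        then show ?thesis using s0[of x] by (simp add: A_def)
      qed
      then have "A * S \<le> v - u" by (intro S(3)) (auto simp: A_def)
      moreover have "A * (dist (\<zeta> u) (\<zeta> v) - e) \<le> A * S"
        using S(2) by (intro mult_left_mono) (auto simp: A_def)
      ultimately show ?thesis by (simp add: A_def)
    next
      case False
      then have "\<zeta> u = \<zeta> v" using main[OF uv] by (simp add: \<zeta>_def)
      then show ?thesis using uv e by (simp add: mult_nonneg_nonpos order_trans[of _ 0])
    qed
  qed
qed

text \<open>The parametrized chains jump and have an uncountable domain, so no convergent
  subsequence is extracted. Tychonoff gives a cluster point in the product topology, approximated
  infinitely often on each finite set, with indices depending on the set; inequalities between
  finitely many values still pass to it.\<close>

lemma pointwise_cluster_point:
  fixes \<zeta> :: "nat \<Rightarrow> 'b \<Rightarrow> 'a::metric_space"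
  assumes "compact (UNIV :: 'a set)"
  obtains \<gamma> where "\<And>S m e. finite S \<Longrightarrow> 0 < e \<Longrightarrow> \<exists>n\<ge>m. \<forall>s\<in>S. dist (\<zeta> n s) (\<gamma> s) < e"
proof -
  have "compact_space (product_topology (\<lambda>_::'b. euclidean :: 'a topology) UNIV)"
    using assms by (subst compact_space_product_topology) (simp add: compact_space_def)
  then have "compact (UNIV :: ('b \<Rightarrow> 'a) set)"
    by (simp add: compact_space_def euclidean_product_topology)
  \<comment> \<open>The cluster point is that of the tail filter of the sequence.\<close>
  note this[unfolded compact_filter, rule_format, of "filtermap \<zeta> sequentially"]
  then obtain \<gamma> where \<gamma>: "inf (nhds \<gamma>) (filtermap \<zeta> sequentially) \<noteq> bot"
    by (auto simp: filtermap_bot_iff)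
  show thesis
  proof
    fix S :: "'b set" and m :: nat and e :: real assume S: "finite S" "0 < e"
    let ?W = "\<Inter>s\<in>S. {f. dist (f s) (\<gamma> s) < e}"
    have "open {f::'b \<Rightarrow> 'a. dist (f s) (\<gamma> s) < e}" for s
      by (intro open_Collect_less continuous_on_dist continuous_on_product_coordinates continuous_intros)
    then have W: "open ?W" using S by (intro open_INT) auto
    show "\<exists>n\<ge>m. \<forall>s\<in>S. dist (\<zeta> n s) (\<gamma> s) < e"
    proof (rule ccontr)
      assume "\<not> ?thesis"
      then have "eventually (\<lambda>n. \<zeta> n \<notin> ?W) sequentially"
        unfolding eventually_sequentially by (intro exI[of _ m]) force
      then have "eventually (\<lambda>f. f \<notin> ?W) (filtermap \<zeta> sequentially)" by (simp add: eventually_filtermap)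
      moreover have "eventually (\<lambda>f. f \<in> ?W) (nhds \<gamma>)" using W S by (intro eventually_nhds_in_open) auto
      ultimately have "eventually (\<lambda>f. False) (inf (nhds \<gamma>) (filtermap \<zeta> sequentially))"
        unfolding eventually_inf by blast
      then show False using \<gamma> by (simp add: trivial_limit_def)
    qed
  qed
qed

text \<open>\<open>slow\<close> is a finite-difference form of the statement that \<open>s\<close>
  times the speed of \<open>\<gamma>\<close> is at most 1. On a block of parameter length
  \<open>\<theta>\<close> the weight is nearly constant, so weight times length is at most
  \<open>\<theta>\<close> up to an error quadratic in \<open>\<theta>\<close>; the errors of the n
  blocks add up to order 1/n.\<close>

lemma line_integral_le_of_slow:
  fixes \<gamma> :: "real \<Rightarrow> 'a::metric_space" and s :: "'a \<Rightarrow> real"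
  assumes ab: "a \<le> b" and \<delta>: "0 < \<delta>" and L: "0 \<le> L"
    and lip: "\<And>u v. a \<le> u \<Longrightarrow> u \<le> v \<Longrightarrow> v \<le> b \<Longrightarrow> dist (\<gamma> u) (\<gamma> v) \<le> (v - u) / \<delta>"
    and slow: "\<And>u v. a \<le> u \<Longrightarrow> u \<le> v \<Longrightarrow> v \<le> b \<Longrightarrow>
       max 0 (s (\<gamma> u) - L * ((v - u) / \<delta>)) * dist (\<gamma> u) (\<gamma> v) \<le> v - u"
    and s: "\<And>x. 0 \<le> s x" "\<And>x y. \<bar>s x - s y\<bar> \<le> L * dist x y" and sm: "s \<in> borel_measurable borel"
  shows "continuous_on {a..b} \<gamma>" "curve_length \<gamma> a b < \<infinity>"
    "line_integral (\<lambda>x. ennreal (s x)) \<gamma> a b \<le> ennreal (b - a)"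
proof -
  have lip': "dist (\<gamma> u) (\<gamma> v) \<le> 1 / \<delta> * (v - u)" if "a \<le> u" "u \<le> v" "v \<le> b" for u v
    using lip[OF that] by simp
  have "(1/\<delta>)-lipschitz_on {a..b} \<gamma>"
  proof (rule lipschitz_onI)
    fix x y assume "x \<in> {a..b}" "y \<in> {a..b}"
    then show "dist (\<gamma> x) (\<gamma> y) \<le> 1 / \<delta> * dist x y"
      using lip'[of x y] lip'[of y x] by (cases "x \<le> y") (auto simp: dist_commute dist_real_def)
  qed (use \<delta> in simp)
  then show cont: "continuous_on {a..b} \<gamma>" by (rule lipschitz_on_continuous_on)
  have "curve_length \<gamma> a b \<le> ennreal (1 / \<delta> * (b - a))"
    using ab \<delta> lip' by (intro curve_length_le_of_lipschitz) auto
  then show fin: "curve_length \<gamma> a b < \<infinity>" by (simp add: order_le_less_trans)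
  define V where "V t = enn2real (curve_length \<gamma> a t)" for t
  define \<beta> where "\<beta> = arc_length_param \<gamma> a b"
  define f where "f x = ennreal (s (\<beta> x)) * indicator {0..V b} x" for x
  have fm: "f \<in> borel_measurable lborel"
    using arc_length_param_measurable[OF ab cont fin, of "\<lambda>x. ennreal (s x)"] sm
    by (simp add: f_def[abs_def] V_def \<beta>_def)
  have Vmono: "V x \<le> V y" if "a \<le> x" "x \<le> y" "y \<le> b" for x y
    using curve_length_diff(2)[OF fin that] by (simp add: V_def)
  have Va: "V a = 0" by (simp add: V_def)
  have bound: "line_integral (\<lambda>x. ennreal (s x)) \<gamma> a b \<le> ennreal ((b - a) + 3 * L * ((b - a) / \<delta>)\<^sup>2 / real (Suc m))" for m
  proof -
    define n where "n = Suc m"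
    define \<theta> where "\<theta> = (b - a) / real n"
    define t where "t i = a + real i * \<theta>" for i
    have n0: "0 < real n" by (simp add: n_def)
    have \<theta>: "0 \<le> \<theta>" "real n * \<theta> = b - a" using ab n0 by (auto simp: \<theta>_def)
    have tS: "t (Suc i) = t i + \<theta>" for i by (simp add: t_def distrib_right)
    have t_le: "t i \<le> t j" if "i \<le> j" for i j unfolding t_def using that \<theta> by (intro add_left_mono mult_right_mono) auto
    have t0: "t 0 = a" "t n = b" using \<theta> by (auto simp: t_def)
    have block: "(\<integral>\<^sup>+x\<in>{V (t i)..V (t (Suc i))}. f x \<partial>lborel) \<le> ennreal (\<theta> + 3 * L * (\<theta> / \<delta>)\<^sup>2)"
      if i: "i < n" for i
    proof -
      have ti: "a \<le> t i" "t i \<le> t (Suc i)" "t (Suc i) \<le> b"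
        using t_le[of 0 i] t_le[of i "Suc i"] t_le[of "Suc i" n] i t0 by auto
      define len where "len = V (t (Suc i)) - V (t i)"
      \<comment> \<open>One \<open>L * (\<theta> / \<delta>)\<close> absorbs the oscillation of
        \<open>s\<close> along the block, the other the correction term in \<open>slow\<close>. For
        non-positive \<open>A\<close> the bound on \<open>A * len\<close> is trivial.\<close>
      define A where "A = s (\<gamma> (t i)) - 2 * L * (\<theta> / \<delta>)"
      have len0: "0 \<le> len" using Vmono ti by (simp add: len_def)
      have len_eq: "curve_length \<gamma> (t i) (t (Suc i)) = ennreal len"
        using curve_length_diff(1)[OF fin ti] by (simp add: len_def V_def)
      have "curve_length \<gamma> (t i) (t (Suc i)) \<le> ennreal (1 / \<delta> * (t (Suc i) - t i))"
        using ti \<delta> lip' by (intro curve_length_le_of_lipschitz) auto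
      then have "ennreal len \<le> ennreal (\<theta> / \<delta>)" unfolding len_eq by (simp add: tS)
      then have len1: "len \<le> \<theta> / \<delta>" using \<delta> \<theta> by (subst (asm) ennreal_le_iff) auto
      have Alen: "A * len \<le> \<theta>"
      proof (cases "0 < A")
        case True
        have "curve_length \<gamma> (t i) (t (Suc i)) \<le> ennreal (1 / A * (t (Suc i) - t i))"
        proof (rule curve_length_le_of_lipschitz)
          fix u v assume uv: "t i \<le> u" "u \<le> v" "v \<le> t (Suc i)"
          have "L * dist (\<gamma> (t i)) (\<gamma> u) \<le> L * (\<theta> / \<delta>)"
          proof (rule mult_left_mono[OF _ L])
            have "dist (\<gamma> (t i)) (\<gamma> u) \<le> (u - t i) / \<delta>" using lip[of "t i" u] ti uv by simp
            also have "\<dots> \<le> \<theta> / \<delta>" using uv tS[of i] \<delta> by (intro divide_right_mono) auto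
            finally show "dist (\<gamma> (t i)) (\<gamma> u) \<le> \<theta> / \<delta>" .
          qed
          moreover have "L * ((v - u) / \<delta>) \<le> L * (\<theta> / \<delta>)"
            using uv tS[of i] \<delta> L by (intro mult_left_mono divide_right_mono) auto
          ultimately have "A \<le> s (\<gamma> u) - L * ((v - u) / \<delta>)"
            using s(2)[of "\<gamma> (t i)" "\<gamma> u"] by (simp add: A_def)
          then have "A * dist (\<gamma> u) (\<gamma> v) \<le> max 0 (s (\<gamma> u) - L * ((v - u) / \<delta>)) * dist (\<gamma> u) (\<gamma> v)"
            by (intro mult_right_mono) auto
          also have "\<dots> \<le> v - u" using slow[of u v] ti uv by simp
          finally show "dist (\<gamma> u) (\<gamma> v) \<le> 1 / A * (v - u)" using True by (simp add: field_simps)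
        qed (use True ti in auto)
        then have "ennreal len \<le> ennreal (\<theta> / A)" unfolding len_eq by (simp add: tS)
        then have "len \<le> \<theta> / A" using True \<theta> by (subst (asm) ennreal_le_iff) auto
        then show ?thesis using True by (simp add: field_simps)
      next
        case False
        then show ?thesis using len0 \<theta> by (meson mult_nonneg_nonpos2 mult.commute not_less order_trans mult_nonpos_nonneg)
      qed
      have V01: "0 \<le> V (t i)" "V (t (Suc i)) \<le> V b"
        using Vmono[of a "t i"] Vmono[of "t (Suc i)" b] ti Va by auto
      have pt: "f x \<le> ennreal (s (\<gamma> (t i)) + L * (\<theta> / \<delta>))" if x: "x \<in> {V (t i)..V (t (Suc i))}" for x
      proof -
        have "\<beta> (V (t i)) = \<gamma> (t i)"
          unfolding \<beta>_def V_def using ti by (intro arc_length_param_curve_length ab cont fin) auto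
        moreover have "dist (\<beta> (V (t i))) (\<beta> x) \<le> \<bar>V (t i) - x\<bar>"
        proof -
          have "0 \<le> x" "x \<le> V b" "V (t i) \<le> V b" using V01 x by auto
          then show ?thesis using V01(1) unfolding \<beta>_def V_def
            by (intro arc_length_param_lipschitz ab cont fin)
        qed
        ultimately have "dist (\<gamma> (t i)) (\<beta> x) \<le> \<theta> / \<delta>" using x len1 by (auto simp: len_def)
        then have "L * dist (\<gamma> (t i)) (\<beta> x) \<le> L * (\<theta> / \<delta>)" using L by (rule mult_left_mono)
        then have "s (\<beta> x) \<le> s (\<gamma> (t i)) + L * (\<theta> / \<delta>)" using s(2)[of "\<gamma> (t i)" "\<beta> x"] by linarith
        then show ?thesis by (auto simp: f_def intro: ennreal_leI split: split_indicator)
      qed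
      have "(\<integral>\<^sup>+x\<in>{V (t i)..V (t (Suc i))}. f x \<partial>lborel) \<le>
         (\<integral>\<^sup>+x\<in>{V (t i)..V (t (Suc i))}. ennreal (s (\<gamma> (t i)) + L * (\<theta> / \<delta>)) \<partial>lborel)"
        using pt by (intro nn_integral_mono) (auto split: split_indicator)
      also have "\<dots> = ennreal (s (\<gamma> (t i)) + L * (\<theta> / \<delta>)) * ennreal len"
        using Vmono[OF ti] by (simp add: nn_integral_cmult_indicator len_def)
      also have "\<dots> = ennreal ((s (\<gamma> (t i)) + L * (\<theta> / \<delta>)) * len)"
        using s(1) L \<theta> \<delta> len0 by (intro ennreal_mult[symmetric]) auto
      \<comment> \<open>The 3 collects the two error terms in \<open>A\<close> and the one by which
        \<open>s\<close> may exceed its value at the start of the block.\<close>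
      also have "\<dots> \<le> ennreal (\<theta> + 3 * L * (\<theta> / \<delta>)\<^sup>2)"
      proof (rule ennreal_leI)
        have "L * (\<theta> / \<delta>) * len \<le> L * (\<theta> / \<delta>) * (\<theta> / \<delta>)"
          using len1 L \<theta> \<delta> by (intro mult_left_mono) auto
        moreover have "(s (\<gamma> (t i)) + L * (\<theta> / \<delta>)) * len = A * len + 3 * (L * (\<theta> / \<delta>) * len)"
          by (simp add: A_def algebra_simps)
        ultimately show "(s (\<gamma> (t i)) + L * (\<theta> / \<delta>)) * len \<le> \<theta> + 3 * L * (\<theta> / \<delta>)\<^sup>2"
          using Alen by (simp add: power2_eq_square)
      qed
      finally show ?thesis .
    qed
    have mono: "mono_on {..n} (\<lambda>i. V (t i))"
    proof (rule mono_onI)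
      fix i j assume "i \<in> {..n}" "j \<in> {..n}" "i \<le> j"
      then show "V (t i) \<le> V (t j)" using t_le[of 0 i] t_le[of i j] t_le[of j n] t0 by (intro Vmono) auto
    qed
    have "line_integral (\<lambda>x. ennreal (s x)) \<gamma> a b = (\<integral>\<^sup>+x\<in>{V (t 0)..V (t n)}. f x \<partial>lborel)"
      unfolding line_integral_def t0 Va V_def[symmetric] \<beta>_def[symmetric]
      by (intro nn_integral_cong) (auto simp: f_def split: split_indicator)
    also have "\<dots> = (\<Sum>i<n. \<integral>\<^sup>+x\<in>{V (t i)..V (t (Suc i))}. f x \<partial>lborel)"
      by (rule nn_integral_split_uniform[OF fm mono, symmetric])
    also have "\<dots> \<le> (\<Sum>i<n. ennreal (\<theta> + 3 * L * (\<theta> / \<delta>)\<^sup>2))" using block by (intro sum_mono) auto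
    also have "\<dots> = ennreal (real n * (\<theta> + 3 * L * (\<theta> / \<delta>)\<^sup>2))"
      using \<theta> L by (simp add: ennreal_mult ennreal_of_nat_eq_real_of_nat)
    also have "real n * (\<theta> + 3 * L * (\<theta> / \<delta>)\<^sup>2) = (b - a) + 3 * L * ((b - a) / \<delta>)\<^sup>2 / real n"
    proof -
      have "real n * (w / real n + 3 * L * (w / real n / \<delta>)\<^sup>2) = w + 3 * L * (w / \<delta>)\<^sup>2 / real n" for w
        using n0 \<delta> by (simp add: field_simps power2_eq_square)
      then show ?thesis unfolding \<theta>_def .
    qed
    finally show ?thesis by (simp add: n_def)
  qed
  have "(\<lambda>m. (b - a) + 3 * L * ((b - a) / \<delta>)\<^sup>2 / real (Suc m)) \<longlonglongrightarrow> (b - a) + 0"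
    by (intro tendsto_add tendsto_const LIMSEQ_Suc[OF lim_const_over_n])
  then have "(\<lambda>m. ennreal ((b - a) + 3 * L * ((b - a) / \<delta>)\<^sup>2 / real (Suc m))) \<longlonglongrightarrow> ennreal (b - a)"
    by (intro tendsto_ennrealI) simp
  then show "line_integral (\<lambda>x. ennreal (s x)) \<gamma> a b \<le> ennreal (b - a)"
    using bound by (intro LIMSEQ_le_const) auto
qed

text \<open>The weight changes along with the chain, so no single inequality could be passed to the
  limit directly. Monotonicity lets the n-th chain satisfy the slowness inequality for every
  \<open>\<sigma> k\<close> with \<open>k \<le> n\<close>; the limit is taken for fixed
  \<open>k\<close>, and monotone convergence in \<open>k\<close> then reaches
  \<open>\<rho>\<close>.\<close>

lemma chain_limit_curve:
  fixes \<sigma> :: "nat \<Rightarrow> 'a::metric_space \<Rightarrow> real"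
  assumes comp: "compact (UNIV :: 'a set)" and \<delta>: "0 < \<delta>" "\<And>k x. \<delta> \<le> \<sigma> k x" and T: "0 \<le> T"
    and lip: "\<And>k x y. \<bar>\<sigma> k x - \<sigma> k y\<bar> \<le> L k * dist x y" and L: "\<And>k. 0 \<le> L k" and inc: "\<And>x. incseq (\<lambda>k. \<sigma> k x)"
    and e: "\<And>n. 0 < e n" "e \<longlonglongrightarrow> 0"
    and AB: "closed A" "closed B" "A \<inter> B = {}"
    and chains: "\<And>n. \<exists>N z. z 0 \<in> A \<and> z N \<in> B \<and> (\<forall>j<N. dist (z j) (z (Suc j)) < e n) \<and>
       (\<Sum>j<N. \<sigma> n (z j) * dist (z j) (z (Suc j))) \<le> T"
    and \<rho>: "\<And>x. \<rho> x \<le> (SUP k. ennreal (\<sigma> k x))"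
  shows "\<exists>c. is_curve c \<and> locally_rectifiable c \<and> curve_integral \<rho> c \<le> ennreal T"
proof -
  have "\<exists>\<zeta>. \<zeta> 0 \<in> A \<and> \<zeta> T \<in> B \<and> (\<forall>u v. 0 \<le> u \<longrightarrow> u \<le> v \<longrightarrow> dist (\<zeta> u) (\<zeta> v) \<le> e n + (v - u) / \<delta>) \<and>
    (\<forall>u v k. 0 \<le> u \<longrightarrow> u \<le> v \<longrightarrow> k \<le> n \<longrightarrow>
       max 0 (\<sigma> k (\<zeta> u) - L k * (e n + (v - u) / \<delta>)) * (dist (\<zeta> u) (\<zeta> v) - e n) \<le> v - u)" for n
  proof -
    obtain N z where z: "z 0 \<in> A" "z N \<in> B" "\<And>j. j < N \<Longrightarrow> dist (z j) (z (Suc j)) < e n"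
      "(\<Sum>j<N. \<sigma> n (z j) * dist (z j) (z (Suc j))) \<le> T" using chains[of n] by blast
    obtain \<zeta> where \<zeta>: "\<zeta> 0 = z 0" "\<zeta> T = z N"
      "\<And>u v. 0 \<le> u \<Longrightarrow> u \<le> v \<Longrightarrow> dist (\<zeta> u) (\<zeta> v) \<le> e n + (v - u) / \<delta>"
      "\<And>u v s' L. 0 \<le> u \<Longrightarrow> u \<le> v \<Longrightarrow> (\<And>x. s' x \<le> \<sigma> n x) \<Longrightarrow> (\<And>x y. \<bar>s' x - s' y\<bar> \<le> L * dist x y) \<Longrightarrow>
       0 \<le> L \<Longrightarrow> max 0 (s' (\<zeta> u) - L * (e n + (v - u) / \<delta>)) * (dist (\<zeta> u) (\<zeta> v) - e n) \<le> v - u"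
      using chain_parametrization[OF \<delta> z(3,4) e(1)] by blast
    show ?thesis
    proof (intro exI[of _ \<zeta>] conjI allI impI)
      fix u v :: real and k assume "0 \<le> u" "u \<le> v" "k \<le> n"
      then show "max 0 (\<sigma> k (\<zeta> u) - L k * (e n + (v - u) / \<delta>)) * (dist (\<zeta> u) (\<zeta> v) - e n) \<le> v - u"
        using lip inc L by (intro \<zeta>(4)) (auto simp: incseq_def)
    qed (use \<zeta> z in auto)
  qed
  then obtain \<zeta> where \<zeta>: "\<And>n. \<zeta> n 0 \<in> A" "\<And>n. \<zeta> n T \<in> B"
    "\<And>n u v. 0 \<le> u \<Longrightarrow> u \<le> v \<Longrightarrow> dist (\<zeta> n u) (\<zeta> n v) \<le> e n + (v - u) / \<delta>"
    "\<And>n u v k. 0 \<le> u \<Longrightarrow> u \<le> v \<Longrightarrow> k \<le> n \<Longrightarrow>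
       max 0 (\<sigma> k (\<zeta> n u) - L k * (e n + (v - u) / \<delta>)) * (dist (\<zeta> n u) (\<zeta> n v) - e n) \<le> v - u"
    by metis
  obtain \<gamma> where \<gamma>: "\<And>S m \<eta>. finite S \<Longrightarrow> 0 < \<eta> \<Longrightarrow> \<exists>n\<ge>m. \<forall>s\<in>S. dist (\<zeta> n s) (\<gamma> s) < \<eta>"
    using pointwise_cluster_point[OF comp, of \<zeta>] by blast
  have cl: "\<exists>n\<ge>k. e n < \<eta> \<and> dist (\<zeta> n u) (\<gamma> u) < \<eta> \<and> dist (\<zeta> n v) (\<gamma> v) < \<eta>" if \<eta>: "0 < \<eta>" for \<eta> u v k
  proof -
    obtain m where m: "\<And>n. n \<ge> m \<Longrightarrow> e n < \<eta>"
      using order_tendstoD(2)[OF e(2) \<eta>] unfolding eventually_sequentially by blast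
    obtain n where "n \<ge> max k m" "\<forall>s\<in>{u,v}. dist (\<zeta> n s) (\<gamma> s) < \<eta>" using \<gamma>[of "{u,v}" \<eta> "max k m"] \<eta> by auto
    then show ?thesis using m[of n] by (intro exI[of _ n]) auto
  qed
  have "\<gamma> 0 \<in> A"
  proof -
    have "\<exists>y\<in>A. dist y (\<gamma> 0) < \<eta>" if "0 < \<eta>" for \<eta> using cl[OF that, of 0 0 0] \<zeta>(1) by blast
    then show ?thesis using AB(1) by (metis closed_approachable)
  qed
  have "\<gamma> T \<in> B"
  proof -
    have "\<exists>y\<in>B. dist y (\<gamma> T) < \<eta>" if "0 < \<eta>" for \<eta> using cl[OF that, of 0 T T] \<zeta>(2) by blast
    then show ?thesis using AB(2) by (metis closed_approachable)
  qed
  have glip: "dist (\<gamma> u) (\<gamma> v) \<le> (v - u) / \<delta>" if uv: "0 \<le> u" "u \<le> v" for u v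
  proof (rule field_le_epsilon)
    fix \<eta> :: real assume \<eta>: "0 < \<eta>"
    obtain n where n: "e n < \<eta>/3" "dist (\<zeta> n u) (\<gamma> u) < \<eta>/3" "dist (\<zeta> n v) (\<gamma> v) < \<eta>/3"
      using cl[of "\<eta>/3" 0 u v] \<eta> by auto
    have "dist (\<gamma> u) (\<gamma> v) \<le> dist (\<zeta> n u) (\<gamma> u) + dist (\<zeta> n u) (\<zeta> n v) + dist (\<zeta> n v) (\<gamma> v)"
      using dist_triangle[of "\<gamma> u" "\<gamma> v" "\<zeta> n u"] dist_triangle[of "\<zeta> n u" "\<gamma> v" "\<zeta> n v"] by (simp add: dist_commute)
    then show "dist (\<gamma> u) (\<gamma> v) \<le> (v - u) / \<delta> + \<eta>" using n \<zeta>(3)[OF uv, of n] by linarith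
  qed
  have slow: "max 0 (\<sigma> k (\<gamma> u) - L k * ((v - u) / \<delta>)) * dist (\<gamma> u) (\<gamma> v) \<le> v - u"
    if uv: "0 \<le> u" "u \<le> v" for u v k
  proof -
    \<comment> \<open>Two \<open>\<eta>\<close>: one for the mesh, one for moving
      \<open>\<sigma> k\<close> from \<open>\<zeta> n u\<close> to \<open>\<gamma> u\<close>. Three
      \<open>\<eta>\<close>: the mesh and the displacement of both end points. Letting
      \<open>\<eta>\<close> tend to 0 removes them.\<close>
    define F where "F \<eta> = max 0 (\<sigma> k (\<gamma> u) - L k * (2 * \<eta> + (v - u) / \<delta>)) * (dist (\<gamma> u) (\<gamma> v) - 3 * \<eta>)" for \<eta>
    have "F \<eta> \<le> v - u" if \<eta>: "0 < \<eta>" for \<eta>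
    proof -
      obtain n where n: "n \<ge> k" "e n < \<eta>" "dist (\<zeta> n u) (\<gamma> u) < \<eta>" "dist (\<zeta> n v) (\<gamma> v) < \<eta>"
        using cl[OF \<eta>, of k u v] by blast
      define d where "d = dist (\<zeta> n u) (\<zeta> n v) - e n"
      have "dist (\<gamma> u) (\<gamma> v) \<le> dist (\<zeta> n u) (\<gamma> u) + dist (\<zeta> n u) (\<zeta> n v) + dist (\<zeta> n v) (\<gamma> v)"
        using dist_triangle[of "\<gamma> u" "\<gamma> v" "\<zeta> n u"] dist_triangle[of "\<zeta> n u" "\<gamma> v" "\<zeta> n v"] by (simp add: dist_commute)
      then have d: "dist (\<gamma> u) (\<gamma> v) - 3 * \<eta> \<le> d" using n by (simp add: d_def)
      then have F: "F \<eta> \<le> max 0 (\<sigma> k (\<gamma> u) - L k * (2 * \<eta> + (v - u) / \<delta>)) * d"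
        unfolding F_def by (intro mult_left_mono) auto
      show ?thesis
      proof (cases "0 \<le> d")
        case True
        have "L k * dist (\<zeta> n u) (\<gamma> u) \<le> L k * \<eta>" using n L by (intro mult_left_mono) auto
        moreover have "L k * e n \<le> L k * \<eta>" using n L by (intro mult_left_mono) auto
        ultimately have "\<sigma> k (\<gamma> u) - L k * (2 * \<eta> + (v - u) / \<delta>) \<le> \<sigma> k (\<zeta> n u) - L k * (e n + (v - u) / \<delta>)"
          using lip[of k "\<zeta> n u" "\<gamma> u"] unfolding distrib_left by linarith
        then have "max 0 (\<sigma> k (\<gamma> u) - L k * (2 * \<eta> + (v - u) / \<delta>)) * d \<le>
            max 0 (\<sigma> k (\<zeta> n u) - L k * (e n + (v - u) / \<delta>)) * d"
          using True by (intro mult_right_mono max.mono) auto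
        also have "\<dots> \<le> v - u" unfolding d_def by (rule \<zeta>(4)[OF uv n(1)])
        finally show ?thesis using F by linarith
      next
        case False
        then have "max 0 (\<sigma> k (\<gamma> u) - L k * (2 * \<eta> + (v - u) / \<delta>)) * d \<le> 0"
          by (intro mult_nonneg_nonpos) auto
        then show ?thesis using F uv by linarith
      qed
    qed
    moreover have "(F \<longlongrightarrow> F 0) (at_right 0)"
      unfolding F_def by (intro tendsto_intros)
    ultimately have "F 0 \<le> v - u"
      by (intro tendsto_upperbound[of F "F 0" "at_right 0"]) (auto simp: eventually_at_right_less intro: eventually_at_rightI[of 0 1])
    then show ?thesis by (simp add: F_def)
  qed
  have \<sigma>m: "\<sigma> k \<in> borel_measurable borel" for k
  proof -
    have "(L k)-lipschitz_on UNIV (\<sigma> k)" using lip L by (intro lipschitz_onI) (auto simp: dist_real_def)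
    then show ?thesis by (intro borel_measurable_continuous_onI lipschitz_on_continuous_on)
  qed
  have \<sigma>0: "0 \<le> \<sigma> k x" for k x using \<delta>(1) \<delta>(2)[of k x] by linarith
  have facts: "continuous_on {a..b} \<gamma>" "curve_length \<gamma> a b < \<infinity>"
    "line_integral (\<lambda>x. ennreal (\<sigma> k x)) \<gamma> a b \<le> ennreal (b - a)" if ab: "0 \<le> a" "a \<le> b" for a b k
  proof -
    have "dist (\<gamma> u) (\<gamma> v) \<le> (v - u) / \<delta>"
      "max 0 (\<sigma> k (\<gamma> u) - L k * ((v - u) / \<delta>)) * dist (\<gamma> u) (\<gamma> v) \<le> v - u"
      if "a \<le> u" "u \<le> v" "v \<le> b" for u v
      using that ab by (intro glip slow; simp)+
    note line_integral_le_of_slow[where \<gamma> = \<gamma> and s = "\<sigma> k" and L = "L k", OF ab(2) \<delta>(1) L this \<sigma>0 lip \<sigma>m]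
    then show "continuous_on {a..b} \<gamma>" "curve_length \<gamma> a b < \<infinity>"
      "line_integral (\<lambda>x. ennreal (\<sigma> k x)) \<gamma> a b \<le> ennreal (b - a)" by auto
  qed
  let ?c = "({0..T}, \<gamma>)"
  have "is_curve ?c"
  proof -
    have "\<gamma> 0 \<noteq> \<gamma> T" using \<open>\<gamma> 0 \<in> A\<close> \<open>\<gamma> T \<in> B\<close> AB(3) by auto
    moreover have "0 \<in> {0..T}" "T \<in> {0..T}" using T by auto
    ultimately have "\<not> \<gamma> constant_on {0..T}" unfolding constant_on_def by metis
    then show ?thesis using facts(1)[of 0 T] T by (simp add: is_curve_def is_interval_cc)
  qed
  moreover have "locally_rectifiable ?c"
    using facts(2) by (auto simp: locally_rectifiable_def)
  moreover have "curve_integral \<rho> ?c \<le> ennreal T"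
    unfolding curve_integral_def prod.case
  proof (rule SUP_least, clarify)
    fix a b :: real assume ab: "a \<le> b" "{a..b} \<subseteq> {0..T}"
    then have ab': "0 \<le> a" "b \<le> T" by auto
    define l where "l = enn2real (curve_length \<gamma> a b)"
    define \<beta> where "\<beta> = arc_length_param \<gamma> a b"
    have "line_integral \<rho> \<gamma> a b \<le> (\<integral>\<^sup>+x. (SUP k. ennreal (\<sigma> k (\<beta> x)) * indicator {0..l} x) \<partial>lborel)"
      unfolding line_integral_def l_def[symmetric] \<beta>_def[symmetric]
      using \<rho> by (intro nn_integral_mono) (auto split: split_indicator)
    also have "\<dots> = (SUP k. \<integral>\<^sup>+x. ennreal (\<sigma> k (\<beta> x)) * indicator {0..l} x \<partial>lborel)"
    proof (rule nn_integral_monotone_convergence_SUP)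
      show "incseq (\<lambda>k x. ennreal (\<sigma> k (\<beta> x)) * indicator {0..l} x)"
        using inc by (auto simp: incseq_def le_fun_def intro!: mult_right_mono ennreal_leI)
      show "(\<lambda>x. ennreal (\<sigma> k (\<beta> x)) * indicator {0..l} x) \<in> borel_measurable lborel" for k
        unfolding l_def \<beta>_def using facts(1,2)[OF ab'(1) ab(1)] ab(1) \<sigma>m
        by (intro arc_length_param_measurable) auto
    qed
    also have "\<dots> \<le> ennreal (b - a)"
      using facts(3)[OF ab'(1) ab(1)] by (intro SUP_least) (simp add: line_integral_def l_def \<beta>_def)
    also have "\<dots> \<le> ennreal T" using ab' by (intro ennreal_leI) auto
    finally show "line_integral \<rho> \<gamma> a b \<le> ennreal T" .
  qed
  ultimately show ?thesis by blast
qed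

section \<open>Semicontinuous majorants\<close>

text \<open>The supremum is the lower semicontinuous majorant of the Vitali-Caratheodory theorem.
  The approximating sequence is kept in place of the supremum because chains are priced with finite
  weights having a Lipschitz constant.\<close>

definition lipschitz_majorant :: "('a::metric_space \<Rightarrow> ennreal) \<Rightarrow> (nat \<Rightarrow> 'a \<Rightarrow> real) \<Rightarrow> bool" where
  "lipschitz_majorant f H \<longleftrightarrow> (\<forall>n. \<exists>L. L-lipschitz_on UNIV (H n)) \<and> (\<forall>n x. 0 \<le> H n x) \<and>
     (\<forall>x. incseq (\<lambda>n. H n x)) \<and> (\<forall>x. f x \<le> (SUP n. ennreal (H n x)))"

lemma lipschitz_majorant_measurable:
  assumes "lipschitz_majorant f H"
  shows "H n \<in> borel_measurable borel"
proof -
  obtain L where "L-lipschitz_on UNIV (H n)" using assms unfolding lipschitz_majorant_def by blast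
  then show ?thesis by (intro borel_measurable_continuous_onI lipschitz_on_continuous_on)
qed

lemma lipschitz_on_max:
  fixes f g :: "'a::metric_space \<Rightarrow> real"
  assumes "K-lipschitz_on X f" "L-lipschitz_on X g"
  shows "(max K L)-lipschitz_on X (\<lambda>x. max (f x) (g x))"
proof (rule lipschitz_onI)
  fix x y assume xy: "x \<in> X" "y \<in> X"
  have "\<bar>f x - f y\<bar> \<le> max K L * dist x y" "\<bar>g x - g y\<bar> \<le> max K L * dist x y"
    using lipschitz_onD[OF assms(1) xy] lipschitz_onD[OF assms(2) xy]
      mult_right_mono[of K "max K L" "dist x y"] mult_right_mono[of L "max K L" "dist x y"]
    by (auto simp: dist_real_def)
  then show "dist (max (f x) (g x)) (max (f y) (g y)) \<le> max K L * dist x y"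
    unfolding dist_real_def by linarith
qed (use lipschitz_on_nonneg[OF assms(1)] in auto)

lemma lipschitz_on_Max_image:
  fixes H :: "nat \<Rightarrow> 'a::metric_space \<Rightarrow> real"
  assumes "\<And>i. i \<le> m \<Longrightarrow> \<exists>L. L-lipschitz_on UNIV (H i)"
  shows "\<exists>L. L-lipschitz_on UNIV (\<lambda>x. MAX i\<in>{..m}. H i x)"
  using assms
proof (induction m)
  case 0
  then show ?case by simp
next
  case (Suc m)
  then obtain K L where "K-lipschitz_on UNIV (H (Suc m))" "L-lipschitz_on UNIV (\<lambda>x. MAX i\<in>{..m}. H i x)"
    by (metis le_Suc_eq order_refl)
  then have "(max K L)-lipschitz_on UNIV (\<lambda>x. max (H (Suc m) x) (MAX i\<in>{..m}. H i x))"
    by (rule lipschitz_on_max)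
  moreover have "(MAX i\<in>{..Suc m}. H i x) = max (H (Suc m) x) (MAX i\<in>{..m}. H i x)" for x
    unfolding atMost_Suc by (simp add: Max_insert)
  ultimately show ?case by auto
qed

text \<open>The sum of maximum and minimum is \<open>g x + h x\<close>, and \<open>u\<close> lies
  below the minimum. Hence passing to the maximum adds to the integral of \<open>h\<close> only the
  excess of \<open>g\<close> over \<open>u\<close>; finiteness permits cancelling the integral of
  \<open>u\<close>.\<close>

lemma ennreal_max_integral_step:
  assumes [measurable]: "g \<in> borel_measurable M" "h \<in> borel_measurable M" "u \<in> borel_measurable M"
    and le: "\<And>x. u x \<le> g x" "\<And>x. u x \<le> h x"
    and fin: "(\<integral>\<^sup>+x. u x \<partial>M) < \<infinity>"
    and gi: "(\<integral>\<^sup>+x. g x \<partial>M) \<le> (\<integral>\<^sup>+x. u x \<partial>M) + a"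
  shows "(\<integral>\<^sup>+x. max (g x) (h x) \<partial>M) \<le> a + (\<integral>\<^sup>+x. h x \<partial>M)"
proof -
  have "(\<integral>\<^sup>+x. max (g x) (h x) \<partial>M) + (\<integral>\<^sup>+x. u x \<partial>M) = (\<integral>\<^sup>+x. max (g x) (h x) + u x \<partial>M)"
    by (rule nn_integral_add[symmetric]) auto
  also have "\<dots> \<le> (\<integral>\<^sup>+x. g x + h x \<partial>M)"
  proof (intro nn_integral_mono)
    fix x
    show "max (g x) (h x) + u x \<le> g x + h x"
      using le[of x] by (cases "g x \<le> h x") (auto simp: max_def add.commute intro: add_mono)
  qed
  also have "\<dots> = (\<integral>\<^sup>+x. g x \<partial>M) + (\<integral>\<^sup>+x. h x \<partial>M)" by (rule nn_integral_add) auto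
  also have "\<dots> \<le> (\<integral>\<^sup>+x. u x \<partial>M) + a + (\<integral>\<^sup>+x. h x \<partial>M)" using gi by (rule add_right_mono)
  finally have "(\<integral>\<^sup>+x. u x \<partial>M) + (\<integral>\<^sup>+x. max (g x) (h x) \<partial>M) \<le> (\<integral>\<^sup>+x. u x \<partial>M) + (a + (\<integral>\<^sup>+x. h x \<partial>M))"
    by (simp add: ac_simps)
  then show ?thesis using fin by (auto simp: ennreal_add_left_cancel_le)
qed

lemma lipschitz_majorant_indicator:
  fixes M :: "'a::metric_space measure"
  assumes sM: "sets M = sets borel" and fin: "emeasure M UNIV < \<infinity>"
    and outer: "emeasure M A = (INF U\<in>{U. open U \<and> A \<subseteq> U}. emeasure M U)" and e: "0 < e"
    and A: "A \<in> sets borel"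
  shows "\<exists>H. lipschitz_majorant (indicator A) H \<and>
    (\<integral>\<^sup>+x. (SUP n. ennreal (H n x)) \<partial>M) \<le> (\<integral>\<^sup>+x. indicator A x \<partial>M) + ennreal e"
proof -
  have "emeasure M A \<le> emeasure M UNIV" using A sM by (intro emeasure_mono) auto
  then have "emeasure M A < emeasure M A + ennreal e"
    using fin e by (cases "emeasure M A") (auto simp: ennreal_less_iff simp flip: ennreal_plus)
  then obtain U where U: "open U" "A \<subseteq> U" "emeasure M U < emeasure M A + ennreal e"
    using outer unfolding INF_less_iff by (auto simp: INF_less_iff)
  \<comment> \<open>\<open>infdist\<close> to the empty set is 0, so the whole space is treated
    apart. Otherwise these truncated multiples of the distance to the complement increase to the
    indicator of \<open>U\<close>.\<close>
  define H where "H n x = (if U = UNIV then 1 else min 1 (real n * infdist x (- U)))" for n x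
  have "lipschitz_majorant (indicator A) H"
    unfolding lipschitz_majorant_def
  proof (intro conjI allI)
    fix n
    show "\<exists>L. L-lipschitz_on UNIV (H n)"
    proof (cases "U = UNIV")
      case True
      then show ?thesis by (intro exI[of _ 0]) (auto simp: H_def lipschitz_on_def)
    next
      case False
      have "(real n)-lipschitz_on UNIV (H n)"
      proof (rule lipschitz_onI)
        fix x y :: 'a
        have "real n * \<bar>infdist x (- U) - infdist y (- U)\<bar> \<le> real n * dist x y"
          by (intro mult_left_mono infdist_triangle_abs) simp
        then have "\<bar>real n * infdist x (- U) - real n * infdist y (- U)\<bar> \<le> real n * dist x y"
          by (simp add: abs_mult flip: right_diff_distrib)
        then show "dist (H n x) (H n y) \<le> real n * dist x y"
          using False unfolding H_def dist_real_def by (simp only: if_False)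
      qed simp
      then show ?thesis by blast
    qed
  next
    show "0 \<le> H n x" for n x by (simp add: H_def infdist_nonneg)
    show "incseq (\<lambda>n. H n x)" for x
    proof (rule monoI)
      fix m n :: nat assume "m \<le> n"
      then have "real m * infdist x (- U) \<le> real n * infdist x (- U)"
        by (intro mult_right_mono infdist_nonneg) simp
      then show "H m x \<le> H n x" unfolding H_def by (cases "U = UNIV") (simp, simp only: if_False min.mono order_refl)
    qed
    show "indicator A x \<le> (SUP n. ennreal (H n x))" for x
    proof (cases "x \<in> A")
      case True
      have "\<exists>n. H n x = 1"
      proof (cases "U = UNIV")
        case False
        have "x \<notin> - U" "closed (- U)" "- U \<noteq> {}" using True U False by auto
        then have "0 < infdist x (- U)" by (metis in_closed_iff_infdist_zero infdist_nonneg order_le_less)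
        then obtain n :: nat where "1 < real n * infdist x (- U)" using reals_Archimedean3 by blast
        then show ?thesis using False by (intro exI[of _ n]) (simp add: H_def)
      qed (simp add: H_def)
      then obtain n where "H n x = 1" by blast
      then have "1 \<le> (SUP n. ennreal (H n x))" by (intro SUP_upper2[of n]) auto
      then show ?thesis using True by simp
    qed simp
  qed
  moreover have "(\<integral>\<^sup>+x. (SUP n. ennreal (H n x)) \<partial>M) \<le> (\<integral>\<^sup>+x. indicator A x \<partial>M) + ennreal e"
  proof -
    have "(\<integral>\<^sup>+x. (SUP n. ennreal (H n x)) \<partial>M) \<le> (\<integral>\<^sup>+x. indicator U x \<partial>M)"
    proof (intro nn_integral_mono SUP_least)
      fix x n
      show "ennreal (H n x) \<le> indicator U x"
      proof (cases "x \<in> U")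
        case True
        have "H n x \<le> 1" by (simp add: H_def)
        then show ?thesis using True by (simp add: ennreal_le_1)
      qed (auto simp: H_def)
    qed
    also have "\<dots> = emeasure M U" using U sM by (intro nn_integral_indicator) auto
    also have "\<dots> \<le> emeasure M A + ennreal e" using U by simp
    also have "emeasure M A = (\<integral>\<^sup>+x. indicator A x \<partial>M)" using A sM by (intro nn_integral_indicator[symmetric]) auto
    finally show ?thesis .
  qed
  ultimately show ?thesis by blast
qed

text \<open>Vitali-Caratheodory by induction over the construction of measurable functions. The
  error \<open>e\<close> is generalised so that each case can ration it: \<open>e / b\<close> for
  multiples, halves for sums, a geometric series for increasing limits.\<close>

lemma lipschitz_majorant_exists:
  fixes M :: "'a::metric_space measure" and f :: "'a \<Rightarrow> ennreal"
  assumes sM: "sets M = sets borel" and fin: "emeasure M UNIV < \<infinity>"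
    and outer: "\<And>A. A \<in> sets borel \<Longrightarrow> emeasure M A = (INF U\<in>{U. open U \<and> A \<subseteq> U}. emeasure M U)"
    and f: "f \<in> borel_measurable M" and e: "0 < e"
  shows "\<exists>H. lipschitz_majorant f H \<and> (\<integral>\<^sup>+x. (SUP n. ennreal (H n x)) \<partial>M) \<le> (\<integral>\<^sup>+x. f x \<partial>M) + ennreal e"
  using f e
proof (induction arbitrary: e rule: borel_measurable_induct)
  case (cong f g)
  have "space M = UNIV" using sets_eq_imp_space_eq[OF sM] by simp
  then have "f = g" using cong by auto
  then show ?case using cong by simp
next
  case (set A)
  then show ?case using sM by (intro lipschitz_majorant_indicator fin outer) auto
next
  case (mult u c)
  show ?case
  proof (cases "c = 0")
    case True
    have "lipschitz_majorant (\<lambda>x. c * u x) (\<lambda>n x. 0)"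
      using True by (auto simp: lipschitz_majorant_def lipschitz_on_def incseq_def intro!: exI[of _ 0])
    then show ?thesis by (intro exI[of _ "\<lambda>n x. 0"]) auto
  next
    case False
    obtain b where b: "c = ennreal b" "0 \<le> b" using mult(1) by (cases c) auto
    then have b0: "0 < b" using False by (cases "b = 0") auto
    obtain H where H: "lipschitz_majorant u H"
      "(\<integral>\<^sup>+x. (SUP n. ennreal (H n x)) \<partial>M) \<le> (\<integral>\<^sup>+x. u x \<partial>M) + ennreal (e / b)"
      using mult.IH[of "e / b"] mult.prems b0 by auto
    note [measurable] = lipschitz_majorant_measurable[OF H(1)] mult(2)
    have [measurable_cong]: "sets M = sets borel" by (rule sM)
    have eq: "(SUP n. ennreal (b * H n x)) = c * (SUP n. ennreal (H n x))" for x
      using H(1) b by (simp add: SUP_mult_left_ennreal ennreal_mult lipschitz_majorant_def)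
    have "lipschitz_majorant (\<lambda>x. c * u x) (\<lambda>n x. b * H n x)"
      unfolding lipschitz_majorant_def eq
    proof (intro conjI allI)
      show "\<exists>L. L-lipschitz_on UNIV (\<lambda>x. b * H n x)" for n
      proof -
        obtain L where "L-lipschitz_on UNIV (H n)" using H(1) unfolding lipschitz_majorant_def by blast
        then show ?thesis using lipschitz_on_cmult_real[of L UNIV "H n" b] by blast
      qed
      show "c * u x \<le> c * (SUP n. ennreal (H n x))" for x
        using H(1) by (intro mult_left_mono) (auto simp: lipschitz_majorant_def)
    qed (use H(1) b in \<open>auto simp: lipschitz_majorant_def incseq_def intro!: mult_left_mono\<close>)
    moreover have "(\<integral>\<^sup>+x. (SUP n. ennreal (b * H n x)) \<partial>M) \<le> (\<integral>\<^sup>+x. c * u x \<partial>M) + ennreal e"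
    proof -
      have "(\<integral>\<^sup>+x. (SUP n. ennreal (b * H n x)) \<partial>M) = c * (\<integral>\<^sup>+x. (SUP n. ennreal (H n x)) \<partial>M)"
        unfolding eq by (intro nn_integral_cmult) measurable
      also have "\<dots> \<le> c * ((\<integral>\<^sup>+x. u x \<partial>M) + ennreal (e / b))" using H(2) by (rule mult_left_mono) simp
      also have "\<dots> = (\<integral>\<^sup>+x. c * u x \<partial>M) + ennreal e"
        using b b0 mult.prems by (simp add: distrib_left nn_integral_cmult ennreal_mult[symmetric])
      finally show ?thesis .
    qed
    ultimately show ?thesis by blast
  qed
next
  case (add u v)
  obtain H where H: "lipschitz_majorant u H"
    "(\<integral>\<^sup>+x. (SUP n. ennreal (H n x)) \<partial>M) \<le> (\<integral>\<^sup>+x. u x \<partial>M) + ennreal (e / 2)"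
    using add.IH(1)[of "e / 2"] add.prems by auto
  obtain K where K: "lipschitz_majorant v K"
    "(\<integral>\<^sup>+x. (SUP n. ennreal (K n x)) \<partial>M) \<le> (\<integral>\<^sup>+x. v x \<partial>M) + ennreal (e / 2)"
    using add.IH(2)[of "e / 2"] add.prems by auto
  note [measurable] = lipschitz_majorant_measurable[OF H(1)] lipschitz_majorant_measurable[OF K(1)] add.hyps(1,3)
  have [measurable_cong]: "sets M = sets borel" by (rule sM)
  have eq: "(SUP n. ennreal (K n x + H n x)) = (SUP n. ennreal (K n x)) + (SUP n. ennreal (H n x))" for x
    using H(1) K(1) by (subst ennreal_SUP_add[symmetric]) (auto simp: lipschitz_majorant_def incseq_def ennreal_leI)
  have "lipschitz_majorant (\<lambda>x. v x + u x) (\<lambda>n x. K n x + H n x)"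
    unfolding lipschitz_majorant_def eq
  proof (intro conjI allI)
    show "\<exists>L. L-lipschitz_on UNIV (\<lambda>x. K n x + H n x)" for n
    proof -
      obtain L L' where "L-lipschitz_on UNIV (K n)" "L'-lipschitz_on UNIV (H n)"
        using H(1) K(1) unfolding lipschitz_majorant_def by blast
      then show ?thesis using lipschitz_on_add by blast
    qed
    show "v x + u x \<le> (SUP n. ennreal (K n x)) + (SUP n. ennreal (H n x))" for x
      using H(1) K(1) by (intro add_mono) (auto simp: lipschitz_majorant_def)
  qed (use H(1) K(1) in \<open>auto simp: lipschitz_majorant_def incseq_def intro!: add_mono\<close>)
  moreover have "(\<integral>\<^sup>+x. (SUP n. ennreal (K n x + H n x)) \<partial>M) \<le> (\<integral>\<^sup>+x. v x + u x \<partial>M) + ennreal e"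
  proof -
    have "(\<integral>\<^sup>+x. (SUP n. ennreal (K n x + H n x)) \<partial>M) = (\<integral>\<^sup>+x. (SUP n. ennreal (K n x)) \<partial>M) + (\<integral>\<^sup>+x. (SUP n. ennreal (H n x)) \<partial>M)"
      unfolding eq by (intro nn_integral_add) measurable
    also have "\<dots> \<le> ((\<integral>\<^sup>+x. v x \<partial>M) + ennreal (e / 2)) + ((\<integral>\<^sup>+x. u x \<partial>M) + ennreal (e / 2))"
      using H(2) K(2) by (intro add_mono)
    also have "\<dots> = (\<integral>\<^sup>+x. v x + u x \<partial>M) + (ennreal (e / 2) + ennreal (e / 2))"
      by (simp add: nn_integral_add ac_simps)
    also have "ennreal (e / 2) + ennreal (e / 2) = ennreal e" using add.prems by (simp flip: ennreal_plus)
    finally show ?thesis .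
  qed
  ultimately show ?case by blast
next
  case (seq U)
  show ?case
  proof (cases "(\<integral>\<^sup>+x. (SUP i. U i) x \<partial>M) = \<infinity>")
    \<comment> \<open>With an infinite integral any majorant will do, so the constants
      \<open>real n\<close> are taken.\<close>
    case True
    have top: "(SUP n. ennreal (real n)) = top" by (simp add: ennreal_SUP_of_nat_eq_top flip: ennreal_of_nat_eq_real_of_nat)
    have "lipschitz_majorant (SUP i. U i) (\<lambda>n x. real n)"
      unfolding lipschitz_majorant_def top by (auto simp: lipschitz_on_def incseq_def intro!: exI[of _ 0])
    moreover have "(\<integral>\<^sup>+x. (SUP n. ennreal (real n)) \<partial>M) \<le> (\<integral>\<^sup>+x. (SUP i. U i) x \<partial>M) + ennreal e"
      unfolding True by simp
    ultimately show ?thesis by blast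
  next
    case False
    have Ule: "U i x \<le> (SUP i. U i) x" for i x by (auto intro: SUP_upper)
    have [measurable]: "U i \<in> borel_measurable M" for i by (rule seq(1))
    have Ufin: "(\<integral>\<^sup>+x. U i x \<partial>M) < \<infinity>" for i
    proof -
      have "(\<integral>\<^sup>+x. U i x \<partial>M) \<le> (\<integral>\<^sup>+x. (SUP i. U i) x \<partial>M)" by (intro nn_integral_mono Ule)
      also have "\<dots> < \<infinity>" using False by (simp only: infinity_ennreal_def less_top)
      finally show ?thesis .
    qed
    have "\<forall>i. \<exists>H. lipschitz_majorant (U i) H \<and> (\<integral>\<^sup>+x. (SUP n. ennreal (H n x)) \<partial>M) \<le> (\<integral>\<^sup>+x. U i x \<partial>M) + ennreal (e / 2 ^ Suc i)"
      using seq.IH seq.prems by simp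
    then obtain H where H: "\<And>i. lipschitz_majorant (U i) (H i)"
      "\<And>i. (\<integral>\<^sup>+x. (SUP n. ennreal (H i n x)) \<partial>M) \<le> (\<integral>\<^sup>+x. U i x \<partial>M) + ennreal (e / 2 ^ Suc i)"
      by metis
    have [measurable_cong]: "sets M = sets borel" by (rule sM)
    note [measurable] = lipschitz_majorant_measurable[OF H(1)]
    define h where "h i x = (SUP n. ennreal (H i n x))" for i x
    have [measurable]: "h i \<in> borel_measurable M" for i unfolding h_def by measurable
    have Uh: "U i x \<le> h i x" for i x using H(1)[of i] by (simp add: lipschitz_majorant_def h_def)
    \<comment> \<open>Sums of majorants would count the limit many times over. Maxima do not: by
      \<open>ennreal_max_integral_step\<close> each new index adds only its own share of the
      error.\<close>
    define g where "g m x = (SUP i\<in>{..m}. h i x)" for m x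
    have gS: "g (Suc m) x = max (g m x) (h (Suc m) x)" for m x
      unfolding g_def atMost_Suc by (simp add: sup_max max.commute)
    have gm[measurable]: "g m \<in> borel_measurable M" for m unfolding g_def by measurable
    have gint: "(\<integral>\<^sup>+x. g m x \<partial>M) \<le> (\<integral>\<^sup>+x. U m x \<partial>M) + ennreal (e * (1 - 1 / 2 ^ Suc m))" for m
    proof (induction m)
      case 0
      show ?case using H(2)[of 0] by (simp add: g_def h_def)
    next
      case (Suc m)
      have "(\<integral>\<^sup>+x. g (Suc m) x \<partial>M) \<le> ennreal (e * (1 - 1 / 2 ^ Suc m)) + (\<integral>\<^sup>+x. h (Suc m) x \<partial>M)"
        unfolding gS
      proof (rule ennreal_max_integral_step[where u = "U m"])
        show "U m x \<le> g m x" for x unfolding g_def by (intro SUP_upper2[of m] Uh) simp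
        have "U m x \<le> U (Suc m) x" for x using \<open>incseq U\<close> by (simp add: incseq_Suc_iff le_fun_def)
        then show "U m x \<le> h (Suc m) x" for x using Uh order_trans by blast
      qed (use Suc Ufin in auto)
      also have "\<dots> \<le> ennreal (e * (1 - 1 / 2 ^ Suc m)) + ((\<integral>\<^sup>+x. U (Suc m) x \<partial>M) + ennreal (e / 2 ^ Suc (Suc m)))"
        using H(2)[of "Suc m"] unfolding h_def by (intro add_left_mono)
      also have "\<dots> = (\<integral>\<^sup>+x. U (Suc m) x \<partial>M) + (ennreal (e * (1 - 1 / 2 ^ Suc m)) + ennreal (e / 2 ^ Suc (Suc m)))"
        by (simp only: ac_simps)
      also have "ennreal (e * (1 - 1 / 2 ^ Suc m)) + ennreal (e / 2 ^ Suc (Suc m)) = ennreal (e * (1 - 1 / 2 ^ Suc m) + e / 2 ^ Suc (Suc m))"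
      proof (rule ennreal_plus[symmetric])
        have "(1::real) \<le> 2 ^ Suc m" by (rule one_le_power) simp
        then have "1 / 2 ^ Suc m \<le> (1::real)" by (simp add: divide_le_eq)
        then show "0 \<le> e * (1 - 1 / 2 ^ Suc m)" using seq.prems by (intro mult_nonneg_nonneg) auto
      qed (use seq.prems in simp)
      also have "e * (1 - 1 / 2 ^ Suc m) + e / 2 ^ Suc (Suc m) = e * (1 - 1 / 2 ^ Suc (Suc m))"
        by (simp add: field_simps)
      finally show ?case .
    qed
    \<comment> \<open>A diagonal choice: finite maxima stay Lipschitz and increase in
      \<open>n\<close>, and they eventually dominate every \<open>H i m\<close>.\<close>
    define G where "G n x = (MAX i\<in>{..n}. H i n x)" for n x
    have H0: "0 \<le> H i n x" and Hinc: "n \<le> n' \<Longrightarrow> H i n x \<le> H i n' x" for i n n' x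
      using H(1)[of i] by (auto simp: lipschitz_majorant_def incseq_def)
    have HG: "H i n x \<le> G m x" if "i \<le> m" "n \<le> m" for i n m x
    proof -
      have "H i m x \<le> G m x" unfolding G_def using that by (intro Max_ge) auto
      then show ?thesis using Hinc[OF that(2), of i x] by simp
    qed
    have Gin: "\<exists>i\<le>n. G n x = H i n x" for n x
    proof -
      have "G n x \<in> (\<lambda>i. H i n x) ` {..n}" unfolding G_def by (intro Max_in) auto
      then show ?thesis by auto
    qed
    have "lipschitz_majorant (SUP i. U i) G"
      unfolding lipschitz_majorant_def
    proof (intro conjI allI)
      show "\<exists>L. L-lipschitz_on UNIV (G n)" for n
        unfolding G_def using H(1) by (intro lipschitz_on_Max_image) (auto simp: lipschitz_majorant_def)
      show "0 \<le> G n x" for n x using Gin[of n x] H0 by auto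
      show "incseq (\<lambda>n. G n x)" for x
      proof (rule incseq_SucI)
        fix n
        obtain i where "i \<le> n" "G n x = H i n x" using Gin by blast
        then show "G n x \<le> G (Suc n) x" using HG[of i "Suc n" n x] by simp
      qed
      show "(SUP i. U i) x \<le> (SUP n. ennreal (G n x))" for x
        unfolding SUP_apply
      proof (rule SUP_least)
        fix i
        have "U i x \<le> h i x" by (rule Uh)
        also have "\<dots> \<le> (SUP n. ennreal (G n x))"
          unfolding h_def
        proof (rule SUP_least)
          fix n
          show "ennreal (H i n x) \<le> (SUP n. ennreal (G n x))"
            by (rule SUP_upper2[of "max i n"]) (auto intro!: ennreal_leI HG)
        qed
        finally show "U i x \<le> (SUP n. ennreal (G n x))" .
      qed
    qed
    moreover have "(\<integral>\<^sup>+x. (SUP n. ennreal (G n x)) \<partial>M) \<le> (\<integral>\<^sup>+x. (SUP i. U i) x \<partial>M) + ennreal e"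
    proof -
      have "(\<integral>\<^sup>+x. (SUP n. ennreal (G n x)) \<partial>M) \<le> (\<integral>\<^sup>+x. (SUP m. g m x) \<partial>M)"
      proof (intro nn_integral_mono SUP_mono)
        fix x n
        obtain i where i: "i \<le> n" "G n x = H i n x" using Gin by blast
        have "ennreal (G n x) \<le> h i x" unfolding h_def i(2) by (intro SUP_upper) simp
        also have "\<dots> \<le> g n x" unfolding g_def using i by (intro SUP_upper) simp
        finally show "\<exists>m\<in>UNIV. ennreal (G n x) \<le> g m x" by blast
      qed
      also have "\<dots> = (SUP m. \<integral>\<^sup>+x. g m x \<partial>M)"
        by (intro nn_integral_monotone_convergence_SUP) (auto simp: incseq_Suc_iff le_fun_def gS)
      also have "\<dots> \<le> (\<integral>\<^sup>+x. (SUP i. U i) x \<partial>M) + ennreal e"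
      proof (rule SUP_least)
        fix m
        have "(\<integral>\<^sup>+x. g m x \<partial>M) \<le> (\<integral>\<^sup>+x. U m x \<partial>M) + ennreal (e * (1 - 1 / 2 ^ Suc m))" by (rule gint)
        also have "\<dots> \<le> (\<integral>\<^sup>+x. (SUP i. U i) x \<partial>M) + ennreal e"
          using Ule seq.prems by (intro add_mono nn_integral_mono ennreal_leI mult_left_le) auto
        finally show "(\<integral>\<^sup>+x. g m x \<partial>M) \<le> (\<integral>\<^sup>+x. (SUP i. U i) x \<partial>M) + ennreal e" .
      qed
      finally show ?thesis .
    qed
    ultimately show ?thesis by blast
  qed
qed

text \<open>For \<open>\<delta> \<le> x \<le> y\<close> the difference of p-th powers is at least
  \<open>(y - x) * x powr (p - 1)\<close>. The root is in general not Lipschitz near 0, which is why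
  the floor \<open>\<delta> powr p\<close> is added to a weight before its root is taken.\<close>

lemma powr_root_lipschitz:
  fixes a b :: real
  assumes p: "1 \<le> p" and \<delta>: "0 < \<delta>" "\<delta> powr p \<le> a" "\<delta> powr p \<le> b"
  shows "\<bar>a powr (1/p) - b powr (1/p)\<bar> \<le> \<delta> powr (1 - p) * \<bar>a - b\<bar>"
proof -
  have *: "y - x \<le> \<delta> powr (1 - p) * (y powr p - x powr p)" if x: "\<delta> \<le> x" "x \<le> y" for x y
  proof -
    have pos: "0 < x" "0 < y" using x \<delta> by auto
    have "(y - x) * \<delta> powr (p - 1) \<le> (y - x) * x powr (p - 1)"
      using x \<delta> p by (intro mult_left_mono powr_mono2) auto
    also have "\<dots> = y * x powr (p - 1) - x powr p"
      using powr_mult_base[of x "p - 1"] pos by (simp add: left_diff_distrib)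
    also have "\<dots> \<le> y * y powr (p - 1) - x powr p"
      using x pos p by (intro diff_right_mono mult_left_mono powr_mono2) auto
    also have "\<dots> = y powr p - x powr p" using powr_mult_base[of y "p - 1"] pos by simp
    finally have "\<delta> powr (1 - p) * ((y - x) * \<delta> powr (p - 1)) \<le> \<delta> powr (1 - p) * (y powr p - x powr p)"
      by (intro mult_left_mono) auto
    moreover have "\<delta> powr (1 - p) * ((y - x) * \<delta> powr (p - 1)) = y - x"
      using \<delta> by (simp add: mult.left_commute flip: powr_add)
    ultimately show ?thesis by simp
  qed
  have root: "\<delta> \<le> c powr (1/p)" "(c powr (1/p)) powr p = c" if "\<delta> powr p \<le> c" for c
  proof -
    have "0 \<le> c" using that order_trans[OF powr_ge_zero] by blast
    then show "(c powr (1/p)) powr p = c" using p by (simp add: powr_powr)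
    have "(\<delta> powr p) powr (1/p) \<le> c powr (1/p)" using that p by (intro powr_mono2) auto
    then show "\<delta> \<le> c powr (1/p)" using \<delta> p by (simp add: powr_powr)
  qed
  define x where "x = a powr (1/p)"
  define y where "y = b powr (1/p)"
  have xy: "\<delta> \<le> x" "\<delta> \<le> y" "x powr p = a" "y powr p = b"
    using root[OF \<delta>(2)] root[OF \<delta>(3)] by (auto simp: x_def y_def)
  have "\<bar>x - y\<bar> \<le> \<delta> powr (1 - p) * \<bar>a - b\<bar>"
  proof (cases "x \<le> y")
    case True
    have "0 \<le> y - x" using True by simp
    moreover have "y - x \<le> \<delta> powr (1 - p) * (b - a)" using *[of x y] xy True by simp
    moreover have "\<dots> \<le> \<delta> powr (1 - p) * \<bar>a - b\<bar>" by (intro mult_left_mono) auto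
    ultimately show ?thesis by linarith
  next
    case False
    have "x - y \<le> \<delta> powr (1 - p) * (a - b)" using *[of y x] xy False by simp
    moreover have "\<dots> \<le> \<delta> powr (1 - p) * \<bar>a - b\<bar>" by (intro mult_left_mono) auto
    ultimately show ?thesis using False by linarith
  qed
  then show ?thesis by (simp add: x_def y_def)
qed

section \<open>Discrete cut-off functions\<close>

text \<open>The witness is 1 minus the least cost of an \<open>e\<close>-chain from
  \<open>A\<close>, in units of \<open>T\<close> and truncated at 1. Adding one edge changes the
  cost by the weight at its start; the factor 2 makes this bound symmetric in the two ends.\<close>

lemma chain_cutoff:
  fixes s :: "'a::metric_space \<Rightarrow> real"
  assumes T: "0 < T" and s: "\<And>x. \<delta> \<le> s x" "\<And>x y. \<bar>s x - s y\<bar> \<le> L * dist x y" "0 < \<delta>"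
    and e: "0 < e" "L * e \<le> \<delta>" "0 \<le> L"
    and nochain: "\<not> (\<exists>N z. z 0 \<in> A \<and> z N \<in> B \<and> (\<forall>j<N. dist (z j) (z (Suc j)) < e) \<and>
       (\<Sum>j<N. s (z j) * dist (z j) (z (Suc j))) \<le> T)"
  obtains v :: "'a \<Rightarrow> real" where "\<And>x. x \<in> A \<Longrightarrow> v x = 1" "\<And>x. x \<in> B \<Longrightarrow> v x = 0"
    "\<And>x y. dist x y < e \<Longrightarrow> \<bar>v x - v y\<bar> \<le> 2 / T * s x * dist x y"
proof -
  \<comment> \<open>The inserted 1 performs the truncation and also covers points that no chain
    reaches.\<close>
  define S where "S x = insert 1 {c. \<exists>N z. z 0 \<in> A \<and> z N = x \<and> (\<forall>j<N. dist (z j) (z (Suc j)) < e) \<and>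
       c = (\<Sum>j<N. s (z j) * dist (z j) (z (Suc j))) / T}" for x
  define u where "u x = Inf (S x)" for x
  have s0: "0 \<le> s x" for x using s(1)[of x] s(3) by linarith
  have lb: "0 \<le> c" if "c \<in> S x" for c x
    using that T s0 by (auto simp: S_def intro!: divide_nonneg_pos sum_nonneg mult_nonneg_nonneg)
  have bdd: "bdd_below (S x)" for x using lb by (intro bdd_belowI[of _ 0])
  have ne: "S x \<noteq> {}" for x by (simp add: S_def)
  have step: "u y \<le> u x + s x * dist x y / T" if d: "dist x y < e" for x y
  proof -
    have "u y - s x * dist x y / T \<le> c" if c: "c \<in> S x" for c
    proof -
      have K: "0 \<le> s x * dist x y / T" using s0 T by simp
      consider "c = 1" | N z where "z 0 \<in> A" "z N = x" "\<And>j. j < N \<Longrightarrow> dist (z j) (z (Suc j)) < e"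
        "c = (\<Sum>j<N. s (z j) * dist (z j) (z (Suc j))) / T"
        using c by (auto simp: S_def)
      then show ?thesis
      proof cases
        case 1
        have "u y \<le> 1" unfolding u_def by (intro cInf_lower bdd) (simp add: S_def)
        then show ?thesis using 1 K by linarith
      next
        case 2
        \<comment> \<open>The chain ending at \<open>x\<close> is prolonged by the edge to
          \<open>y\<close>, charged at its starting point \<open>x\<close>.\<close>
        define z' where "z' j = (if j \<le> N then z j else y)" for j
        have "(\<Sum>j<Suc N. s (z' j) * dist (z' j) (z' (Suc j))) = (\<Sum>j<N. s (z j) * dist (z j) (z (Suc j))) + s x * dist x y"
          using 2(2) by (simp add: z'_def)
        then have "c + s x * dist x y / T = (\<Sum>j<Suc N. s (z' j) * dist (z' j) (z' (Suc j))) / T"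
          using 2(4) by (simp add: add_divide_distrib)
        moreover have "\<forall>j<Suc N. dist (z' j) (z' (Suc j)) < e"
          using 2(2,3) d by (auto simp: z'_def less_Suc_eq)
        ultimately have "c + s x * dist x y / T \<in> S y"
          unfolding S_def using 2(1) by (intro insertI2 CollectI exI[of _ "Suc N"] exI[of _ z']) (simp add: z'_def)
        then have "u y \<le> c + s x * dist x y / T" unfolding u_def by (intro cInf_lower bdd)
        then show ?thesis by simp
      qed
    qed
    then have "u y - s x * dist x y / T \<le> u x" unfolding u_def by (intro cInf_greatest ne)
    then show ?thesis by simp
  qed
  show thesis
  proof
    show "1 - u x = 1" if "x \<in> A" for x
    proof -
      have "0 \<in> S x" unfolding S_def using that by (intro insertI2 CollectI exI[of _ 0] exI[of _ "\<lambda>_. x"]) simp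
      then have "u x \<le> 0" unfolding u_def by (intro cInf_lower bdd)
      moreover have "0 \<le> u x" unfolding u_def by (intro cInf_greatest ne lb)
      ultimately show ?thesis by simp
    qed
    show "1 - u x = 0" if "x \<in> B" for x
    proof -
      have "1 \<le> c" if c: "c \<in> S x" for c
      proof (cases "c = 1")
        case False
        then obtain N z where z: "z 0 \<in> A" "z N = x" "\<forall>j<N. dist (z j) (z (Suc j)) < e"
          "c = (\<Sum>j<N. s (z j) * dist (z j) (z (Suc j))) / T"
          using c by (auto simp: S_def)
        then have "T < (\<Sum>j<N. s (z j) * dist (z j) (z (Suc j)))"
          using nochain \<open>x \<in> B\<close> by (meson not_less)
        then show ?thesis using z(4) T by simp
      qed simp
      then have "1 \<le> u x" unfolding u_def by (intro cInf_greatest ne)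
      moreover have "u x \<le> 1" unfolding u_def by (intro cInf_lower bdd) (simp add: S_def)
      ultimately show ?thesis by simp
    qed
    show "\<bar>(1 - u x) - (1 - u y)\<bar> \<le> 2 / T * s x * dist x y" if d: "dist x y < e" for x y
    proof -
      \<comment> \<open>The mesh is so short that \<open>s\<close> varies by at most
        \<open>\<delta>\<close>, hence by at most its own value, between neighbours.\<close>
      have "L * dist x y \<le> L * e" using d e by (intro mult_left_mono) auto
      then have "s y \<le> 2 * s x" using s(1)[of x] s(2)[of x y] e(2) by linarith
      then have "s y * dist x y / T \<le> 2 * s x * dist x y / T"
        using T by (intro divide_right_mono mult_right_mono) auto
      moreover have "s x * dist x y / T \<le> 2 * s x * dist x y / T"
        using T s0[of x] by (intro divide_right_mono mult_right_mono) auto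
      moreover have "u x \<le> u y + s y * dist x y / T" using step[of y x] d by (simp add: dist_commute)
      moreover have "u y \<le> u x + s x * dist x y / T" using step[OF d] .
      ultimately show ?thesis by (simp add: abs_le_iff)
    qed
  qed
qed

section \<open>Bounded doubling spaces\<close>

context doubling_space
begin

text \<open>The balls of radius \<open>s/2\<close> are disjoint and lie in
  \<open>ball x (R + s)\<close>. Each has at least the fraction \<open>1 / C ^ k\<close> of its
  volume, since the condition on \<open>k\<close> covers \<open>2 * R + s\<close>, the distance of
  centres plus the larger radius.\<close>

lemma separated_card_le:
  fixes S :: "'a set"
  assumes "finite S" "\<And>y. y \<in> S \<Longrightarrow> dist x y \<le> R" "\<And>y z. y \<in> S \<Longrightarrow> z \<in> S \<Longrightarrow> y \<noteq> z \<Longrightarrow> s \<le> dist y z"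
    and s: "0 < s" "4 * R + 2 * s \<le> 2 ^ k * s" "0 \<le> R"
  shows "real (card S) \<le> C ^ k"
proof -
  define m where "m = measure M (ball x (R + s))"
  have m: "0 < m" unfolding m_def using s by (intro measure_ball_pos) auto
  have disj: "disjoint_family_on (\<lambda>y. ball y (s/2)) S"
  proof (unfold disjoint_family_on_def, intro ballI impI)
    fix y z assume yz: "y \<in> S" "z \<in> S" "y \<noteq> z"
    have "w \<notin> ball y (s/2) \<inter> ball z (s/2)" for w
      using assms(3)[OF yz] dist_triangle[of y z w] by (auto simp: dist_commute)
    then show "ball y (s/2) \<inter> ball z (s/2) = {}" by blast
  qed
  have "real (card S) * (m / C ^ k) = (\<Sum>y\<in>S. m / C ^ k)" by simp
  also have "\<dots> \<le> (\<Sum>y\<in>S. measure M (ball y (s/2)))"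
  proof (rule sum_mono)
    fix y assume y: "y \<in> S"
    have "m \<le> C ^ k * measure M (ball y (s/2))"
      unfolding m_def using assms(2)[OF y] s by (intro measure_ball_compare) auto
    then show "m / C ^ k \<le> measure M (ball y (s/2))" using C_gt_1 by (simp add: field_simps)
  qed
  also have "\<dots> = measure M (\<Union>y\<in>S. ball y (s/2))"
    using assms(1) disj ball_fin[of "s/2"] s by (intro measure_finite_Union[symmetric]) (auto simp: less_top[symmetric])
  also have "\<dots> \<le> m"
    unfolding m_def
  proof (rule measure_mono_fmeasurable)
    show "(\<Union>y\<in>S. ball y (s/2)) \<subseteq> ball x (R + s)"
    proof
      fix w assume "w \<in> (\<Union>y\<in>S. ball y (s/2))"
      then obtain y where y: "y \<in> S" "dist y w < s/2" by auto
      then show "w \<in> ball x (R + s)" using assms(2)[OF y(1)] dist_triangle[of x w y] s by simp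
    qed
    show "ball x (R + s) \<in> fmeasurable M" using ball_fin[of "R + s" x] s by (simp add: fmeasurable_def)
    show "(\<Union>y\<in>S. ball y (s/2)) \<in> sets M" using assms(1) by auto
  qed
  finally have "real (card S) * (m / C ^ k) \<le> m" .
  then have "real (card S) * m \<le> C ^ k * m" using C_gt_1 by (simp add: field_simps)
  then show ?thesis using m by simp
qed

text \<open>Far from a ball carrying most of the mass, doubling fails.\<close>

lemma bounded_of_finite_measure:
  assumes fin: "emeasure M UNIV < \<infinity>"
  obtains R where "0 < R" "\<And>x y :: 'a. dist x y < R"
proof -
  interpret finite_measure M by (rule finite_measureI) (use fin space_M in auto)
  fix x0 :: 'a
  define \<mu> where "\<mu> = measure M UNIV"
  \<comment> \<open>If \<open>y\<close> is very far from \<open>x0\<close>, two doublings of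
    \<open>ball y (\<rho>/2)\<close> cover \<open>ball x0 n\<close>, yet they multiply a mass below
    \<open>c * \<mu>\<close> to less than \<open>\<mu> / 4\<close>, while \<open>ball x0 n\<close>
    holds more than three quarters of the total.\<close>
  define c where "c = 1 / (4 * C\<^sup>2)"
  have C2: "1 < C\<^sup>2" using C_gt_1 by (simp add: one_less_power)
  have "1 / C\<^sup>2 < 1" using C2 by (subst divide_less_eq_1_pos) auto
  then have c: "0 < c" "c < 1/4" using C2 by (auto simp: c_def)
  have "measure M (ball x0 1) \<le> \<mu>" unfolding \<mu>_def by (intro finite_measure_mono) (auto simp: sets_M)
  then have \<mu>: "0 < \<mu>" using measure_ball_pos[of 1 x0] by simp
  have "(\<Union>n::nat. ball x0 n) = UNIV"
  proof -
    have "\<exists>n::nat. dist x0 y < n" for y by (rule reals_Archimedean2)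
    then show ?thesis by auto
  qed
  then have "(\<lambda>n. measure M (ball x0 (real n))) \<longlonglongrightarrow> \<mu>"
    using finite_Lim_measure_incseq[of "\<lambda>n. ball x0 (real n)"] unfolding \<mu>_def
    by (force simp: incseq_def)
  moreover have "\<mu> * (1 - c) < \<mu>" using \<mu> c by simp
  ultimately have "eventually (\<lambda>n. \<mu> * (1 - c) < measure M (ball x0 (real n))) sequentially"
    by (rule order_tendstoD(1))
  then obtain n :: nat where n: "\<mu> * (1 - c) < measure M (ball x0 (real n))"
    by (auto simp: eventually_sequentially)
  moreover have "0 < \<mu> * (1 - c)" using \<mu> c by (intro mult_pos_pos) auto
  ultimately have n0: "0 < n" by (cases n) auto
  have "dist x0 y < 2 * real n" for y
  proof (rule ccontr)
    assume "\<not> dist x0 y < 2 * real n"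
    define \<rho> where "\<rho> = dist x0 y"
    have \<rho>: "2 * real n \<le> \<rho>" "0 < \<rho>" using \<open>\<not> dist x0 y < 2 * real n\<close> n0 by (auto simp: \<rho>_def)
    have "ball y (\<rho>/2) \<inter> ball x0 (real n) = {}"
    proof -
      have "w \<notin> ball y (\<rho>/2) \<inter> ball x0 (real n)" for w
        using dist_triangle[of x0 y w] \<rho> by (auto simp: dist_commute \<rho>_def)
      then show ?thesis by blast
    qed
    then have "measure M (ball y (\<rho>/2)) + measure M (ball x0 (real n)) = measure M (ball y (\<rho>/2) \<union> ball x0 (real n))"
      by (intro finite_measure_Union[symmetric]) auto
    also have "\<dots> \<le> \<mu>" unfolding \<mu>_def by (intro finite_measure_mono) (auto simp: sets_M)
    finally have small: "measure M (ball y (\<rho>/2)) < c * \<mu>" using n by (simp add: algebra_simps)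
    have "measure M (ball x0 (real n)) \<le> C ^ 2 * measure M (ball y (\<rho>/2))"
      using \<rho> by (intro measure_ball_compare) (auto simp: \<rho>_def)
    also have "\<dots> < C ^ 2 * (c * \<mu>)" using small C2 by (intro mult_strict_left_mono) auto
    also have "\<dots> = \<mu> / 4" using C_gt_1 by (simp add: c_def)
    finally have "\<mu> * (1 - c) < \<mu> / 4" using n by linarith
    moreover have "\<mu> * c < \<mu> * (1/4)" using \<mu> c by (intro mult_strict_left_mono)
    ultimately show False using \<mu> by (simp add: right_diff_distrib)
  qed
  then have "dist x y < 4 * real n" for x y :: 'a
    using dist_triangle[of x y x0] by (smt (verit) dist_commute)
  then show thesis using n0 that[of "4 * real n"] by auto
qed

text \<open>The size of separated sets is bounded, so one of largest cardinality exists; a point at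
  distance at least \<open>s\<close> from it could be added.\<close>

lemma finite_net:
  assumes R: "0 < R" "\<And>x y :: 'a. dist x y < R" and s: "0 < s"
  obtains S :: "'a set" where "finite S" "\<And>y z. y \<in> S \<Longrightarrow> z \<in> S \<Longrightarrow> y \<noteq> z \<Longrightarrow> s \<le> dist y z"
    "\<And>y. \<exists>x\<in>S. dist x y < s"
proof -
  obtain k :: nat where "4 * R / s + 2 < 2 ^ k" using real_arch_pow[of 2 "4 * R / s + 2"] by auto
  then have k: "4 * R + 2 * s \<le> 2 ^ k * s" using s by (simp add: field_simps)
  define P where "P S \<longleftrightarrow> finite S \<and> (\<forall>y\<in>S. \<forall>z\<in>S. y \<noteq> z \<longrightarrow> s \<le> dist y z)" for S :: "'a set"
  have "card S < Suc (nat \<lceil>C ^ k\<rceil>)" if "P S" for S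
  proof -
    \<comment> \<open>Any centre serves, because no two points of the space are \<open>R\<close>
      apart.\<close>
    have "real (card S) \<le> C ^ k"
      using that k s R less_imp_le[OF R(2)] by (intro separated_card_le[of S undefined R s]) (auto simp: P_def)
    then show ?thesis by linarith
  qed
  moreover have "P {}" by (simp add: P_def)
  ultimately obtain S where S: "P S" "\<And>S'. P S' \<Longrightarrow> card S' \<le> card S"
    using ex_has_greatest_nat[of P "{}" card "Suc (nat \<lceil>C ^ k\<rceil>)"] by (metis less_imp_le)
  show thesis
  proof
    show "s \<le> dist y z" if "y \<in> S" "z \<in> S" "y \<noteq> z" for y z using S(1) that by (auto simp: P_def)
    show "finite S" using S(1) by (simp add: P_def)
    show "\<exists>x\<in>S. dist x y < s" for y
    proof (rule ccontr)
      assume *: "\<not> (\<exists>x\<in>S. dist x y < s)"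
      then have "P (insert y S)" using S(1) unfolding P_def by (auto simp: dist_commute not_less)
      moreover have "y \<notin> S" using * s by force
      then have "card (insert y S) = Suc (card S)" using S(1) by (simp add: P_def)
      ultimately show False using S(2)[of "insert y S"] by simp
    qed
  qed
qed

end

text \<open>The finite nets give total boundedness; completeness of the space turns it into
  compactness.\<close>

lemma compact_of_finite_doubling:
  fixes M :: "'a::complete_space measure"
  assumes "doubling_space M C D" "emeasure M UNIV < \<infinity>"
  shows "compact (UNIV :: 'a set)"
proof -
  interpret doubling_space M C D by fact
  obtain R where R: "0 < R" "\<And>x y :: 'a. dist x y < R"
    using bounded_of_finite_measure[OF assms(2)] by blast
  have "\<exists>S::'a set. finite S \<and> UNIV \<subseteq> (\<Union>x\<in>S. ball x e)" if e: "0 < e" for e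
  proof -
    obtain S :: "'a set" where "finite S" "\<And>y. \<exists>x\<in>S. dist x y < e"
      using finite_net[OF R e] by metis
    then show ?thesis by (intro exI[of _ S]) auto
  qed
  then show ?thesis unfolding compact_eq_totally_bounded using complete_UNIV by blast
qed

section \<open>Energy of discrete convolutions\<close>

definition clamp01 :: "real \<Rightarrow> real" where
  "clamp01 t = max 0 (min 1 t)"

lemma clamp01_lipschitz: "1-lipschitz_on UNIV clamp01"
  by (rule lipschitz_onI) (auto simp: clamp01_def dist_real_def)

lemma clamp01_simps [simp]: "clamp01 0 = 0" "0 \<le> clamp01 t" "clamp01 t \<le> 1" "1 \<le> t \<Longrightarrow> clamp01 t = 1"
  by (auto simp: clamp01_def)

lemma best_lipschitz_clamp01: "0 \<le> best_lipschitz clamp01" "best_lipschitz clamp01 \<le> 1"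
proof -
  have *: "0 \<le> L" if "L-lipschitz_on UNIV clamp01" for L using lipschitz_on_nonneg[OF that] .
  show "0 \<le> best_lipschitz clamp01"
    unfolding best_lipschitz_def using clamp01_lipschitz * by (intro cInf_greatest) auto
  show "best_lipschitz clamp01 \<le> 1"
    unfolding best_lipschitz_def using clamp01_lipschitz * by (intro cInf_lower) (auto intro!: bdd_belowI[of _ 0])
qed

section \<open>Localised energy, cut-off functions and discrete convolution\<close>

context doubling_dirichlet_space
begin

lemma p_pos: "0 < p"
  using p_ge_1 by simp

text \<open>With the p-th root, \<open>energy_triangle\<close> and \<open>energy_scale\<close>
  become the seminorm axioms on each set \<open>A\<close>, so finite linear combinations are
  estimated term by term.\<close>

definition root_energy :: "('a \<Rightarrow> real) \<Rightarrow> 'a set \<Rightarrow> real" where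
  "root_energy f A = measure (\<Gamma> f) A powr (1/p)"

lemma root_energy_nonneg [simp]: "0 \<le> root_energy f A"
  by (simp add: root_energy_def)

lemma root_energy_powr: "root_energy f A powr p = measure (\<Gamma> f) A"
  using p_pos by (simp add: root_energy_def powr_powr)

lemma energy_le_of_root_energy_le:
  assumes "root_energy f A \<le> B"
  shows "measure (\<Gamma> f) A \<le> B powr p"
  using powr_mono2[OF less_imp_le[OF p_pos] root_energy_nonneg assms] by (simp add: root_energy_powr)

lemma root_energy_scale:
  "f \<in> F \<Longrightarrow> A \<in> sets borel \<Longrightarrow> root_energy (\<lambda>x. c * f x) A = \<bar>c\<bar> * root_energy f A"
  using p_pos by (simp add: root_energy_def energy_scale powr_mult powr_powr)

lemma root_energy_add:
  "f \<in> F \<Longrightarrow> g \<in> F \<Longrightarrow> A \<in> sets borel \<Longrightarrow> root_energy (\<lambda>x. f x + g x) A \<le> root_energy f A + root_energy g A"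
  unfolding root_energy_def by (rule energy_triangle)

lemma root_energy_zero: "A \<in> sets borel \<Longrightarrow> root_energy (\<lambda>x. 0) A = 0"
  using root_energy_scale[OF zero_in_F, of A 0] by simp

lemma root_energy_local:
  "f \<in> F \<Longrightarrow> open A \<Longrightarrow> (\<And>x. x \<in> A \<Longrightarrow> f x = c) \<Longrightarrow> root_energy f A = 0"
  unfolding root_energy_def by (subst energy_local) auto

lemma sum_in_F:
  assumes "finite I" "\<And>i. i \<in> I \<Longrightarrow> f i \<in> F"
  shows "(\<lambda>x. \<Sum>i\<in>I. c i * f i x) \<in> F"
  using assms by (induction I) (auto intro!: zero_in_F add_in_F scale_in_F)

lemma root_energy_sum:
  assumes "finite I" "\<And>i. i \<in> I \<Longrightarrow> f i \<in> F" "A \<in> sets borel"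
  shows "root_energy (\<lambda>x. \<Sum>i\<in>I. c i * f i x) A \<le> (\<Sum>i\<in>I. \<bar>c i\<bar> * root_energy (f i) A)"
  using assms(1,2)
proof (induction I)
  case empty
  then show ?case using root_energy_zero[OF assms(3)] by simp
next
  case (insert j I)
  have "root_energy (\<lambda>x. c j * f j x + (\<Sum>i\<in>I. c i * f i x)) A \<le>
     root_energy (\<lambda>x. c j * f j x) A + root_energy (\<lambda>x. \<Sum>i\<in>I. c i * f i x) A"
    using insert.prems insert.hyps assms(3) by (intro root_energy_add scale_in_F sum_in_F) auto
  also have "root_energy (\<lambda>x. c j * f j x) A = \<bar>c j\<bar> * root_energy (f j) A"
    using insert assms by (intro root_energy_scale) auto
  also have "root_energy (\<lambda>x. \<Sum>i\<in>I. c i * f i x) A \<le> (\<Sum>i\<in>I. \<bar>c i\<bar> * root_energy (f i) A)"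
    using insert.prems by (intro insert.IH) auto
  finally show ?case using insert.hyps by simp
qed

lemma clamp_in_F: "f \<in> F \<Longrightarrow> (\<lambda>x. clamp01 (f x)) \<in> F"
  using lipschitz_in_F[of f clamp01] clamp01_lipschitz by (auto simp: comp_def)

lemma root_energy_clamp:
  assumes "f \<in> F" "A \<in> sets borel"
  shows "root_energy (\<lambda>x. clamp01 (f x)) A \<le> root_energy f A"
proof -
  have "measure (\<Gamma> (clamp01 \<circ> f)) A \<le> best_lipschitz clamp01 powr p * measure (\<Gamma> f) A"
    using clamp01_lipschitz assms by (intro energy_lipschitz) auto
  also have "\<dots> \<le> 1 * measure (\<Gamma> f) A"
    using best_lipschitz_clamp01 p_pos by (intro mult_right_mono powr_le1) auto
  finally show ?thesis using p_pos by (auto simp: root_energy_def comp_def intro!: powr_mono2)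
qed

text \<open>On a compact space the constant lies in \<open>Cc_space\<close>, but density only yields
  a nearby \<open>g\<close> in \<open>F\<close>. As \<open>2 * g\<close> is at least 1, truncation
  recovers the constant exactly.\<close>

lemma one_in_F:
  assumes "compact (UNIV :: 'a set)"
  shows "(\<lambda>x. 1) \<in> F"
proof -
  have "(\<lambda>x::'a. 1::real) \<in> Cc_space" using assms by (simp add: Cc_space_def)
  then obtain g where g: "g \<in> Cc_space" "g \<in> F" "(SUP x. \<bar>1 - g x\<bar>) < 1/2"
    using dense_in_Cc[of "\<lambda>x. 1" "1/2"] by auto
  have "1 \<le> 2 * g x" for x
    using Cc_sup_dist[OF \<open>(\<lambda>x. 1) \<in> Cc_space\<close> g(1,3), of x] by linarith
  then have "(\<lambda>x. clamp01 (2 * g x)) = (\<lambda>x. 1)" by simp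
  then show ?thesis using clamp_in_F[OF scale_in_F[OF g(2), of 2]] by simp
qed

text \<open>A capacity competitor is 0 on the small ball and 1 outside the large one, so the cut-off
  function is a truncation of 1 minus it; constants carry no energy. The infimum need not be
  attained, and since \<open>q\<close> is positive, \<open>2 * q\<close> leaves room for a
  competitor.\<close>

lemma cutoff_exists:
  assumes one: "(\<lambda>x. 1) \<in> F" and a: "1 < a" and s: "0 < s" and c: "0 < c" and \<Psi>: "0 < \<Psi> s"
    and cap: "capacity M E F (ball x s) (- ball x (a * s)) \<le> ennreal c * emeasure M (ball x s) / ennreal (\<Psi> s)"
  obtains \<psi> where "\<psi> \<in> F" "\<And>y. 0 \<le> \<psi> y" "\<And>y. y \<in> ball x s \<Longrightarrow> \<psi> y = 1" "\<And>y. y \<notin> ball x (a * s) \<Longrightarrow> \<psi> y = 0"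
    "E \<psi> \<le> 2 * c / \<Psi> s * measure M (ball x s)"
proof -
  define q where "q = c * measure M (ball x s) / \<Psi> s"
  have q: "0 < q" using c \<Psi> measure_ball_pos[OF s] by (simp add: q_def)
  have "ennreal c * emeasure M (ball x s) / ennreal (\<Psi> s) = ennreal q"
    using c \<Psi> s by (simp add: emeasure_ball q_def divide_ennreal flip: ennreal_mult)
  then have "capacity M E F (ball x s) (- ball x (a * s)) < ennreal (2 * q)"
    using cap q by (intro order_le_less_trans[OF cap]) (simp add: ennreal_less_iff)
  then obtain \<phi> where \<phi>: "\<phi> \<in> F" "AE y in M. y \<in> ball x s \<longrightarrow> \<phi> y = 0"
    "AE y in M. y \<in> - ball x (a * s) \<longrightarrow> \<phi> y = 1" "ennreal (E \<phi>) < ennreal (2 * q)"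
    unfolding capacity_def INF_less_iff by blast
  define w where "w y = clamp01 (1 + (-1) * \<phi> y)" for y
  have w0F: "(\<lambda>y. 1 + (-1) * \<phi> y) \<in> F" by (intro add_in_F one scale_in_F \<phi>)
  then have wF: "w \<in> F" unfolding w_def by (rule clamp_in_F)
  have "root_energy w UNIV \<le> root_energy (\<lambda>y. 1 + (-1) * \<phi> y) UNIV"
    unfolding w_def using w0F by (intro root_energy_clamp) auto
  also have "\<dots> \<le> root_energy (\<lambda>y. 1) UNIV + root_energy (\<lambda>y. (-1) * \<phi> y) UNIV"
    by (intro root_energy_add one scale_in_F \<phi>) auto
  also have "\<dots> = root_energy \<phi> UNIV"
    using root_energy_local[OF one, of UNIV 1] root_energy_scale[OF \<phi>(1), of UNIV "-1"] by simp
  finally have "E w \<le> root_energy \<phi> UNIV powr p"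
    using energy_le_of_root_energy_le energy_total[OF wF] by metis
  then have Ew: "E w \<le> E \<phi>" using root_energy_powr[of \<phi> UNIV] energy_total[OF \<phi>(1)] by simp
  \<comment> \<open>The boundary values hold almost everywhere only. They are enforced at every
    point by a change on a null set, because the partition of unity is to be exact.\<close>
  define \<psi> where "\<psi> y = (if y \<in> ball x s then 1 else if y \<in> ball x (a * s) then w y else 0)" for y
  have wm: "w \<in> borel_measurable M" using wF F_subset_Lp by (auto simp: Lp_space_def)
  have \<psi>m: "\<psi> \<in> borel_measurable M"
    unfolding \<psi>_def by (intro measurable_If_set wm) (auto simp: space_M)
  have ae: "AE y in M. w y = \<psi> y"
    using \<phi>(2,3) by eventually_elim (use a s in \<open>auto simp: \<psi>_def w_def intro: mult_left_mono order_less_le_trans\<close>)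
  note \<psi>F = ae_closed[OF wF \<psi>m ae]
  show thesis
  proof
    show "\<psi> \<in> F" using \<psi>F by simp
    show "0 \<le> \<psi> y" for y by (simp add: \<psi>_def w_def)
    show "\<psi> y = 1" if "y \<in> ball x s" for y using that by (simp add: \<psi>_def)
    show "\<psi> y = 0" if y: "y \<notin> ball x (a * s)" for y
    proof -
      have "s \<le> a * s" using a s by simp
      then have "y \<notin> ball x s" using y by auto
      then show ?thesis using y unfolding \<psi>_def by presburger
    qed
    have "E \<phi> \<le> 2 * q" using \<phi>(4) q by (metis ennreal_le_iff less_imp_le mult_pos_pos zero_less_numeral)
    then show "E \<psi> \<le> 2 * c / \<Psi> s * measure M (ball x s)" using \<psi>F Ew by (simp add: q_def)
  qed
qed

text \<open>Products being unavailable in \<open>F\<close>, the partition of unity subordinate to the cover is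
  obtained by differencing the truncated partial sums of the cut-off functions.\<close>

lemma discrete_convolution:
  fixes x :: "nat \<Rightarrow> 'a" and \<psi> :: "nat \<Rightarrow> 'a \<Rightarrow> real"
  assumes one: "(\<lambda>x. 1) \<in> F" and a: "1 < a" and s: "0 < s" and q: "0 \<le> q"
    and cover: "\<And>y. \<exists>j<N. dist (x j) y < s"
    and sep: "\<And>i j. i < N \<Longrightarrow> j < N \<Longrightarrow> i \<noteq> j \<Longrightarrow> s \<le> dist (x i) (x j)"
    and inj: "inj_on x {..<N}"
    and \<psi>F: "\<And>j. j < N \<Longrightarrow> \<psi> j \<in> F" and \<psi>0: "\<And>j y. j < N \<Longrightarrow> 0 \<le> \<psi> j y"
    and \<psi>1: "\<And>j y. j < N \<Longrightarrow> y \<in> ball (x j) s \<Longrightarrow> \<psi> j y = 1"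
    and \<psi>out: "\<And>j y. j < N \<Longrightarrow> y \<notin> ball (x j) (a * s) \<Longrightarrow> \<psi> j y = 0"
    and \<psi>E: "\<And>j. j < N \<Longrightarrow> E (\<psi> j) \<le> q * measure M (ball (x j) s)"
    and k: "4 * a + 6 \<le> 2 ^ k"
    and v: "\<And>y z. dist y z < (a + 2) * s \<Longrightarrow> \<bar>v y - v z\<bar> \<le> g y * dist y z"
    and g: "\<And>y. 0 \<le> g y" "g \<in> borel_measurable borel"
  shows "\<exists>f\<in>F. ennreal (E f) \<le> ennreal ((2 * (C ^ k)\<^sup>2 * (a + 2)) powr p * C ^ k * q * s powr p) * (\<integral>\<^sup>+y. ennreal (g y powr p) \<partial>M)
    \<and> (\<forall>y c. (\<forall>z. dist y z < a * s \<longrightarrow> v z = c) \<longrightarrow> f y = c)"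
proof -
  \<comment> \<open>The indices for which \<open>ball (x i) (a * s)\<close> can meet
    \<open>ball (x j) s\<close>; all other cut-off functions vanish on \<open>B j\<close> and have
    no energy there.\<close>
  define nb where "nb j = {i. i < N \<and> dist (x j) (x i) < (a + 1) * s}" for j
  define B where "B j = ball (x j) s" for j
  define m where "m j = measure M (ball (x j) (s/2))" for j
  \<comment> \<open>A bound for the root energy on \<open>B j\<close> of each neighbouring cut-off
    function. It uses the volume of the half ball because the half balls around the net are
    disjoint, and the final estimate is integrated over them.\<close>
  define Q where "Q j = (q * C ^ k * m j) powr (1/p)" for j
  define S where "S n y = clamp01 (\<Sum>i<n. 1 * \<psi> i y)" for n y
  define \<eta> where "\<eta> n y = S (Suc n) y + (-1) * S n y" for n y
  define f where "f y = (\<Sum>i<N. v (x i) * \<eta> i y)" for y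
  define n where "n = C ^ k"
  have n: "1 \<le> n" using C_gt_1 by (simp add: n_def)
  have m: "0 < m j" for j unfolding m_def using s by (intro measure_ball_pos) auto
  have oB: "open (B j)" and bB: "B j \<in> sets borel" for j by (auto simp: B_def)
  have as: "s < a * s" using a s by simp
  have fin_nb: "finite (nb j)" for j by (simp add: nb_def)
  have nb_card: "real (card (nb j)) \<le> n" for j
  proof -
    have "real (card (x ` nb j)) \<le> C ^ k"
    proof (rule separated_card_le[of _ "x j" "(a + 1) * s" s])
      \<comment> \<open>The requirement \<open>4 * a + 6 \<le> 2 ^ k\<close> originates here; it
        also covers the volume comparison of neighbouring balls.\<close>
      show "4 * ((a + 1) * s) + 2 * s \<le> 2 ^ k * s"
        using mult_right_mono[OF k, of s] s by (simp add: algebra_simps)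
    qed (use fin_nb sep s a in \<open>auto simp: nb_def\<close>)
    moreover have "card (x ` nb j) = card (nb j)"
      using inj by (intro card_image) (auto simp: nb_def inj_on_def)
    ultimately show ?thesis by (simp add: n_def)
  qed
  have far: "y \<notin> ball (x i) (a * s)" if "i < N" "i \<notin> nb j" "y \<in> B j" for i j y
    using that dist_triangle[of "x j" "x i" y] by (auto simp: nb_def B_def dist_commute algebra_simps)
  have \<psi>B: "root_energy (\<psi> i) (B j) \<le> (if i \<in> nb j then Q j else 0)" if i: "i < N" for i j
  proof (cases "i \<in> nb j")
    case True
    interpret G: finite_measure "\<Gamma> (\<psi> i)" using energy_finite[OF \<psi>F[OF i]] .
    have "measure M (ball (x i) s) \<le> C ^ k * measure M (ball (x j) (s/2))"
    proof (rule measure_ball_compare)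
      have "dist (x i) (x j) + s \<le> (a + 2) * s" using True by (simp add: nb_def dist_commute algebra_simps)
      also have "\<dots> \<le> (2 ^ k / 2) * s" using k s a by (intro mult_right_mono) auto
      finally show "dist (x i) (x j) + s \<le> 2 ^ k * (s/2)" by simp
    qed (use s in simp)
    then have "q * measure M (ball (x i) s) \<le> q * C ^ k * m j"
      using q by (simp add: m_def mult.assoc mult_left_mono)
    moreover have "measure (\<Gamma> (\<psi> i)) (B j) \<le> measure (\<Gamma> (\<psi> i)) UNIV"
      using energy_sets[OF \<psi>F[OF i]] bB by (intro G.finite_measure_mono) auto
    ultimately have "measure (\<Gamma> (\<psi> i)) (B j) \<le> q * C ^ k * m j"
      using \<psi>E[OF i] energy_total[OF \<psi>F[OF i]] by linarith
    then show ?thesis using True p_pos by (auto simp: root_energy_def Q_def intro!: powr_mono2)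
  next
    case False
    then show ?thesis using root_energy_local[OF \<psi>F[OF i] oB, of j 0] far[OF i] \<psi>out[OF i] by simp
  qed
  have sumF: "(\<lambda>y. \<Sum>i<l. 1 * \<psi> i y) \<in> F" if "l \<le> N" for l
    using that \<psi>F by (intro sum_in_F) auto
  have SF: "S l \<in> F" if "l \<le> N" for l unfolding S_def by (rule clamp_in_F[OF sumF[OF that]])
  have SB: "root_energy (S l) (B j) \<le> n * Q j" if l: "l \<le> N" for l j
  proof -
    have "root_energy (S l) (B j) \<le> root_energy (\<lambda>y. \<Sum>i<l. 1 * \<psi> i y) (B j)"
      unfolding S_def by (rule root_energy_clamp[OF sumF[OF l] bB])
    also have "\<dots> \<le> (\<Sum>i<l. \<bar>1\<bar> * root_energy (\<psi> i) (B j))"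
      using l \<psi>F bB by (intro root_energy_sum) auto
    also have "\<dots> \<le> (\<Sum>i<N. if i \<in> nb j then Q j else 0)"
    proof -
      have "(\<Sum>i<l. \<bar>1\<bar> * root_energy (\<psi> i) (B j)) \<le> (\<Sum>i<l. if i \<in> nb j then Q j else 0)"
        using \<psi>B l by (intro sum_mono) auto
      also have "\<dots> \<le> (\<Sum>i<N. if i \<in> nb j then Q j else 0)"
        using l by (intro sum_mono2) (auto simp: Q_def)
      finally show ?thesis .
    qed
    also have "\<dots> = real (card (nb j)) * Q j"
    proof -
      have "{..<N} \<inter> {i. i \<in> nb j} = nb j" by (auto simp: nb_def)
      then show ?thesis by (simp add: sum.If_cases)
    qed
    also have "\<dots> \<le> n * Q j" using nb_card by (intro mult_right_mono) (auto simp: Q_def)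
    finally show ?thesis .
  qed
  have \<eta>F: "\<eta> i \<in> F" if "i < N" for i unfolding \<eta>_def using that by (intro add_in_F scale_in_F SF) auto
  have \<eta>B: "root_energy (\<eta> i) (B j) \<le> 2 * n * Q j" if i: "i < N" for i j
  proof -
    have "root_energy (\<eta> i) (B j) \<le> root_energy (S (Suc i)) (B j) + root_energy (\<lambda>y. (-1) * S i y) (B j)"
      unfolding \<eta>_def using i bB by (intro root_energy_add scale_in_F SF) auto
    also have "root_energy (\<lambda>y. (-1) * S i y) (B j) = root_energy (S i) (B j)"
      using i bB by (subst root_energy_scale) (auto intro: SF)
    finally show ?thesis using SB[of "Suc i" j] SB[of i j] i by simp
  qed
  have \<eta>0: "\<eta> i y = 0" if "i < N" "y \<notin> ball (x i) (a * s)" for i y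
    using \<psi>out[OF that] by (simp add: \<eta>_def S_def)
  have \<eta>sum: "(\<Sum>i<N. \<eta> i y) = 1" for y
  proof -
    have "(\<Sum>i<l. \<eta> i y) = S l y" for l by (induction l) (auto simp: \<eta>_def S_def)
    moreover have "1 \<le> (\<Sum>i<N. 1 * \<psi> i y)"
    proof -
      obtain j where j: "j < N" "dist (x j) y < s" using cover by blast
      have "\<psi> j y \<le> (\<Sum>i<N. \<psi> i y)" using j \<psi>0 by (intro member_le_sum) auto
      then show ?thesis using \<psi>1[of j y] j by simp
    qed
    ultimately show ?thesis by (simp add: S_def)
  qed
  have fF: "f \<in> F" unfolding f_def using \<eta>F by (intro sum_in_F) auto
  interpret Gf: finite_measure "\<Gamma> f" using energy_finite[OF fF] .
  have f_const: "f y = c" if c: "\<And>z. dist y z < a * s \<Longrightarrow> v z = c" for y c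
  proof -
    have "f y = (\<Sum>i<N. c * \<eta> i y)"
      unfolding f_def
    proof (rule sum.cong)
      fix i assume i: "i \<in> {..<N}"
      show "v (x i) * \<eta> i y = c * \<eta> i y"
      proof (cases "y \<in> ball (x i) (a * s)")
        case True
        then show ?thesis using c[of "x i"] by (simp add: dist_commute)
      next
        case False
        then show ?thesis using \<eta>0[of i y] i by simp
      qed
    qed simp
    also have "\<dots> = c" using \<eta>sum[of y] by (simp flip: sum_distrib_left)
    finally show ?thesis .
  qed
  define K where "K = (2 * n\<^sup>2 * (a + 2)) powr p * n * q * s powr p"
  have K: "0 \<le> K" using n q by (simp add: K_def)
  \<comment> \<open>The estimate holds with \<open>g y\<close> for every \<open>y\<close> in the
    half ball, so it may be averaged over \<open>y\<close>. This replaces values of \<open>g\<close>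
    at the net points by an integral, without any regularity of \<open>g\<close>.\<close>
  have block: "ennreal (measure (\<Gamma> f) (B j)) \<le> (\<integral>\<^sup>+y\<in>ball (x j) (s/2). ennreal (K * g y powr p) \<partial>M)" if j: "j < N" for j
  proof -
    have pt: "measure (\<Gamma> f) (B j) \<le> K * g y powr p * m j" if y: "y \<in> ball (x j) (s/2)" for y
    proof -
      define D where "D = (a + 2) * s * g y"
      have D0: "0 \<le> D" using a s g(1)[of y] by (simp add: D_def)
      have osc: "\<bar>v (x i) - v (x j)\<bar> \<le> D" if i: "i \<in> nb j" for i
      proof -
        have dj: "dist y (x j) < s/2" using y by (simp add: dist_commute)
        have di: "dist y (x i) < (a + 1) * s + s/2"
          using dist_triangle[of y "x i" "x j"] dj i by (simp add: nb_def)
        have lt: "dist y (x i) < (a + 2) * s" "dist y (x j) < (a + 2) * s"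
          using di dj s a by (auto simp: algebra_simps) (smt (verit) mult_pos_pos)
        have "\<bar>v (x i) - v (x j)\<bar> \<le> \<bar>v y - v (x i)\<bar> + \<bar>v y - v (x j)\<bar>" by linarith
        also have "\<dots> \<le> g y * dist y (x i) + g y * dist y (x j)" using v[OF lt(1)] v[OF lt(2)] by linarith
        also have "\<dots> = g y * (dist y (x i) + dist y (x j))" by (simp add: distrib_left)
        also have "\<dots> \<le> g y * ((a + 2) * s)" using di dj g(1)[of y] by (intro mult_left_mono) (auto simp: algebra_simps)
        finally show ?thesis by (simp add: D_def mult.commute)
      qed
      \<comment> \<open>Since the \<open>\<eta> i\<close> sum to 1, subtracting the constant
        \<open>v (x j)\<close> leaves only differences over neighbouring net points, each at most
        \<open>D\<close>. One factor \<open>n\<close> counts neighbours here, the other counts the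
        cut-off functions in a partial sum; the 2 comes from the differencing.\<close>
      have feq: "f = (\<lambda>y. (\<Sum>i<N. (v (x i) - v (x j)) * \<eta> i y) + v (x j) * 1)"
      proof
        fix y
        show "f y = (\<Sum>i<N. (v (x i) - v (x j)) * \<eta> i y) + v (x j) * 1"
          using \<eta>sum[of y] by (simp add: f_def left_diff_distrib sum_subtractf flip: sum_distrib_left)
      qed
      have "root_energy f (B j) \<le> root_energy (\<lambda>y. \<Sum>i<N. (v (x i) - v (x j)) * \<eta> i y) (B j) + root_energy (\<lambda>y. v (x j) * 1) (B j)"
        unfolding feq using \<eta>F one bB by (intro root_energy_add sum_in_F scale_in_F) auto
      also have "root_energy (\<lambda>y. v (x j) * 1) (B j) = 0"
        using root_energy_local[OF scale_in_F[OF one, of "v (x j)"] oB, of j "v (x j)"] by simp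
      also have "root_energy (\<lambda>y. \<Sum>i<N. (v (x i) - v (x j)) * \<eta> i y) (B j) \<le>
          (\<Sum>i<N. \<bar>v (x i) - v (x j)\<bar> * root_energy (\<eta> i) (B j))"
        using \<eta>F bB by (intro root_energy_sum) auto
      also have "\<dots> \<le> (\<Sum>i<N. if i \<in> nb j then D * (2 * n * Q j) else 0)"
      proof (rule sum_mono)
        fix i assume i: "i \<in> {..<N}"
        show "\<bar>v (x i) - v (x j)\<bar> * root_energy (\<eta> i) (B j) \<le> (if i \<in> nb j then D * (2 * n * Q j) else 0)"
        proof (cases "i \<in> nb j")
          case True
          have "\<bar>v (x i) - v (x j)\<bar> * root_energy (\<eta> i) (B j) \<le> D * (2 * n * Q j)"
            using osc[OF True] \<eta>B[of i j] i D0 by (intro mult_mono) auto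
          then show ?thesis using True by simp
        next
          case False
          have "root_energy (\<eta> i) (B j) = 0"
            using root_energy_local[OF \<eta>F oB, of i j 0] far[of i j] \<eta>0[of i] False i by auto
          then show ?thesis using False by simp
        qed
      qed
      also have "\<dots> = real (card (nb j)) * (D * (2 * n * Q j))"
      proof -
        have "{..<N} \<inter> {i. i \<in> nb j} = nb j" by (auto simp: nb_def)
        then show ?thesis by (simp add: sum.If_cases)
      qed
      also have "\<dots> \<le> n * (D * (2 * n * Q j))"
        using nb_card[of j] D0 n by (intro mult_right_mono mult_nonneg_nonneg) (auto simp: Q_def)
      finally have "root_energy f (B j) \<le> (2 * n\<^sup>2) * D * Q j" by (simp add: power2_eq_square mult_ac)
      then have "measure (\<Gamma> f) (B j) \<le> ((2 * n\<^sup>2) * D * Q j) powr p" by (rule energy_le_of_root_energy_le)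
      also have "(2 * n\<^sup>2) * D = (2 * n\<^sup>2 * (a + 2)) * s * g y" by (simp add: D_def mult_ac)
      also have "((2 * n\<^sup>2 * (a + 2)) * s * g y * Q j) powr p = (2 * n\<^sup>2 * (a + 2)) powr p * s powr p * g y powr p * (Q j powr p)"
        by (simp only: powr_mult)
      also have "Q j powr p = q * n * m j"
        using q n m[of j] p_pos by (simp add: Q_def powr_powr n_def)
      finally show ?thesis by (simp add: K_def mult_ac)
    qed
    have "ennreal (measure (\<Gamma> f) (B j)) = (\<integral>\<^sup>+y\<in>ball (x j) (s/2). ennreal (measure (\<Gamma> f) (B j) / m j) \<partial>M)"
    proof -
      have "(\<integral>\<^sup>+y\<in>ball (x j) (s/2). ennreal (measure (\<Gamma> f) (B j) / m j) \<partial>M) = ennreal (measure (\<Gamma> f) (B j) / m j) * emeasure M (ball (x j) (s/2))"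
        by (rule nn_integral_cmult_indicator) simp
      also have "emeasure M (ball (x j) (s/2)) = ennreal (m j)" using s by (simp add: emeasure_ball m_def)
      also have "ennreal (measure (\<Gamma> f) (B j) / m j) * ennreal (m j) = ennreal (measure (\<Gamma> f) (B j))"
        using m[of j] by (simp flip: ennreal_mult)
      finally show ?thesis ..
    qed
    also have "\<dots> \<le> (\<integral>\<^sup>+y\<in>ball (x j) (s/2). ennreal (K * g y powr p) \<partial>M)"
    proof (intro nn_integral_mono)
      fix y
      show "ennreal (measure (\<Gamma> f) (B j) / m j) * indicator (ball (x j) (s/2)) y \<le> ennreal (K * g y powr p) * indicator (ball (x j) (s/2)) y"
        using pt[of y] m[of j] by (auto simp: pos_divide_le_eq intro!: ennreal_leI split: split_indicator)
    qed
    finally show ?thesis .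
  qed
  have "(\<Union>j<N. B j) = UNIV"
  proof -
    have "y \<in> (\<Union>j<N. B j)" for y using cover[of y] unfolding B_def by force
    then show ?thesis by blast
  qed
  then have "E f = measure (\<Gamma> f) (\<Union>j<N. B j)" using energy_total[OF fF] by simp
  also have "\<dots> \<le> (\<Sum>j<N. measure (\<Gamma> f) (B j))"
    using bB energy_sets[OF fF] by (intro Gf.finite_measure_subadditive_finite) auto
  finally have "ennreal (E f) \<le> (\<Sum>j<N. ennreal (measure (\<Gamma> f) (B j)))" by (simp add: ennreal_leI)
  also have "\<dots> \<le> (\<Sum>j<N. \<integral>\<^sup>+y\<in>ball (x j) (s/2). ennreal (K * g y powr p) \<partial>M)" using block by (intro sum_mono) auto
  also have "\<dots> = (\<integral>\<^sup>+y. (\<Sum>j<N. ennreal (K * g y powr p) * indicator (ball (x j) (s/2)) y) \<partial>M)"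
  proof (rule nn_integral_sum[symmetric])
    note g(2)[measurable]
    have [measurable_cong]: "sets M = sets borel" by (rule sets_M)
    show "(\<lambda>y. ennreal (K * g y powr p) * indicator (ball (x j) (s/2)) y) \<in> borel_measurable M" for j
      by measurable
  qed
  also have "\<dots> \<le> (\<integral>\<^sup>+y. ennreal K * ennreal (g y powr p) \<partial>M)"
  proof (intro nn_integral_mono)
    fix y
    \<comment> \<open>Half balls around an \<open>s\<close>-separated net do not overlap, so the
      local estimates add up without a multiplicity factor.\<close>
    have disj: "disjoint_family_on (\<lambda>j. ball (x j) (s/2)) {..<N}"
    proof (unfold disjoint_family_on_def, intro ballI impI)
      fix i j assume ij: "i \<in> {..<N}" "j \<in> {..<N}" "i \<noteq> j"
      have "w \<notin> ball (x i) (s/2) \<inter> ball (x j) (s/2)" for w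
        using sep[of i j] ij dist_triangle[of "x i" "x j" w] by (auto simp: dist_commute)
      then show "ball (x i) (s/2) \<inter> ball (x j) (s/2) = {}" by blast
    qed
    have "(\<Sum>j<N. indicator (ball (x j) (s/2)) y) = (indicator (\<Union>j<N. ball (x j) (s/2)) y :: ennreal)"
      using disj by (intro indicator_UN_disjoint[symmetric]) auto
    also have "\<dots> \<le> 1" by (auto split: split_indicator)
    finally have "ennreal (K * g y powr p) * (\<Sum>j<N. indicator (ball (x j) (s/2)) y) \<le> ennreal (K * g y powr p) * 1"
      by (rule mult_left_mono) simp
    then show "(\<Sum>j<N. ennreal (K * g y powr p) * indicator (ball (x j) (s/2)) y) \<le> ennreal K * ennreal (g y powr p)"
      using K by (simp add: ennreal_mult flip: sum_distrib_left)
  qed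
  also have "\<dots> = ennreal K * (\<integral>\<^sup>+y. ennreal (g y powr p) \<partial>M)"
    using g(2) by (intro nn_integral_cmult) (simp add: borel_M)
  finally show ?thesis using fF f_const by (intro bexI[of _ f]) (auto simp: K_def n_def)
qed

text \<open>Whatever the mean \<open>t\<close> is, it differs by at least 1/2 from the value 1 or
  from the value 0, hence from \<open>f\<close> on one of the two balls. The Poincare inequality is
  applied at a radius whose ball is the whole space.\<close>

lemma energy_lower_bound:
  assumes PI: "poincare_inequality p \<Psi> M F \<Gamma>" and pos: "\<And>r. 0 < r \<Longrightarrow> 0 < \<Psi> r"
    and R: "0 < R" "\<And>x y :: 'a. dist x y < R" and r: "0 < r1" "0 < r2"
  obtains \<kappa> where "0 < \<kappa>"
    "\<And>f. f \<in> F \<Longrightarrow> (\<And>y. y \<in> ball x1 r1 \<Longrightarrow> f y = 1) \<Longrightarrow> (\<And>y. y \<in> ball x2 r2 \<Longrightarrow> f y = 0) \<Longrightarrow> \<kappa> \<le> E f"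
proof -
  obtain c a where c: "0 < c" and
    PI: "\<And>x r u. 0 < r \<Longrightarrow> u \<in> F \<Longrightarrow> (\<integral>\<^sup>+y\<in>ball x r. ennreal (\<bar>u y - set_average M (ball x r) u\<bar> powr p) \<partial>M)
          \<le> ennreal (c * \<Psi> r) * emeasure (\<Gamma> u) (ball x (a * r))"
    using PI unfolding poincare_inequality_def by blast
  define m where "m = min (measure M (ball x1 r1)) (measure M (ball x2 r2))"
  have m: "0 < m" using measure_ball_pos r by (simp add: m_def)
  define b where "b = c * \<Psi> R"
  have b: "0 < b" using c pos[OF R(1)] by (simp add: b_def)
  show thesis
  proof
    show "0 < (1/2) powr p * m / b" using m b by simp
    fix f assume f: "f \<in> F" "\<And>y. y \<in> ball x1 r1 \<Longrightarrow> f y = 1" "\<And>y. y \<in> ball x2 r2 \<Longrightarrow> f y = 0"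
    interpret G: finite_measure "\<Gamma> f" using energy_finite[OF f(1)] .
    define t where "t = set_average M (ball x1 R) f"
    have U: "ball x1 R = UNIV" using R(2) by auto
    have lower: "ennreal ((1/2) powr p * m) \<le> (\<integral>\<^sup>+y\<in>ball x1 R. ennreal (\<bar>f y - t\<bar> powr p) \<partial>M)"
      if B: "0 < r" "m \<le> measure M (ball z r)" "\<And>y. y \<in> ball z r \<Longrightarrow> 1/2 \<le> \<bar>f y - t\<bar>" for z r
    proof -
      have "ennreal ((1/2) powr p * m) \<le> ennreal ((1/2) powr p * measure M (ball z r))"
        using B(2) by (intro ennreal_leI mult_left_mono) auto
      also have "\<dots> = ennreal ((1/2) powr p) * emeasure M (ball z r)"
        using B(1) by (simp add: emeasure_ball ennreal_mult)
      also have "\<dots> = (\<integral>\<^sup>+y\<in>ball z r. ennreal ((1/2) powr p) \<partial>M)"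
        by (rule nn_integral_cmult_indicator[symmetric]) simp
      also have "\<dots> \<le> (\<integral>\<^sup>+y\<in>ball x1 R. ennreal (\<bar>f y - t\<bar> powr p) \<partial>M)"
        unfolding U
      proof (intro nn_integral_mono)
        fix y
        show "ennreal ((1/2) powr p) * indicator (ball z r) y \<le> ennreal (\<bar>f y - t\<bar> powr p) * indicator UNIV y"
          using B(3)[of y] p_pos by (cases "y \<in> ball z r") (auto intro!: ennreal_leI powr_mono2)
      qed
      finally show ?thesis .
    qed
    have "ennreal ((1/2) powr p * m) \<le> (\<integral>\<^sup>+y\<in>ball x1 R. ennreal (\<bar>f y - t\<bar> powr p) \<partial>M)"
    proof (cases "t \<le> 1/2")
      case True
      then show ?thesis using f(2) r by (intro lower[of r1 x1]) (auto simp: m_def)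
    next
      case False
      then show ?thesis using f(3) r by (intro lower[of r2 x2]) (auto simp: m_def)
    qed
    also have "\<dots> \<le> ennreal b * emeasure (\<Gamma> f) (ball x1 (a * R))"
      unfolding t_def b_def by (rule PI[OF R(1) f(1)])
    also have "\<dots> \<le> ennreal b * emeasure (\<Gamma> f) UNIV"
      using energy_sets[OF f(1)] by (intro mult_left_mono emeasure_mono) auto
    also have "\<dots> = ennreal (b * E f)"
      using b E_nonneg[OF f(1)] energy_total[OF f(1)] by (simp add: G.emeasure_eq_measure ennreal_mult)
    finally have "(1/2) powr p * m \<le> b * E f" using b E_nonneg[OF f(1)] by (simp add: ennreal_le_iff)
    then show "(1/2) powr p * m / b \<le> E f" using b by (simp add: pos_divide_le_eq mult.commute)
  qed
qed

text \<open>Feeds \<open>discrete_convolution\<close> with a maximal \<open>s\<close>-separated net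
  and capacitary cut-off functions. Their energy is inversely proportional to
  \<open>\<Psi> s\<close>, while the oscillation of \<open>v\<close> over neighbouring balls is
  proportional to \<open>s\<close>.\<close>

lemma energy_of_gradient:
  fixes z w :: 'a
  assumes comp: "compact (UNIV :: 'a set)"
    and R: "0 < R" "\<And>x y :: 'a. dist x y < R"
    and pos: "\<And>r. 0 < r \<Longrightarrow> 0 < \<Psi> r" and c: "0 < c" and a: "1 < a"
    and cap: "\<And>x r. 0 < r \<Longrightarrow> - ball x (a * r) \<noteq> {} \<Longrightarrow>
        capacity M E F (ball x r) (- ball x (a * r)) \<le> ennreal c * emeasure M (ball x r) / ennreal (\<Psi> r)"
    and k: "4 * a + 6 \<le> 2 ^ k"
    and s: "0 < s" "2 * (a * s) \<le> dist z w"
    and v: "\<And>x y. dist x y < (a + 2) * s \<Longrightarrow> \<bar>v x - v y\<bar> \<le> g x * dist x y"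
    and g: "\<And>x. 0 \<le> g x" "g \<in> borel_measurable borel"
  defines "K \<equiv> (2 * (C ^ k)\<^sup>2 * (a + 2)) powr p * C ^ k * (2 * c)"
  shows "\<exists>f\<in>F. ennreal (E f) \<le> ennreal (K * (s powr p / \<Psi> s)) * (\<integral>\<^sup>+y. ennreal (g y powr p) \<partial>M) \<and>
         (\<forall>y t. (\<forall>z. dist y z < a * s \<longrightarrow> v z = t) \<longrightarrow> f y = t)"
proof -
  have one: "(\<lambda>x. 1) \<in> F" using one_in_F[OF comp] .
  obtain S :: "'a set" where S: "finite S" "\<And>y z. y \<in> S \<Longrightarrow> z \<in> S \<Longrightarrow> y \<noteq> z \<Longrightarrow> s \<le> dist y z"
    "\<And>y. \<exists>x\<in>S. dist x y < s"
    using finite_net[OF R s(1)] by blast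
  \<comment> \<open>Differencing partial sums needs a linear order on the net.\<close>
  obtain x where x: "bij_betw x {0..<card S} S" using ex_bij_betw_nat_finite[OF S(1)] by blast
  have inj: "inj_on x {..<card S}" and img: "x ` {..<card S} = S"
    using x by (auto simp: bij_betw_def lessThan_atLeast0)
  \<comment> \<open>No ball of radius \<open>a * s\<close> contains both \<open>z\<close> and
    \<open>w\<close>, so the capacity bound is never vacuous at this scale.\<close>
  have ne: "- ball y (a * s) \<noteq> {}" for y :: 'a
  proof
    assume "- ball y (a * s) = {}"
    then have "z \<in> ball y (a * s)" "w \<in> ball y (a * s)" by auto
    then show False using dist_triangle[of z w y] s(2) by (simp add: dist_commute)
  qed
  have "\<exists>\<psi>. \<psi> \<in> F \<and> (\<forall>y. 0 \<le> \<psi> y) \<and> (\<forall>y\<in>ball (x j) s. \<psi> y = 1) \<and> (\<forall>y. y \<notin> ball (x j) (a * s) \<longrightarrow> \<psi> y = 0) \<and>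
    E \<psi> \<le> 2 * c / \<Psi> s * measure M (ball (x j) s)" for j
    by (rule cutoff_exists[where \<Psi> = \<Psi>, OF one a s(1) c pos[OF s(1)] cap[OF s(1) ne, of "x j"]]) blast
  then obtain \<psi> where \<psi>: "\<And>j. \<psi> j \<in> F" "\<And>j y. 0 \<le> \<psi> j y" "\<And>j y. y \<in> ball (x j) s \<Longrightarrow> \<psi> j y = 1"
    "\<And>j y. y \<notin> ball (x j) (a * s) \<Longrightarrow> \<psi> j y = 0" "\<And>j. E (\<psi> j) \<le> 2 * c / \<Psi> s * measure M (ball (x j) s)"
    by metis
  have "\<exists>f\<in>F. ennreal (E f) \<le> ennreal ((2 * (C ^ k)\<^sup>2 * (a + 2)) powr p * C ^ k * (2 * c / \<Psi> s) * s powr p) * (\<integral>\<^sup>+y. ennreal (g y powr p) \<partial>M)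
    \<and> (\<forall>y t. (\<forall>z. dist y z < a * s \<longrightarrow> v z = t) \<longrightarrow> f y = t)"
  proof (rule discrete_convolution[OF one a s(1), where x = x and N = "card S" and \<psi> = \<psi>])
    show "0 \<le> 2 * c / \<Psi> s" using c pos[OF s(1)] by simp
    show "\<exists>j<card S. dist (x j) y < s" for y
    proof -
      obtain u where u: "u \<in> S" "dist u y < s" using S(3)[of y] by blast
      have "u \<in> x ` {..<card S}" using u(1) by (simp only: img)
      then show ?thesis using u(2) by auto
    qed
    show "s \<le> dist (x i) (x j)" if "i < card S" "j < card S" "i \<noteq> j" for i j
      using that img inj by (intro S(2)) (auto simp: inj_on_def)
  qed (use inj \<psi> k v g in auto)
  then show ?thesis by (simp add: K_def)
qed

text \<open>The majorant is taken for the p-th power of \<open>\<rho>\<close>, where the integral is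
  additive, and the root is extracted afterwards. One \<open>e\<close> in the bound is the norm of
  \<open>\<rho>\<close>, the other the loss in the majorant.\<close>

lemma weights_of_admissible:
  assumes fin: "emeasure M UNIV < \<infinity>" and \<delta>: "0 < \<delta>" and e: "0 < e"
    and \<rho>: "\<rho> \<in> borel_measurable borel" "(\<integral>\<^sup>+x. ennreal_powr (\<rho> x) p \<partial>M) \<le> ennreal e"
  shows "\<exists>(\<sigma> :: nat \<Rightarrow> 'a \<Rightarrow> real) L. (\<forall>k x. \<delta> \<le> \<sigma> k x) \<and> (\<forall>k. 0 \<le> L k) \<and>
    (\<forall>k x y. \<bar>\<sigma> k x - \<sigma> k y\<bar> \<le> L k * dist x y) \<and> (\<forall>x. incseq (\<lambda>k. \<sigma> k x)) \<and>
    (\<forall>x. \<rho> x \<le> (SUP k. ennreal (\<sigma> k x))) \<and> (\<forall>k. \<sigma> k \<in> borel_measurable borel) \<and>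
    (\<forall>k. (\<integral>\<^sup>+x. ennreal (\<sigma> k x powr p) \<partial>M) \<le> ennreal (\<delta> powr p * measure M UNIV + 2 * e))"
proof -
  have [measurable_cong]: "sets M = sets borel" by (rule sets_M)
  note \<rho>(1)[measurable]
  have outer: "emeasure M A = (INF U\<in>{U. open U \<and> A \<subseteq> U}. emeasure M U)" if "A \<in> sets borel" for A
    using radon that unfolding radon_measure_def by blast
  have "(\<lambda>x. ennreal_powr (\<rho> x) p) \<in> borel_measurable M" by measurable
  then obtain H where H: "lipschitz_majorant (\<lambda>x. ennreal_powr (\<rho> x) p) H"
    "(\<integral>\<^sup>+x. (SUP n. ennreal (H n x)) \<partial>M) \<le> (\<integral>\<^sup>+x. ennreal_powr (\<rho> x) p \<partial>M) + ennreal e"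
    using lipschitz_majorant_exists[OF sets_M fin outer _ e] by blast
  have Hp: "0 \<le> H n x" "incseq (\<lambda>n. H n x)" "ennreal_powr (\<rho> x) p \<le> (SUP n. ennreal (H n x))" for n x
    using H(1) by (auto simp: lipschitz_majorant_def)
  note [measurable] = lipschitz_majorant_measurable[OF H(1)]
  \<comment> \<open>The summand \<open>\<delta> powr p\<close> gives both the floor
    \<open>\<delta>\<close> and, by \<open>powr_root_lipschitz\<close>, the Lipschitz property of
    the root.\<close>
  define \<sigma> where "\<sigma> k x = (\<delta> powr p + H k x) powr (1/p)" for k x
  have "\<exists>L. L-lipschitz_on UNIV (H n)" for n using H(1) unfolding lipschitz_majorant_def by blast
  then obtain L where L: "\<And>n. (L n)-lipschitz_on UNIV (H n)" by metis
  have L0: "0 \<le> L n" for n using lipschitz_on_nonneg[OF L] .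
  have \<sigma>p: "\<sigma> k x powr p = \<delta> powr p + H k x" for k x
    using Hp(1)[of k x] p_pos by (simp add: \<sigma>_def powr_powr)
  show ?thesis
  proof (intro exI[of _ \<sigma>] exI[of _ "\<lambda>k. \<delta> powr (1 - p) * L k"] conjI allI)
    show "\<delta> \<le> \<sigma> k x" for k x
    proof -
      have "(\<delta> powr p) powr (1/p) \<le> \<sigma> k x" unfolding \<sigma>_def using Hp(1)[of k x] p_pos by (intro powr_mono2) auto
      then show ?thesis using \<delta> p_pos by (simp add: powr_powr)
    qed
    show "0 \<le> \<delta> powr (1 - p) * L k" for k using L0 by simp
    show "\<bar>\<sigma> k x - \<sigma> k y\<bar> \<le> \<delta> powr (1 - p) * L k * dist x y" for k x y
    proof -
      have "\<bar>\<sigma> k x - \<sigma> k y\<bar> \<le> \<delta> powr (1 - p) * \<bar>(\<delta> powr p + H k x) - (\<delta> powr p + H k y)\<bar>"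
        unfolding \<sigma>_def using Hp(1) by (intro powr_root_lipschitz p_ge_1 \<delta>) auto
      also have "\<dots> = \<delta> powr (1 - p) * \<bar>H k x - H k y\<bar>" by simp
      also have "\<dots> \<le> \<delta> powr (1 - p) * (L k * dist x y)"
        using lipschitz_onD[OF L, of x y k] by (intro mult_left_mono) (auto simp: dist_real_def)
      finally show ?thesis by (simp add: mult.assoc)
    qed
    show "incseq (\<lambda>k. \<sigma> k x)" for x
    proof (rule monoI)
      fix m n :: nat assume "m \<le> n"
      then have "H m x \<le> H n x" using Hp(2)[of x] by (simp add: incseq_def)
      then show "\<sigma> m x \<le> \<sigma> n x" unfolding \<sigma>_def using Hp(1)[of m x] p_pos by (intro powr_mono2) auto
    qed
    show "\<rho> x \<le> (SUP k. ennreal (\<sigma> k x))" for x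
    proof -
      have "ennreal_powr (\<rho> x) p \<le> ennreal_powr (SUP k. ennreal (\<sigma> k x)) p"
      proof (rule order_trans[OF Hp(3)], rule SUP_least)
        fix n
        have "ennreal (H n x) \<le> ennreal (\<sigma> n x powr p)" using \<sigma>p[of n x] by (intro ennreal_leI) simp
        also have "\<dots> = ennreal_powr (ennreal (\<sigma> n x)) p" by (simp add: \<sigma>_def)
        also have "\<dots> \<le> ennreal_powr (SUP k. ennreal (\<sigma> k x)) p"
          using p_pos by (intro ennreal_powr_mono SUP_upper) auto
        finally show "ennreal (H n x) \<le> ennreal_powr (SUP k. ennreal (\<sigma> k x)) p" .
      qed
      then have "ennreal_powr (ennreal_powr (\<rho> x) p) (1/p) \<le> ennreal_powr (ennreal_powr (SUP k. ennreal (\<sigma> k x)) p) (1/p)"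
        by (rule ennreal_powr_mono[rotated]) (use p_pos in simp)
      then show ?thesis by (simp only: ennreal_powr_inverse(2)[OF p_pos])
    qed
    show "\<sigma> k \<in> borel_measurable borel" for k unfolding \<sigma>_def by measurable
    show "(\<integral>\<^sup>+x. ennreal (\<sigma> k x powr p) \<partial>M) \<le> ennreal (\<delta> powr p * measure M UNIV + 2 * e)" for k
    proof -
      have "(\<integral>\<^sup>+x. ennreal (\<sigma> k x powr p) \<partial>M) = (\<integral>\<^sup>+x. ennreal (\<delta> powr p) + ennreal (H k x) \<partial>M)"
        using Hp(1) by (intro nn_integral_cong) (simp add: \<sigma>p)
      also have "\<dots> = ennreal (\<delta> powr p) * emeasure M UNIV + (\<integral>\<^sup>+x. ennreal (H k x) \<partial>M)"
        by (subst nn_integral_add) (auto simp: space_M)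
      also have "\<dots> \<le> ennreal (\<delta> powr p) * emeasure M UNIV + (ennreal e + ennreal e)"
      proof (rule add_left_mono)
        have "(\<integral>\<^sup>+x. ennreal (H k x) \<partial>M) \<le> (\<integral>\<^sup>+x. (SUP n. ennreal (H n x)) \<partial>M)"
          by (intro nn_integral_mono SUP_upper) simp
        also have "\<dots> \<le> (\<integral>\<^sup>+x. ennreal_powr (\<rho> x) p \<partial>M) + ennreal e" by (rule H(2))
        also have "\<dots> \<le> ennreal e + ennreal e" using \<rho>(2) by (rule add_right_mono)
        finally show "(\<integral>\<^sup>+x. ennreal (H k x) \<partial>M) \<le> ennreal e + ennreal e" .
      qed
      also have "emeasure M UNIV = ennreal (measure M UNIV)"
        using fin by (intro emeasure_eq_ennreal_measure) auto
      also have "ennreal (\<delta> powr p) * ennreal (measure M UNIV) + (ennreal e + ennreal e) = ennreal (\<delta> powr p * measure M UNIV + 2 * e)"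
        using e by (simp flip: ennreal_mult ennreal_plus)
      finally show ?thesis .
    qed
  qed
qed

text \<open>The same function is shown to have energy at least \<open>\<kappa>\<close>, a number
  fixed before any weight is chosen, and at most a multiple of the p-norm of a weight that vanishing
  modulus makes arbitrarily small.\<close>

lemma modulus_not_vanishing:
  assumes comp: "compact (UNIV :: 'a set)" and fin: "emeasure M UNIV < \<infinity>"
    and PI: "poincare_inequality p \<Psi> M F \<Gamma>" and pos: "\<And>r. 0 < r \<Longrightarrow> 0 < \<Psi> r"
    and cap: "capacity_upper_bound \<Psi> M E F"
    and big: "0 < c0" "0 < s0" "\<And>s. 0 < s \<Longrightarrow> s < s0 \<Longrightarrow> c0 \<le> \<Psi> s / s powr p"
  shows "\<not> vanishing_modulus p M"
proof
  assume vm: "vanishing_modulus p M"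
  obtain x0 x1 :: 'a where x01: "x0 \<noteq> x1" using two_points by blast
  define r where "r = dist x0 x1 / 4"
  have r: "0 < r" "dist x0 x1 = 4 * r" using x01 by (auto simp: r_def)
  obtain R where R: "0 < R" "\<And>x y :: 'a. dist x y < R" using bounded_of_finite_measure[OF fin] by blast
  obtain c a where c: "0 < c" and a: "1 < a" and
    cap: "\<And>x r. 0 < r \<Longrightarrow> - ball x (a * r) \<noteq> {} \<Longrightarrow>
        capacity M E F (ball x r) (- ball x (a * r)) \<le> ennreal c * emeasure M (ball x r) / ennreal (\<Psi> r)"
    using cap unfolding capacity_upper_bound_def by blast
  obtain \<kappa> where \<kappa>: "0 < \<kappa>"
    "\<And>f. f \<in> F \<Longrightarrow> (\<And>y. y \<in> ball x0 (r/2) \<Longrightarrow> f y = 1) \<Longrightarrow> (\<And>y. y \<in> ball x1 r \<Longrightarrow> f y = 0) \<Longrightarrow> \<kappa> \<le> E f"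
    using energy_lower_bound[OF PI pos R, of "r/2" r x0 x1] r by auto
  obtain k :: nat where k: "4 * a + 6 \<le> 2 ^ k" using real_arch_pow[of 2 "4 * a + 6"] by (auto intro: less_imp_le)
  define K where "K = (2 * (C ^ k)\<^sup>2 * (a + 2)) powr p * C ^ k * (2 * c)"
  have "2 * (C ^ k)\<^sup>2 * (a + 2) \<noteq> 0" using C_gt_1 a by simp
  then have "0 < (2 * (C ^ k)\<^sup>2 * (a + 2)) powr p" by (simp only: powr_gt_zero not_False_eq_True)
  then have K: "0 < K" unfolding K_def using C_gt_1 c by (intro mult_pos_pos) auto
  define \<mu> where "\<mu> = measure M UNIV"
  have "measure M (ball x0 R) \<le> \<mu>" using R(2) by (simp add: \<mu>_def ball_def)
  then have \<mu>: "0 < \<mu>" using measure_ball_pos[OF R(1), of x0] by simp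
  \<comment> \<open>With \<open>4 powr p\<close> from the gradient of the cut-off and
    \<open>3 * \<epsilon>\<close> from the weight, the final upper bound is three quarters of
    \<open>\<kappa>\<close>.\<close>
  define \<epsilon> where "\<epsilon> = \<kappa> * c0 / (4 * K * 4 powr p)"
  have \<epsilon>: "0 < \<epsilon>" "K / c0 * (4 powr p * (3 * \<epsilon>)) < \<kappa>"
    using \<kappa>(1) big(1) K by (simp_all add: \<epsilon>_def field_simps)
  \<comment> \<open>The floor alone then contributes exactly \<open>\<epsilon>\<close> to the
    integral of the p-th power.\<close>
  define \<delta> where "\<delta> = (\<epsilon> / \<mu>) powr (1/p)"
  have \<delta>: "0 < \<delta>" "\<delta> powr p * \<mu> = \<epsilon>" using \<epsilon>(1) \<mu> p_pos by (auto simp: \<delta>_def powr_powr)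
  \<comment> \<open>Vanishing modulus is used for the family of all curves, since the limit curve is
    not known in advance.\<close>
  have "modulus p M {c. is_curve c} < ennreal \<epsilon>"
    using vm \<epsilon>(1) unfolding vanishing_modulus_def by (simp add: ennreal_less_zero_iff)
  then obtain \<rho> where \<rho>: "admissible {c. is_curve c} \<rho>" "(\<integral>\<^sup>+x. ennreal_powr (\<rho> x) p \<partial>M) < ennreal \<epsilon>"
    unfolding modulus_def INF_less_iff by auto
  have \<rho>m: "\<rho> \<in> borel_measurable borel" using \<rho>(1) unfolding admissible_def by blast
  obtain \<sigma> :: "nat \<Rightarrow> 'a \<Rightarrow> real" and L where W: "(\<forall>k x. \<delta> \<le> \<sigma> k x) \<and> (\<forall>k. 0 \<le> L k) \<and>
    (\<forall>k x y. \<bar>\<sigma> k x - \<sigma> k y\<bar> \<le> L k * dist x y) \<and> (\<forall>x. incseq (\<lambda>k. \<sigma> k x)) \<and>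
    (\<forall>x. \<rho> x \<le> (SUP k. ennreal (\<sigma> k x))) \<and> (\<forall>k. \<sigma> k \<in> borel_measurable borel) \<and>
    (\<forall>k. (\<integral>\<^sup>+x. ennreal (\<sigma> k x powr p) \<partial>M) \<le> ennreal (\<delta> powr p * measure M UNIV + 2 * \<epsilon>))"
    using weights_of_admissible[OF fin \<delta>(1) \<epsilon>(1) \<rho>m less_imp_le[OF \<rho>(2)]] by (elim exE)
  have \<sigma>: "\<And>k x. \<delta> \<le> \<sigma> k x" "\<And>k. 0 \<le> L k"
    "\<And>k x y. \<bar>\<sigma> k x - \<sigma> k y\<bar> \<le> L k * dist x y" "\<And>x. incseq (\<lambda>k. \<sigma> k x)"
    "\<And>x. \<rho> x \<le> (SUP k. ennreal (\<sigma> k x))" "\<And>k. \<sigma> k \<in> borel_measurable borel"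
    "\<And>k. (\<integral>\<^sup>+x. ennreal (\<sigma> k x powr p) \<partial>M) \<le> ennreal (\<delta> powr p * measure M UNIV + 2 * \<epsilon>)"
    using W by simp_all
  have \<sigma>int: "(\<integral>\<^sup>+x. ennreal (\<sigma> k x powr p) \<partial>M) \<le> ennreal (3 * \<epsilon>)" for k
    using \<sigma>(7)[of k] \<delta>(2) by (simp add: \<mu>_def)
  \<comment> \<open>The first bound keeps the weight comparable at neighbouring points of a chain,
    as \<open>chain_cutoff\<close> demands; the second sends the mesh to 0 for the limit
    curve.\<close>
  define e where "e n = min (\<delta> / (L n + 1)) (1 / real (Suc n))" for n
  have e: "0 < e n" "L n * e n \<le> \<delta>" for n
  proof -
    have L: "0 < L n + 1" using \<sigma>(2)[of n] by simp
    then show "0 < e n" using \<delta>(1) by (simp add: e_def)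
    have "L n * e n \<le> (L n + 1) * (\<delta> / (L n + 1))"
      using \<sigma>(2)[of n] \<delta>(1) L \<open>0 < e n\<close> by (intro mult_mono) (auto simp: e_def)
    then show "L n * e n \<le> \<delta>" using L by simp
  qed
  have e_lim: "e \<longlonglongrightarrow> 0"
  proof (rule tendsto_sandwich[of "\<lambda>_. 0" _ _ "\<lambda>n. 1 / real (Suc n)"])
    show "(\<lambda>n. 1 / real (Suc n)) \<longlonglongrightarrow> 0" using LIMSEQ_Suc[OF lim_const_over_n[of 1]] .
  qed (use e(1) in \<open>auto simp: e_def less_imp_le intro!: always_eventually\<close>)
  \<comment> \<open>Closed sets with a gap: chains from one to the other cannot shrink to a constant
    curve. They contain \<open>ball x0 (r/2)\<close> and \<open>ball x1 r\<close> with a margin of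
    \<open>r/2\<close>, which absorbs the range \<open>a * s\<close> of the convolution.\<close>
  define A where "A = cball x0 r"
  define B where "B = - ball x0 (2 * r)"
  have "\<exists>n. \<not> (\<exists>N z. z 0 \<in> A \<and> z N \<in> B \<and> (\<forall>j<N. dist (z j) (z (Suc j)) < e n) \<and>
       (\<Sum>j<N. \<sigma> n (z j) * dist (z j) (z (Suc j))) \<le> 1/2)"
  proof (rule ccontr)
    assume "\<not> ?thesis"
    then have chains: "\<exists>N z. z 0 \<in> A \<and> z N \<in> B \<and> (\<forall>j<N. dist (z j) (z (Suc j)) < e n) \<and>
       (\<Sum>j<N. \<sigma> n (z j) * dist (z j) (z (Suc j))) \<le> 1/2" for n by blast
    have AB: "closed A" "closed B" "A \<inter> B = {}" using r by (auto simp: A_def B_def)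
    obtain c where "is_curve c" "locally_rectifiable c" "curve_integral \<rho> c \<le> ennreal (1/2)"
      using chain_limit_curve[OF comp \<delta>(1) \<sigma>(1) _ \<sigma>(3,2,4) e(1) e_lim AB chains \<sigma>(5)] by auto
    moreover have "1 \<le> curve_integral \<rho> c"
      using \<rho>(1) calculation(1,2) unfolding admissible_def by blast
    ultimately have "ennreal 1 \<le> ennreal (1/2)" by (metis ennreal_1 order_trans)
    then show False by (subst (asm) ennreal_le_iff) auto
  qed
  then obtain n where n: "\<not> (\<exists>N z. z 0 \<in> A \<and> z N \<in> B \<and> (\<forall>j<N. dist (z j) (z (Suc j)) < e n) \<and>
       (\<Sum>j<N. \<sigma> n (z j) * dist (z j) (z (Suc j))) \<le> 1/2)" by blast
  obtain v :: "'a \<Rightarrow> real" where v: "\<And>x. x \<in> A \<Longrightarrow> v x = 1" "\<And>x. x \<in> B \<Longrightarrow> v x = 0"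
    "\<And>x y. dist x y < e n \<Longrightarrow> \<bar>v x - v y\<bar> \<le> 2 / (1/2) * \<sigma> n x * dist x y"
    using chain_cutoff[OF _ \<sigma>(1,3) \<delta>(1) e \<sigma>(2) n] by auto
  \<comment> \<open>Below \<open>s0\<close> the lower bound on the scale function applies, the
    second term keeps neighbouring net points within the mesh, and the third respects the margin
    \<open>r/2\<close>.\<close>
  define s where "s = min (s0/2) (min (e n / (a + 2)) (r / (2 * a)))"
  have s: "0 < s" "s < s0" "(a + 2) * s \<le> e n" "a * s \<le> r / 2"
  proof -
    show "0 < s" "s < s0" using big(2) e(1)[of n] a r by (auto simp: s_def)
    have "s \<le> e n / (a + 2)" by (simp add: s_def)
    then show "(a + 2) * s \<le> e n" using a by (simp add: pos_le_divide_eq mult.commute)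
    have "s \<le> r / (2 * a)" by (simp add: s_def)
    then show "a * s \<le> r / 2" using a by (simp add: field_simps)
  qed
  have \<sigma>0: "0 \<le> \<sigma> n x" for x using \<sigma>(1)[of n x] \<delta>(1) by linarith
  obtain f where f: "f \<in> F"
    "ennreal (E f) \<le> ennreal (K * (s powr p / \<Psi> s)) * (\<integral>\<^sup>+y. ennreal ((4 * \<sigma> n y) powr p) \<partial>M)"
    "\<And>y t. (\<And>z. dist y z < a * s \<Longrightarrow> v z = t) \<Longrightarrow> f y = t"
  proof -
    have "\<bar>v x - v y\<bar> \<le> 4 * \<sigma> n x * dist x y" if "dist x y < (a + 2) * s" for x y
      using v(3)[of x y] that s(3) by simp
    moreover have "2 * (a * s) \<le> dist x0 x1" using s(4) r by linarith
    moreover have "(\<lambda>x. 4 * \<sigma> n x) \<in> borel_measurable borel" using \<sigma>(6)[of n] by measurable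
    ultimately have "\<exists>f\<in>F. ennreal (E f) \<le> ennreal (K * (s powr p / \<Psi> s)) * (\<integral>\<^sup>+y. ennreal ((4 * \<sigma> n y) powr p) \<partial>M) \<and>
         (\<forall>y t. (\<forall>z. dist y z < a * s \<longrightarrow> v z = t) \<longrightarrow> f y = t)"
      unfolding K_def using \<sigma>0 by (intro energy_of_gradient[OF comp R pos c a cap k s(1)]) auto
    then show thesis using that by blast
  qed
  have "\<kappa> \<le> E f"
  proof (rule \<kappa>(2)[OF f(1)])
    fix y assume y: "y \<in> ball x0 (r/2)"
    show "f y = 1"
    proof (rule f(3), rule v(1))
      fix z assume "dist y z < a * s"
      then show "z \<in> A" using y s(4) dist_triangle[of x0 z y] by (simp add: A_def)
    qed
  next
    fix y assume y: "y \<in> ball x1 r"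
    show "f y = 0"
    proof (rule f(3), rule v(2))
      fix z assume "dist y z < a * s"
      then show "z \<in> B" using y s(4) dist_triangle[of x0 x1 z] dist_triangle[of z x1 y] r
        by (simp add: B_def dist_commute)
    qed
  qed
  moreover have "E f \<le> K / c0 * (4 powr p * (3 * \<epsilon>))"
  proof -
    have "s powr p / \<Psi> s \<le> 1 / c0"
      using big(3)[OF s(1,2)] big(1) pos[OF s(1)] s(1) by (simp add: field_simps)
    then have "K * (s powr p / \<Psi> s) \<le> K / c0"
      using K mult_left_mono[of "s powr p / \<Psi> s" "1 / c0" K] by simp
    then have "ennreal (K * (s powr p / \<Psi> s)) \<le> ennreal (K / c0)" by (rule ennreal_leI)
    moreover have "(\<integral>\<^sup>+y. ennreal ((4 * \<sigma> n y) powr p) \<partial>M) \<le> ennreal (4 powr p * (3 * \<epsilon>))"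
    proof -
      have "(\<integral>\<^sup>+y. ennreal ((4 * \<sigma> n y) powr p) \<partial>M) = (\<integral>\<^sup>+y. ennreal (4 powr p) * ennreal (\<sigma> n y powr p) \<partial>M)"
        by (intro nn_integral_cong) (simp add: powr_mult ennreal_mult)
      also have "\<dots> = ennreal (4 powr p) * (\<integral>\<^sup>+y. ennreal (\<sigma> n y powr p) \<partial>M)"
        using \<sigma>(6)[of n] by (intro nn_integral_cmult) (simp add: borel_M)
      also have "\<dots> \<le> ennreal (4 powr p) * ennreal (3 * \<epsilon>)" by (intro mult_left_mono \<sigma>int) simp
      finally show ?thesis using \<epsilon>(1) by (simp add: ennreal_mult)
    qed
    ultimately have "ennreal (E f) \<le> ennreal (K / c0) * ennreal (4 powr p * (3 * \<epsilon>))"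
      using f(2) by (meson mult_mono order_trans zero_le)
    also have "\<dots> = ennreal (K / c0 * (4 powr p * (3 * \<epsilon>)))"
      using K big(1) \<epsilon>(1) by (intro ennreal_mult[symmetric]) auto
    finally show ?thesis using K big(1) \<epsilon>(1) by (subst (asm) ennreal_le_iff) auto
  qed
  ultimately show False using \<epsilon>(2) by linarith
qed

lemma finite_measure_of_capacity:
  assumes cap: "capacity_upper_bound \<Psi> M E F" and pos: "\<And>r. 0 < r \<Longrightarrow> 0 < \<Psi> r"
  shows "emeasure M UNIV < \<infinity>"
proof -
  obtain c a where c: "0 < c" and a: "1 < a" and
    cap: "\<And>x r. 0 < r \<Longrightarrow> - ball x (a * r) \<noteq> {} \<Longrightarrow>
        capacity M E F (ball x r) (- ball x (a * r)) \<le> ennreal c * emeasure M (ball x r) / ennreal (\<Psi> r)"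
    using cap unfolding capacity_upper_bound_def by blast
  obtain x y :: 'a where xy: "x \<noteq> y" using two_points by blast
  \<comment> \<open>This puts \<open>y\<close> exactly at distance \<open>a * r\<close>, outside the
    open ball, so that the capacity bound says something; a finite capacity then has a
    competitor.\<close>
  define r where "r = dist x y / a"
  have r: "0 < r" "a * r = dist x y" using xy a by (auto simp: r_def)
  let ?B = "ball x (a * r)"
  have "y \<in> - ?B" using r by simp
  then have "capacity M E F (ball x r) (- ?B) \<le> ennreal c * emeasure M (ball x r) / ennreal (\<Psi> r)"
    using r by (intro cap) auto
  also have "\<dots> < top"
    using pos[OF r(1)] c r(1) by (simp add: emeasure_ball divide_ennreal flip: ennreal_mult)
  finally obtain \<phi> where \<phi>: "\<phi> \<in> F" "AE z in M. z \<in> - ?B \<longrightarrow> \<phi> z = 1"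
    unfolding capacity_def INF_less_iff by auto
  have int: "integrable M (\<lambda>z. \<bar>\<phi> z\<bar> powr p)" using \<phi>(1) F_subset_Lp by (auto simp: Lp_space_def)
  have "emeasure M (- ?B) = (\<integral>\<^sup>+z. indicator (- ?B) z \<partial>M)"
    by (rule nn_integral_indicator[symmetric]) (auto simp: sets_M)
  also have "\<dots> \<le> (\<integral>\<^sup>+z. ennreal (\<bar>\<phi> z\<bar> powr p) \<partial>M)"
  proof (rule nn_integral_mono_AE)
    show "AE z in M. indicator (- ?B) z \<le> ennreal (\<bar>\<phi> z\<bar> powr p)"
      using \<phi>(2) by eventually_elim (auto split: split_indicator)
  qed
  also have "\<dots> < \<infinity>" using int by (simp add: integrable_iff_bounded)
  finally have "emeasure M (- ?B) < \<infinity>" .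
  moreover have "emeasure M ?B < \<infinity>" using r a by (intro ball_fin) auto
  moreover have "emeasure M UNIV = emeasure M ?B + emeasure M (- ?B)"
    by (subst plus_emeasure) (auto simp: sets_M)
  ultimately show ?thesis by simp
qed

end

section \<open>Reduction of the hypotheses and conclusion\<close>

lemma doubling_dirichlet_spaceI:
  fixes M :: "'a::metric_space measure"
  assumes "regular_local_dirichlet_space p M E F \<Gamma>" "volume_doubling M"
  obtains C D where "doubling_dirichlet_space p M E F \<Gamma> C D"
proof -
  interpret regular_local_dirichlet_space p M E F \<Gamma> by fact
  obtain C where C: "1 < C" and VD: "\<And>x r. 0 < r \<Longrightarrow> 0 < emeasure M (ball x (2 * r))"
    "\<And>x r. 0 < r \<Longrightarrow> emeasure M (ball x (2 * r)) \<le> ennreal C * emeasure M (ball x r)"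
    "\<And>x r. 0 < r \<Longrightarrow> ennreal C * emeasure M (ball x r) < \<infinity>"
    using assms(2) unfolding volume_doubling_def by blast
  obtain D :: "'a set" where D: "countable D" "closure D = UNIV"
    using separable unfolding separable_space_def by auto
  have "doubling_space M C D"
  proof
    show "sets M = sets borel" using radon by (simp add: radon_measure_def)
    show "emeasure M (ball x r) < \<infinity>" if "0 < r" for x r
      using VD(3)[OF that, of x] C by (auto simp: ennreal_mult_less_top)
    show "0 < emeasure M (ball x r)" if "0 < r" for x r
      using VD(1)[of "r/2" x] that by simp
    show "\<exists>z\<in>D. dist x z < e" if "0 < e" for x and e :: real
      using D(2) that closure_approachable[of x D] by (auto simp: dist_commute)
  qed (use C VD(2) D(1) in auto)
  then have "doubling_dirichlet_space p M E F \<Gamma> C D"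
    using assms(1) by (simp add: doubling_dirichlet_space_def)
  then show thesis by (rule that)
qed

text \<open>A lower bound \<open>\<eta>\<close> on an entire interval to the right of 0 would pass
  to the lower limit.\<close>

lemma Liminf_eq_0_small:
  fixes h :: "real \<Rightarrow> real"
  assumes "Liminf (at_right 0) (\<lambda>r. ereal (h r)) = 0" "0 < \<eta>" "0 < \<delta>"
  shows "\<exists>r. 0 < r \<and> r < \<delta> \<and> h r < \<eta>"
proof (rule ccontr)
  assume "\<not> ?thesis"
  then have "\<eta> \<le> h r" if "0 < r" "r < \<delta>" for r using that by (meson not_less)
  then have "eventually (\<lambda>r. ereal \<eta> \<le> ereal (h r)) (at_right 0)"
    using assms(3) unfolding eventually_at_right_field by auto
  then have "ereal \<eta> \<le> Liminf (at_right 0) (\<lambda>r. ereal (h r))" by (rule Liminf_bounded)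
  then show False using assms by simp
qed

text \<open>Any number strictly between 0 and the lower limit is eventually a lower bound; it can be
  chosen real even when the lower limit is infinite.\<close>

lemma Liminf_pos_bounded_below:
  fixes h :: "real \<Rightarrow> real"
  assumes "0 < Liminf (at_right 0) (\<lambda>r. ereal (h r))"
  obtains c s0 where "0 < c" "0 < s0" "\<And>s. 0 < s \<Longrightarrow> s < s0 \<Longrightarrow> c \<le> h s"
proof -
  obtain c where c: "0 < ereal c" "ereal c < Liminf (at_right 0) (\<lambda>r. ereal (h r))"
    using ereal_dense2[OF assms] by auto
  then have "eventually (\<lambda>r. ereal c < ereal (h r)) (at_right 0)" by (intro less_LiminfD)
  then obtain b where "0 < b" "\<And>s. 0 < s \<Longrightarrow> s < b \<Longrightarrow> c < h s"
    unfolding eventually_at_right_field by auto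
  then show thesis using c that[of c b] by (auto intro: less_imp_le)
qed

theorem theorem1p2:
  fixes p :: real
    and \<Psi> :: "real \<Rightarrow> real"
    and M :: "'a::complete_space measure"
    and E :: "('a \<Rightarrow> real) \<Rightarrow> real"
    and F :: "('a \<Rightarrow> real) set"
    and \<Gamma> :: "('a \<Rightarrow> real) \<Rightarrow> 'a measure"
  assumes "1 < p"
    and "scale_function \<Psi>"
    and "regular_local_dirichlet_space p M E F \<Gamma>"
    and "volume_doubling M"
    and "poincare_inequality p \<Psi> M F \<Gamma>"
  shows "(Liminf (at_right 0) (\<lambda>r. ereal (\<Psi> r / r powr p)) = 0 \<longrightarrow> vanishing_modulus p M)
       \<and> (chain_condition TYPE('a) \<and> capacity_upper_bound \<Psi> M E F
            \<and> Liminf (at_right 0) (\<lambda>r. ereal (\<Psi> r / r powr p)) > 0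
            \<longrightarrow> \<not> vanishing_modulus p M)"
proof -
  obtain C D where "doubling_dirichlet_space p M E F \<Gamma> C D"
    using doubling_dirichlet_spaceI[OF assms(3,4)] .
  then interpret doubling_dirichlet_space p M E F \<Gamma> C D .
  have pos: "0 < \<Psi> r" if "0 < r" for r
    using assms(2) that unfolding scale_function_def by (auto simp: bij_betw_def)
  show ?thesis
  proof (intro conjI impI)
    assume "Liminf (at_right 0) (\<lambda>r. ereal (\<Psi> r / r powr p)) = 0"
    then show "vanishing_modulus p M"
      by (intro vanishing_modulus_of_scale[OF assms(5) pos] Liminf_eq_0_small)
  next
    assume *: "chain_condition TYPE('a) \<and> capacity_upper_bound \<Psi> M E F
            \<and> Liminf (at_right 0) (\<lambda>r. ereal (\<Psi> r / r powr p)) > 0"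
    then have "0 < Liminf (at_right 0) (\<lambda>r. ereal (\<Psi> r / r powr p))" by blast
    then obtain c s0 where big: "0 < c" "0 < s0" "\<And>s. 0 < s \<Longrightarrow> s < s0 \<Longrightarrow> c \<le> \<Psi> s / s powr p"
      by (rule Liminf_pos_bounded_below) blast
    have cap: "capacity_upper_bound \<Psi> M E F" using * by blast
    have fin: "emeasure M UNIV < \<infinity>" by (rule finite_measure_of_capacity[OF cap pos])
    have "compact (UNIV :: 'a set)"
      by (rule compact_of_finite_doubling[OF doubling_space_axioms fin])
    then show "\<not> vanishing_modulus p M"
      by (rule modulus_not_vanishing[OF _ fin assms(5) pos cap big])
  qed
qed

end
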